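(* (Modified de Vries Duality Theorem) The functor $\overline U:\mathsf C/\!\sim\;\to\mathbf{deVBoo}/\!\backsim$ defined in the context is an equivalence of categories. As a consequence, the category $\mathbf{KHaus}$ of compact Hausdorff spaces and continuous maps is dually equivalent to the category $\mathbf{deVBoo}/\!\backsim$, whose objects are complete normal contact algebras and whose morphisms are equivalence classes of Boolean homomorphisms reflecting the contact relations, composed by ordinary map composition of their representatives.
   Context: A contact algebra is a Boolean algebra $A$ (operations $\vee,\wedge$, complement $^*$, constants $0,1$) with a relation $\frown$ such that for all $a,b,c$: $a\frown a$ whenever $a>0$; $a\frown b$ implies $a>0$ and $b>0$; $a\frown b$ implies $b\frown a$; $a\frown(b\vee c)$ iff $a\frown b$ or $a\frown c$. It is normal if also: $a\not\frown b$ implies $a\not\frown c$ and $b\not\frown c^*$ for some $c$; and if $a<1$ then there is $b>0$ with $b\not\frown a$. Put $a\ll b\iff a\not\frown b^*$. A de Vries algebra is a complete normal contact algebra. $\mathbf{deVBoo}$: objects are complete normal contact algebras; morphisms $\varphi:A\to A'$ are Boolean homomorphisms reflecting the contact relation ($\varphi(a)\frown\varphi(b)\Rightarrow a\frown b$), equivalently, preserving $\ll$; composition is map composition. For a monotone map $\varphi:A\to A'$ of de Vries algebras put $\varphi^{\vee}(a)=\bigvee\{\varphi(b)\mid b\ll a\}$. For parallel morphisms of $\mathbf{deVBoo}$ put $\varphi\backsim\psi\iff\varphi^\vee=\psi^\vee$; this is a compatible equivalence relation, $\langle\varphi\rangle$ denotes the class of $\varphi$, and $\mathbf{deVBoo}/\!\backsim$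 is the quotient category. For a Boolean algebra $A$, $\mathsf{Ult}(A)$ is its Stone space of ultrafilters, with the sets $\varepsilon_A(a)=\{\mathfrak u\mid a\in\mathfrak u\}$ as basic open sets; for a homomorphism $\varphi$, $\mathsf{Ult}(\varphi)$ takes inverse images. A continuous map $p:X\to Y$ of compact Hausdorff spaces is irreducible if $p(X)=Y$ and $p(Z)\neq Y$ for every proper closed subset $Z$ of $X$. Let $\mathcal P$ be the class of irreducible continuous maps of compact Hausdorff spaces with extremally disconnected domain. The category $\mathsf C$ has as objects the pairs $(A,p)$ with $A$ a complete Boolean algebra and $p:\mathsf{Ult}(A)\to Y$ in $\mathcal P$; morphisms $(\varphi,f):(A,p:\mathsf{Ult}(A)\to Y)\to(A',p':\mathsf{Ult}(A')\to Y')$ are pairs of a Boolean homomorphism $\varphi:A\to A'$ and a continuous map $f:Y'\to Y$ with $p\circ\mathsf{Ult}(\varphi)=f\circ p'$; composition is $(\varphi',f')\circ(\varphi,f)=(\varphi'\circ\varphi,f\circ f')$. Put $(\varphi,f)\sim(\psi,g)\iff f=g$ for parallel morphisms; $[\varphi,f]$ is the class of $(\varphi,f)$ and $\mathsf C/\!\sim$ the quotient category. The functor $\overline U$ sends $(A,p)$ to $A$ provided with the normal contact relation $a\frown_p b\iff p(\varepsilon_A(a))\cap p(\varepsilon_A(b))\neq\emptyset$, and $[\varphi,f]$ to $\langle\varphi\rangle$. *)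

theory Defs
  imports
    "HOL-Analysis.Analysis"
    "HOL-Algebra.Complete_Lattice"
    "HOL-Library.Equipollence"
begin

section \<open>Categories, functors, quotients and equivalences\<close>

text \<open>Hom-sets need not be disjoint: \<open>Cmp C a b c g f\<close> is the composite \<open>g \<circ> f\<close> of
  \<open>f \<in> Mor C a b\<close> and \<open>g \<in> Mor C b c\<close>, and receives the three objects explicitly.\<close>

record ('o, 'm) cat =
  Ob  :: "'o set"
  Mor :: "'o \<Rightarrow> 'o \<Rightarrow> 'm set"
  Idt :: "'o \<Rightarrow> 'm"
  Cmp :: "'o \<Rightarrow> 'o \<Rightarrow> 'o \<Rightarrow> 'm \<Rightarrow> 'm \<Rightarrow> 'm"

definition category :: "('o, 'm) cat \<Rightarrow> bool" where
  "category C \<longleftrightarrow>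
     (\<forall>a\<in>Ob C. Idt C a \<in> Mor C a a) \<and>
     (\<forall>a\<in>Ob C. \<forall>b\<in>Ob C. \<forall>c\<in>Ob C. \<forall>f\<in>Mor C a b. \<forall>g\<in>Mor C b c.
        Cmp C a b c g f \<in> Mor C a c) \<and>
     (\<forall>a\<in>Ob C. \<forall>b\<in>Ob C. \<forall>f\<in>Mor C a b.
        Cmp C a a b f (Idt C a) = f \<and> Cmp C a b b (Idt C b) f = f) \<and>
     (\<forall>a\<in>Ob C. \<forall>b\<in>Ob C. \<forall>c\<in>Ob C. \<forall>d\<in>Ob C.
        \<forall>f\<in>Mor C a b. \<forall>g\<in>Mor C b c. \<forall>h\<in>Mor C c d.
        Cmp C a b d (Cmp C b c d h g) f = Cmp C a c d h (Cmp C a b c g f))"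

definition opposite :: "('o, 'm) cat \<Rightarrow> ('o, 'm) cat" where
  "opposite C = \<lparr>Ob = Ob C, Mor = (\<lambda>a b. Mor C b a), Idt = Idt C,
     Cmp = (\<lambda>a b c g f. Cmp C c b a f g)\<rparr>"

definition quotient_cat ::
    "('o, 'm) cat \<Rightarrow> ('o \<Rightarrow> 'o \<Rightarrow> ('m \<times> 'm) set) \<Rightarrow> ('o, 'm set) cat" where
  "quotient_cat C R = \<lparr>Ob = Ob C,
     Mor = (\<lambda>a b. Mor C a b // R a b),
     Idt = (\<lambda>a. R a a `` {Idt C a}),
     Cmp = (\<lambda>a b c G F. \<Union>g\<in>G. \<Union>f\<in>F. R a c `` {Cmp C a b c g f})\<rparr>"

record ('o, 'm, 'p, 'n) func =
  on_ob  :: "'o \<Rightarrow> 'p"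
  on_mor :: "'o \<Rightarrow> 'o \<Rightarrow> 'm \<Rightarrow> 'n"

definition is_functor ::
    "('o, 'm) cat \<Rightarrow> ('p, 'n) cat \<Rightarrow> ('o, 'm, 'p, 'n) func \<Rightarrow> bool" where
  "is_functor C D F \<longleftrightarrow>
     category C \<and> category D \<and>
     (\<forall>a\<in>Ob C. on_ob F a \<in> Ob D) \<and>
     (\<forall>a\<in>Ob C. \<forall>b\<in>Ob C. \<forall>f\<in>Mor C a b.
        on_mor F a b f \<in> Mor D (on_ob F a) (on_ob F b)) \<and>
     (\<forall>a\<in>Ob C. on_mor F a a (Idt C a) = Idt D (on_ob F a)) \<and>
     (\<forall>a\<in>Ob C. \<forall>b\<in>Ob C. \<forall>c\<in>Ob C. \<forall>f\<in>Mor C a b. \<forall>g\<in>Mor C b c.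
        on_mor F a c (Cmp C a b c g f) =
        Cmp D (on_ob F a) (on_ob F b) (on_ob F c) (on_mor F b c g) (on_mor F a b f))"

definition id_func :: "('o, 'm, 'o, 'm) func" where
  "id_func = \<lparr>on_ob = (\<lambda>a. a), on_mor = (\<lambda>a b f. f)\<rparr>"

definition comp_func ::
    "('p, 'n, 'q, 'l) func \<Rightarrow> ('o, 'm, 'p, 'n) func \<Rightarrow> ('o, 'm, 'q, 'l) func" where
  "comp_func G F = \<lparr>on_ob = (\<lambda>a. on_ob G (on_ob F a)),
     on_mor = (\<lambda>a b f. on_mor G (on_ob F a) (on_ob F b) (on_mor F a b f))\<rparr>"

definition iso_mor :: "('o, 'm) cat \<Rightarrow> 'o \<Rightarrow> 'o \<Rightarrow> 'm \<Rightarrow> bool" where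
  "iso_mor C a b f \<longleftrightarrow> f \<in> Mor C a b \<and>
     (\<exists>g\<in>Mor C b a. Cmp C a b a g f = Idt C a \<and> Cmp C b a b f g = Idt C b)"

definition nat_isomorphic ::
    "('o, 'm) cat \<Rightarrow> ('p, 'n) cat \<Rightarrow> ('o, 'm, 'p, 'n) func \<Rightarrow> ('o, 'm, 'p, 'n) func \<Rightarrow> bool" where
  "nat_isomorphic C D F G \<longleftrightarrow>
     (\<exists>\<eta>. (\<forall>a\<in>Ob C. iso_mor D (on_ob F a) (on_ob G a) (\<eta> a)) \<and>
          (\<forall>a\<in>Ob C. \<forall>b\<in>Ob C. \<forall>f\<in>Mor C a b.
             Cmp D (on_ob F a) (on_ob F b) (on_ob G b) (\<eta> b) (on_mor F a b f) =
             Cmp D (on_ob F a) (on_ob G a) (on_ob G b) (on_mor G a b f) (\<eta> a)))"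

definition is_equivalence ::
    "('o, 'm) cat \<Rightarrow> ('p, 'n) cat \<Rightarrow> ('o, 'm, 'p, 'n) func \<Rightarrow> bool" where
  "is_equivalence C D F \<longleftrightarrow>
     is_functor C D F \<and>
     (\<exists>G. is_functor D C G \<and>
          nat_isomorphic C C (comp_func G F) id_func \<and>
          nat_isomorphic D D (comp_func F G) id_func)"

definition dually_equivalent :: "('o, 'm) cat \<Rightarrow> ('p, 'n) cat \<Rightarrow> bool" where
  "dually_equivalent C D \<longleftrightarrow> (\<exists>F. is_equivalence (opposite C) D F)"


section \<open>Boolean algebras and contact algebras\<close>

locale boolean_lattice = Lattice.bounded_lattice L for L (structure) +
  assumes meet_join_distrib:
      "\<lbrakk>x \<in> carrier L; y \<in> carrier L; z \<in> carrier L\<rbrakk>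
       \<Longrightarrow> x \<sqinter> (y \<squnion> z) = (x \<sqinter> y) \<squnion> (x \<sqinter> z)"
    and complemented:
      "x \<in> carrier L \<Longrightarrow> \<exists>y\<in>carrier L. x \<squnion> y = \<top> \<and> x \<sqinter> y = \<bottom>"

definition cmpl :: "('a, 'b) gorder_scheme \<Rightarrow> 'a \<Rightarrow> 'a" where
  "cmpl L x = (THE y. y \<in> carrier L \<and> x \<squnion>\<^bsub>L\<^esub> y = \<top>\<^bsub>L\<^esub> \<and> x \<sqinter>\<^bsub>L\<^esub> y = \<bottom>\<^bsub>L\<^esub>)"

definition complete_boolean :: "('a, 'b) gorder_scheme \<Rightarrow> bool" where
  "complete_boolean L \<longleftrightarrow> boolean_lattice L \<and> Complete_Lattice.complete_lattice L"

text \<open>Maps between carriers are \<^const>\<open>extensional\<close> throughout, so that equality of HOL functions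
  is equality of maps, and are composed by \<^const>\<open>compose\<close>.\<close>

definition boolean_hom ::
    "('a, 'b) gorder_scheme \<Rightarrow> ('c, 'd) gorder_scheme \<Rightarrow> ('a \<Rightarrow> 'c) set" where
  "boolean_hom L M = {\<phi> \<in> carrier L \<rightarrow>\<^sub>E carrier M.
     (\<forall>x\<in>carrier L. \<forall>y\<in>carrier L. \<phi> (x \<squnion>\<^bsub>L\<^esub> y) = \<phi> x \<squnion>\<^bsub>M\<^esub> \<phi> y) \<and>
     (\<forall>x\<in>carrier L. \<forall>y\<in>carrier L. \<phi> (x \<sqinter>\<^bsub>L\<^esub> y) = \<phi> x \<sqinter>\<^bsub>M\<^esub> \<phi> y) \<and>
     (\<forall>x\<in>carrier L. \<phi> (cmpl L x) = cmpl M (\<phi> x)) \<and>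
     \<phi> \<bottom>\<^bsub>L\<^esub> = \<bottom>\<^bsub>M\<^esub> \<and> \<phi> \<top>\<^bsub>L\<^esub> = \<top>\<^bsub>M\<^esub>}"

record 'a contact_lattice = "'a gorder" +
  contact :: "'a \<Rightarrow> 'a \<Rightarrow> bool" (infix \<open>\<frown>\<index>\<close> 50)

locale contact_algebra = boolean_lattice A for A (structure) +
  assumes contact_refl: "\<lbrakk>a \<in> carrier A; \<bottom> \<sqsubset> a\<rbrakk> \<Longrightarrow> a \<frown> a"
    and contact_pos:
      "\<lbrakk>a \<in> carrier A; b \<in> carrier A; a \<frown> b\<rbrakk> \<Longrightarrow> \<bottom> \<sqsubset> a \<and> \<bottom> \<sqsubset> b"
    and contact_sym: "\<lbrakk>a \<in> carrier A; b \<in> carrier A; a \<frown> b\<rbrakk> \<Longrightarrow> b \<frown> a"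
    and contact_join:
      "\<lbrakk>a \<in> carrier A; b \<in> carrier A; c \<in> carrier A\<rbrakk>
       \<Longrightarrow> a \<frown> (b \<squnion> c) \<longleftrightarrow> a \<frown> b \<or> a \<frown> c"

locale normal_contact_algebra = contact_algebra +
  assumes contact_separation:
      "\<lbrakk>a \<in> carrier A; b \<in> carrier A; \<not> a \<frown> b\<rbrakk>
       \<Longrightarrow> \<exists>c\<in>carrier A. \<not> a \<frown> c \<and> \<not> b \<frown> cmpl A c"
    and contact_dense:
      "\<lbrakk>a \<in> carrier A; a \<sqsubset> \<top>\<rbrakk> \<Longrightarrow> \<exists>b\<in>carrier A. \<bottom> \<sqsubset> b \<and> \<not> b \<frown> a"

definition de_vries_algebra :: "'a contact_lattice \<Rightarrow> bool" where
  "de_vries_algebra A \<longleftrightarrow> normal_contact_algebra A \<and> complete_boolean A"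

definition well_inside :: "('a, 'b) contact_lattice_scheme \<Rightarrow> 'a \<Rightarrow> 'a \<Rightarrow> bool" where
  "well_inside A a b \<longleftrightarrow> \<not> a \<frown>\<^bsub>A\<^esub> cmpl A b"


section \<open>Size conditions\<close>

text \<open>The carriers of algebras and spaces are subsets of types \<open>'a\<close> and \<open>'y\<close>, respectively, and
  a ``category of all small structures'' consists of the structures whose carriers satisfy a given
  predicate on sets. Taking the same type and predicate on both sides, and requiring it to be
  bounded by itself under power sets, yields smallness with respect to a universe.\<close>

definition size_class :: "('a set \<Rightarrow> bool) \<Rightarrow> bool" where
  "size_class S \<longleftrightarrow> (\<forall>A B. S A \<longrightarrow> B \<subseteq> A \<longrightarrow> S B)"

definition powerset_bounded :: "('a set \<Rightarrow> bool) \<Rightarrow> ('b set \<Rightarrow> bool) \<Rightarrow> bool" where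
  "powerset_bounded S T \<longleftrightarrow> (\<forall>A. S A \<longrightarrow> (\<exists>B. T B \<and> Pow A \<lesssim> B))"


section \<open>The category of de Vries algebras and its quotient\<close>

definition deVBoo_mor :: "'a contact_lattice \<Rightarrow> 'a contact_lattice \<Rightarrow> ('a \<Rightarrow> 'a) set" where
  "deVBoo_mor A A' = {\<phi> \<in> boolean_hom A A'.
     \<forall>a\<in>carrier A. \<forall>b\<in>carrier A. \<phi> a \<frown>\<^bsub>A'\<^esub> \<phi> b \<longrightarrow> a \<frown>\<^bsub>A\<^esub> b}"

definition deVBoo :: "('a set \<Rightarrow> bool) \<Rightarrow> ('a contact_lattice, 'a \<Rightarrow> 'a) cat" where
  "deVBoo S = \<lparr>Ob = {A. de_vries_algebra A \<and> S (carrier A)},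
     Mor = deVBoo_mor,
     Idt = (\<lambda>A. \<lambda>a\<in>carrier A. a),
     Cmp = (\<lambda>A A' A'' \<psi> \<phi>. compose (carrier A) \<psi> \<phi>)\<rparr>"

definition lower_reg ::
    "'a contact_lattice \<Rightarrow> 'a contact_lattice \<Rightarrow> ('a \<Rightarrow> 'a) \<Rightarrow> 'a \<Rightarrow> 'a" where
  "lower_reg A A' \<phi> =
     (\<lambda>a\<in>carrier A. \<Squnion>\<^bsub>A'\<^esub> (\<phi> ` {b \<in> carrier A. well_inside A b a}))"

definition deVBoo_rel ::
    "'a contact_lattice \<Rightarrow> 'a contact_lattice \<Rightarrow> (('a \<Rightarrow> 'a) \<times> ('a \<Rightarrow> 'a)) set" where
  "deVBoo_rel A A' = {(\<phi>, \<psi>). \<phi> \<in> deVBoo_mor A A' \<and> \<psi> \<in> deVBoo_mor A A' \<and>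
     lower_reg A A' \<phi> = lower_reg A A' \<psi>}"

abbreviation deVBoo_quot ::
    "('a set \<Rightarrow> bool) \<Rightarrow> ('a contact_lattice, ('a \<Rightarrow> 'a) set) cat" where
  "deVBoo_quot S \<equiv> quotient_cat (deVBoo S) deVBoo_rel"


section \<open>Stone spaces and irreducible maps\<close>

definition proper_filter :: "('a, 'b) gorder_scheme \<Rightarrow> 'a set \<Rightarrow> bool" where
  "proper_filter L F \<longleftrightarrow> F \<subseteq> carrier L \<and> \<top>\<^bsub>L\<^esub> \<in> F \<and> \<bottom>\<^bsub>L\<^esub> \<notin> F \<and>
     (\<forall>x\<in>F. \<forall>y\<in>F. x \<sqinter>\<^bsub>L\<^esub> y \<in> F) \<and>
     (\<forall>x\<in>F. \<forall>y\<in>carrier L. x \<sqsubseteq>\<^bsub>L\<^esub> y \<longrightarrow> y \<in> F)"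

definition ultrafilter_on :: "('a, 'b) gorder_scheme \<Rightarrow> 'a set \<Rightarrow> bool" where
  "ultrafilter_on L u \<longleftrightarrow> proper_filter L u \<and> (\<forall>F. proper_filter L F \<and> u \<subseteq> F \<longrightarrow> F = u)"

definition stone_set :: "('a, 'b) gorder_scheme \<Rightarrow> 'a \<Rightarrow> 'a set set" where
  "stone_set L a = {u. ultrafilter_on L u \<and> a \<in> u}"

text \<open>The sets \<^const>\<open>stone_set\<close> are closed under finite intersections and cover the set of all
  ultrafilters, so they form a base of the topology they generate.\<close>

definition Ult :: "('a, 'b) gorder_scheme \<Rightarrow> 'a set topology" where
  "Ult L = topology_generated_by (stone_set L ` carrier L)"

definition Ult_map ::
    "('a, 'b) gorder_scheme \<Rightarrow> ('c, 'd) gorder_scheme \<Rightarrow> ('a \<Rightarrow> 'c) \<Rightarrow> 'c set \<Rightarrow> 'a set" where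
  "Ult_map L M \<phi> = (\<lambda>u\<in>topspace (Ult M). {a \<in> carrier L. \<phi> a \<in> u})"

definition ext_continuous :: "'x topology \<Rightarrow> 'y topology \<Rightarrow> ('x \<Rightarrow> 'y) set" where
  "ext_continuous X Y = {f \<in> extensional (topspace X). continuous_map X Y f}"

definition extremally_disconnected :: "'x topology \<Rightarrow> bool" where
  "extremally_disconnected X \<longleftrightarrow> (\<forall>U. openin X U \<longrightarrow> openin X (X closure_of U))"

definition compact_Hausdorff :: "'x topology \<Rightarrow> bool" where
  "compact_Hausdorff X \<longleftrightarrow> compact_space X \<and> Hausdorff_space X"

definition irreducible_map :: "'x topology \<Rightarrow> 'y topology \<Rightarrow> ('x \<Rightarrow> 'y) \<Rightarrow> bool" where
  "irreducible_map X Y p \<longleftrightarrow> p ` topspace X = topspace Y \<and>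
     (\<forall>Z. closedin X Z \<and> Z \<noteq> topspace X \<longrightarrow> p ` Z \<noteq> topspace Y)"

definition class_P :: "'x topology \<Rightarrow> 'y topology \<Rightarrow> ('x \<Rightarrow> 'y) \<Rightarrow> bool" where
  "class_P X Y p \<longleftrightarrow> compact_Hausdorff X \<and> compact_Hausdorff Y \<and>
     p \<in> ext_continuous X Y \<and> irreducible_map X Y p \<and> extremally_disconnected X"


section \<open>The category C and its quotient\<close>

text \<open>An object \<open>(L, p, Y)\<close> stands for the pair \<open>(L, p : Ult L \<rightarrow> Y)\<close>.\<close>

type_synonym ('a, 'y) C_ob = "'a gorder \<times> ('a set \<Rightarrow> 'y) \<times> 'y topology"
type_synonym ('a, 'y) C_mor = "('a \<Rightarrow> 'a) \<times> ('y \<Rightarrow> 'y)"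

fun C_hom :: "('a, 'y) C_ob \<Rightarrow> ('a, 'y) C_ob \<Rightarrow> ('a, 'y) C_mor set" where
  "C_hom (L, p, Y) (L', p', Y') =
     {(\<phi>, f). \<phi> \<in> boolean_hom L L' \<and> f \<in> ext_continuous Y' Y \<and>
        compose (topspace (Ult L')) p (Ult_map L L' \<phi>) = compose (topspace (Ult L')) f p'}"

fun C_id :: "('a, 'y) C_ob \<Rightarrow> ('a, 'y) C_mor" where
  "C_id (L, p, Y) = (\<lambda>a\<in>carrier L. a, \<lambda>y\<in>topspace Y. y)"

fun C_comp ::
    "('a, 'y) C_ob \<Rightarrow> ('a, 'y) C_ob \<Rightarrow> ('a, 'y) C_ob \<Rightarrow>
     ('a, 'y) C_mor \<Rightarrow> ('a, 'y) C_mor \<Rightarrow> ('a, 'y) C_mor" where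
  "C_comp (L, p, Y) (L', p', Y') (L'', p'', Y'') (\<phi>', f') (\<phi>, f) =
     (compose (carrier L) \<phi>' \<phi>, compose (topspace Y'') f f')"

definition Cat_C ::
    "('a set \<Rightarrow> bool) \<Rightarrow> ('y set \<Rightarrow> bool) \<Rightarrow> (('a, 'y) C_ob, ('a, 'y) C_mor) cat" where
  "Cat_C S T = \<lparr>Ob = {(L, p, Y). complete_boolean L \<and> class_P (Ult L) Y p \<and>
                        S (carrier L) \<and> T (topspace Y)},
     Mor = C_hom, Idt = C_id, Cmp = C_comp\<rparr>"

definition C_rel ::
    "('a, 'y) C_ob \<Rightarrow> ('a, 'y) C_ob \<Rightarrow> (('a, 'y) C_mor \<times> ('a, 'y) C_mor) set" where
  "C_rel X X' = {((\<phi>, f), (\<psi>, g)). (\<phi>, f) \<in> C_hom X X' \<and> (\<psi>, g) \<in> C_hom X X' \<and> f = g}"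

abbreviation C_quot ::
    "('a set \<Rightarrow> bool) \<Rightarrow> ('y set \<Rightarrow> bool) \<Rightarrow> (('a, 'y) C_ob, ('a, 'y) C_mor set) cat" where
  "C_quot S T \<equiv> quotient_cat (Cat_C S T) C_rel"


section \<open>The functor\<close>

fun U_ob :: "('a, 'y) C_ob \<Rightarrow> 'a contact_lattice" where
  "U_ob (L, p, Y) = \<lparr>carrier = carrier L, eq = (.=\<^bsub>L\<^esub>), le = (\<sqsubseteq>\<^bsub>L\<^esub>),
     contact = (\<lambda>a b. p ` stone_set L a \<inter> p ` stone_set L b \<noteq> {})\<rparr>"

text \<open>A class \<open>\<Phi>\<close> is sent to the union of the classes of \<open>\<phi>\<close> over all \<open>(\<phi>, f) \<in> \<Phi>\<close>; these classes
  coincide exactly if the assignment does not depend on the choice of a representative.\<close>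

definition U_bar ::
    "(('a, 'y) C_ob, ('a, 'y) C_mor set, 'a contact_lattice, ('a \<Rightarrow> 'a) set) func" where
  "U_bar = \<lparr>on_ob = U_ob,
     on_mor = (\<lambda>X X' \<Phi>. \<Union>(\<phi>, f)\<in>\<Phi>. deVBoo_rel (U_ob X) (U_ob X') `` {\<phi>})\<rparr>"


section \<open>Compact Hausdorff spaces\<close>

definition KHaus_on :: "('y topology \<Rightarrow> bool) \<Rightarrow> ('y topology, 'y \<Rightarrow> 'y) cat" where
  "KHaus_on P = \<lparr>Ob = {Y. compact_Hausdorff Y \<and> P Y},
     Mor = ext_continuous,
     Idt = (\<lambda>Y. \<lambda>y\<in>topspace Y. y),
     Cmp = (\<lambda>X Y Z g f. compose (topspace X) g f)\<rparr>"

definition KHaus :: "('y set \<Rightarrow> bool) \<Rightarrow> ('y topology, 'y \<Rightarrow> 'y) cat" where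
  "KHaus T = KHaus_on (\<lambda>Y. T (topspace Y))"

definition regular_opens :: "'y topology \<Rightarrow> 'y set set" where
  "regular_opens Y = {U. Y interior_of (Y closure_of U) = U}"

text \<open>The dual of a space is carried by a copy of its algebra of regular open sets. If \<open>T\<close> is
  power-set bounded by \<open>S\<close>, every space with small carrier has a small such algebra, so the second
  conjunct below is automatic. Without any closure assumption it singles out the spaces whose duals
  live in the given category of algebras.\<close>

definition KHaus_slice ::
    "('a set \<Rightarrow> bool) \<Rightarrow> ('y set \<Rightarrow> bool) \<Rightarrow> ('y topology, 'y \<Rightarrow> 'y) cat" where
  "KHaus_slice S T =
     KHaus_on (\<lambda>Y. T (topspace Y) \<and> (\<exists>B. S B \<and> regular_opens Y \<lesssim> B))"

end

theory Submission
  imports Defs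
begin

text \<open>Everything rests on one notion: a contact algebra \<open>A\<close> together with an irreducible map
\<open>p\<close> from its Stone space onto a compact Hausdorff space \<open>Y\<close> such that two elements are
in contact exactly if the images of their Stone sets meet. Call \<open>Y\<close> a dual space of
\<open>A\<close>. The objects of \<open>C\<close> are complete Boolean algebras with a dual space of the contact
relation induced by \<open>p\<close>, and three facts about dual spaces carry the theorem.

First, objects. The contact relation induced by an irreducible map is always normal
(\<open>dual_space.de_vries\<close>). Conversely a de Vries algebra has a dual space: two ultrafilters
are identified if every member of the one is in contact with every member of the other; this is
an equivalence relation by the separation axiom, its saturations of closed sets are closed, and
the density axiom makes the quotient map irreducible (\<open>de_vries_dual_space\<close>). Every
compact Hausdorff space is the dual space of its algebra of regular open sets, where an
ultrafilter is sent to its limit (\<open>compact_Hausdorff_dual_algebra\<close>).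

Second, morphisms. A Boolean homomorphism reflects contact exactly if the map of Stone spaces
that it induces respects the identifications made by the irreducible maps, that is, if it
descends to a continuous map \<open>f\<close> of dual spaces (\<open>dual_imp_mor\<close>, \<open>mor_imp_dual\<close>).
Under Stone duality, \<open>\<phi>\<^sup>\<or>(a)\<close> is the closure of the preimage under
\<open>f \<circ> p'\<close> of an open set of \<open>Y\<close> that depends only on \<open>a\<close>, and these open sets
separate points. So \<open>\<phi>\<^sup>\<or> = \<psi>\<^sup>\<or>\<close> says precisely that the maps \<open>f\<close> coincide
(\<open>lower_reg_eq_iff\<close>): \<open>deVBoo_rel\<close> on homomorphisms corresponds to \<open>C_rel\<close> on squares.
This gives at once that \<open>deVBoo_rel\<close> is a congruence and that \<open>U_bar\<close> is full and faithful.

Third, lifting. Since the Stone space of a complete Boolean algebra is extremally disconnected,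
every continuous map of dual spaces comes from some homomorphism
(\<open>dual_map_exists\<close>, Gleason's theorem). With the identity map this shows that two algebras
with the same dual space are isomorphic modulo \<open>deVBoo_rel\<close> (\<open>same_dual_space_iso\<close>),
whence essential surjectivity; with arbitrary maps it shows that sending \<open>Y\<close> to an algebra
dual to it and \<open>f\<close> to the class of all homomorphisms descending to \<open>f\<close> is a full and
faithful contravariant functor on compact Hausdorff spaces.

The size conditions enter only through the carriers. The points of the dual space of \<open>A\<close>
are represented by ultrafilters, hence by subsets of the carrier of \<open>A\<close>, and conversely the
regular open sets of a dual space of \<open>A\<close> inject into the carrier of \<open>A\<close>
(\<open>regular_opens_lepoll\<close>).\<close>

section \<open>Categories, congruences and equivalences\<close>

lemma categoryD:
  assumes "category C"
  shows "\<And>a. a \<in> Ob C \<Longrightarrow> Idt C a \<in> Mor C a a"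
    "\<And>a b c f g. \<lbrakk>a \<in> Ob C; b \<in> Ob C; c \<in> Ob C; f \<in> Mor C a b; g \<in> Mor C b c\<rbrakk>
      \<Longrightarrow> Cmp C a b c g f \<in> Mor C a c"
    "\<And>a b f. \<lbrakk>a \<in> Ob C; b \<in> Ob C; f \<in> Mor C a b\<rbrakk> \<Longrightarrow> Cmp C a a b f (Idt C a) = f"
    "\<And>a b f. \<lbrakk>a \<in> Ob C; b \<in> Ob C; f \<in> Mor C a b\<rbrakk> \<Longrightarrow> Cmp C a b b (Idt C b) f = f"
    "\<And>a b c d f g h. \<lbrakk>a \<in> Ob C; b \<in> Ob C; c \<in> Ob C; d \<in> Ob C; f \<in> Mor C a b; g \<in> Mor C b c; h \<in> Mor C c d\<rbrakk>
      \<Longrightarrow> Cmp C a b d (Cmp C b c d h g) f = Cmp C a c d h (Cmp C a b c g f)"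
  using assms by (simp_all add: category_def)

lemma category_opposite: "category C \<Longrightarrow> category (opposite C)"
  unfolding category_def[of "opposite C"]
  by (simp add: opposite_def categoryD)

lemma is_functorD:
  assumes "is_functor C D F"
  shows "category C" "category D" "\<And>a. a \<in> Ob C \<Longrightarrow> on_ob F a \<in> Ob D"
    "\<And>a b f. \<lbrakk>a \<in> Ob C; b \<in> Ob C; f \<in> Mor C a b\<rbrakk> \<Longrightarrow> on_mor F a b f \<in> Mor D (on_ob F a) (on_ob F b)"
    "\<And>a. a \<in> Ob C \<Longrightarrow> on_mor F a a (Idt C a) = Idt D (on_ob F a)"
    "\<And>a b c f g. \<lbrakk>a \<in> Ob C; b \<in> Ob C; c \<in> Ob C; f \<in> Mor C a b; g \<in> Mor C b c\<rbrakk>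
      \<Longrightarrow> on_mor F a c (Cmp C a b c g f) =
        Cmp D (on_ob F a) (on_ob F b) (on_ob F c) (on_mor F b c g) (on_mor F a b f)"
  using assms by (simp_all add: is_functor_def)

definition fully_faithful :: "('o, 'm) cat \<Rightarrow> ('p, 'n) cat \<Rightarrow> ('o, 'm, 'p, 'n) func \<Rightarrow> bool" where
  "fully_faithful C D F \<longleftrightarrow> (\<forall>a\<in>Ob C. \<forall>b\<in>Ob C.
     bij_betw (on_mor F a b) (Mor C a b) (Mor D (on_ob F a) (on_ob F b)))"

definition essentially_surjective :: "('o, 'm) cat \<Rightarrow> ('p, 'n) cat \<Rightarrow> ('o, 'm, 'p, 'n) func \<Rightarrow> bool" where
  "essentially_surjective C D F \<longleftrightarrow> (\<forall>d\<in>Ob D. \<exists>c\<in>Ob C. \<exists>f. iso_mor D (on_ob F c) d f)"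

text \<open>Hom-sets need not be disjoint, so a quasi-inverse is not determined by its values on arrows
regarded as mere elements: the preimages under the functor are taken hom-set by hom-set. With
chosen isomorphisms \<open>e d : F (G d) \<rightarrow> d\<close>, the value of the quasi-inverse at \<open>h\<close> is
the unique arrow that \<open>F\<close> maps to \<open>(e d')\<inverse> \<circ> h \<circ> e d\<close>. Every equation about the
quasi-inverse is checked after applying \<open>F\<close>.\<close>

theorem fully_faithful_essentially_surjective_equivalence:
  assumes F: "is_functor C D F" and ff: "fully_faithful C D F" and es: "essentially_surjective C D F"
  shows "is_equivalence C D F"
proof -
  note C = categoryD[OF is_functorD(1)[OF F]]
  note D = categoryD[OF is_functorD(2)[OF F]]
  note FD = is_functorD(3-)[OF F]
  have "\<forall>d\<in>Ob D. \<exists>c f h. c \<in> Ob C \<and> f \<in> Mor D (on_ob F c) d \<and> h \<in> Mor D d (on_ob F c) \<and>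
      Cmp D (on_ob F c) d (on_ob F c) h f = Idt D (on_ob F c) \<and> Cmp D d (on_ob F c) d f h = Idt D d"
    using es unfolding essentially_surjective_def iso_mor_def by blast
  then obtain G e e' where
    G: "\<And>d. d \<in> Ob D \<Longrightarrow> G d \<in> Ob C" and
    e: "\<And>d. d \<in> Ob D \<Longrightarrow> e d \<in> Mor D (on_ob F (G d)) d" and
    e': "\<And>d. d \<in> Ob D \<Longrightarrow> e' d \<in> Mor D d (on_ob F (G d))" and
    e'e: "\<And>d. d \<in> Ob D \<Longrightarrow> Cmp D (on_ob F (G d)) d (on_ob F (G d)) (e' d) (e d) = Idt D (on_ob F (G d))" and
    ee': "\<And>d. d \<in> Ob D \<Longrightarrow> Cmp D d (on_ob F (G d)) d (e d) (e' d) = Idt D d"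
    by metis
  \<comment> \<open>The chosen isomorphisms cancel in nested composites; this is how associativity is used below.\<close>
  have can1: "Cmp D a (on_ob F (G d)) d (e d) (Cmp D a d (on_ob F (G d)) (e' d) x) = x"
    if "a \<in> Ob D" "d \<in> Ob D" "x \<in> Mor D a d" for a d x
    using that D(5)[of a d "on_ob F (G d)" d x "e' d" "e d"] D(4) G FD(1) e e' ee' by simp
  have can2: "Cmp D a d (on_ob F (G d)) (e' d) (Cmp D a (on_ob F (G d)) d (e d) x) = x"
    if "a \<in> Ob D" "d \<in> Ob D" "x \<in> Mor D a (on_ob F (G d))" for a d x
    using that D(5)[of a "on_ob F (G d)" d "on_ob F (G d)" x "e d" "e' d"] D(4) G FD(1) e e' e'e by simp
  define K where "K a b = inv_into (Mor C a b) (on_mor F a b)" for a b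
  have K: "K a b h \<in> Mor C a b \<and> on_mor F a b (K a b h) = h"
    if "a \<in> Ob C" "b \<in> Ob C" "h \<in> Mor D (on_ob F a) (on_ob F b)" for a b h
  proof -
    have im: "on_mor F a b ` Mor C a b = Mor D (on_ob F a) (on_ob F b)"
      using ff that by (auto simp: fully_faithful_def bij_betw_def)
    have "h \<in> on_mor F a b ` Mor C a b" using that(3) by (simp add: im)
    then show ?thesis unfolding K_def by (simp add: inv_into_into f_inv_into_f)
  qed
  have inj: "f = g" if "a \<in> Ob C" "b \<in> Ob C" "f \<in> Mor C a b" "g \<in> Mor C a b" "on_mor F a b f = on_mor F a b g" for a b f g
    using ff that by (auto simp: fully_faithful_def bij_betw_def inj_on_def)
  define Q where "Q d d' h = Cmp D (on_ob F (G d)) d' (on_ob F (G d')) (e' d')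
      (Cmp D (on_ob F (G d)) d d' h (e d))" for d d' h
  have Q: "Q d d' h \<in> Mor D (on_ob F (G d)) (on_ob F (G d'))" if "d \<in> Ob D" "d' \<in> Ob D" "h \<in> Mor D d d'" for d d' h
    using that G FD(1) e e' by (auto simp: Q_def intro!: D(2))
  define H where
    "H = \<lparr>on_ob = G, on_mor = (\<lambda>d d' h. K (G d) (G d') (Q d d' h))\<rparr>"
  have H_mor: "on_mor H d d' h \<in> Mor C (G d) (G d')" and FH: "on_mor F (G d) (G d') (on_mor H d d' h) = Q d d' h"
    if "d \<in> Ob D" "d' \<in> Ob D" "h \<in> Mor D d d'" for d d' h
    using K[OF G G Q] that by (simp_all add: H_def)
  have H_ob: "on_ob H = G" by (simp add: H_def)
  have "is_functor D C H"
    unfolding is_functor_def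
  proof (intro conjI ballI)
    show "category D" "category C" using is_functorD[OF F] by blast+
    fix a assume a: "a \<in> Ob D"
    show "on_ob H a \<in> Ob C" using G a by (simp add: H_ob)
    show "on_mor H a a (Idt D a) = Idt C (on_ob H a)" unfolding H_ob
    proof (rule inj[OF G G])
      show "on_mor F (G a) (G a) (on_mor H a a (Idt D a)) = on_mor F (G a) (G a) (Idt C (G a))"
        using a FH[OF a a D(1)] FD(3) G D(4) FD(1) e e'e by (simp add: Q_def)
    qed (use a H_mor D(1) C(1) G in auto)
    fix b assume b: "b \<in> Ob D"
    { fix f assume f: "f \<in> Mor D a b"
      then show "on_mor H a b f \<in> Mor C (on_ob H a) (on_ob H b)" using H_mor a b by (simp add: H_ob) }
    fix c f g assume c: "c \<in> Ob D" and f: "f \<in> Mor D a b" and g: "g \<in> Mor D b c"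
    note o = a b c G[OF a] G[OF b] G[OF c] FD(1)[OF G[OF a]] FD(1)[OF G[OF b]] FD(1)[OF G[OF c]]
    note m = f g e[OF a] e[OF b] e[OF c] e'[OF a] e'[OF b] e'[OF c]
    have gf: "Cmp D a b c g f \<in> Mor D a c" using D(2) o f g by blast
    show "on_mor H a c (Cmp D a b c g f) =
        Cmp C (on_ob H a) (on_ob H b) (on_ob H c) (on_mor H b c g) (on_mor H a b f)"
      unfolding H_ob
    proof (rule inj[OF G G])
      have fe: "Cmp D (on_ob F (G a)) a b f (e a) \<in> Mor D (on_ob F (G a)) b"
        using o m by (intro D(2)) auto
      have "on_mor F (G a) (G c) (on_mor H a c (Cmp D a b c g f)) = Q a c (Cmp D a b c g f)"
        using FH o gf by blast
      also have "\<dots> = Cmp D (on_ob F (G a)) c (on_ob F (G c)) (e' c)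
            (Cmp D (on_ob F (G a)) b c g (Cmp D (on_ob F (G a)) a b f (e a)))"
        using o m by (simp add: Q_def D(5))
      also have "\<dots> = Cmp D (on_ob F (G a)) c (on_ob F (G c)) (e' c) (Cmp D (on_ob F (G a)) b c g
           (Cmp D (on_ob F (G a)) (on_ob F (G b)) b (e b) (Q a b f)))"
        using can1[of "on_ob F (G a)" b] o fe by (simp add: Q_def)
      also have "\<dots> = Cmp D (on_ob F (G a)) (on_ob F (G b)) (on_ob F (G c)) (Q b c g) (Q a b f)"
        using o m Q[OF a b f] D(2)[of "on_ob F (G b)" b c "e b" g] unfolding Q_def[of b c] by (simp add: D(5))
      also have "\<dots> = on_mor F (G a) (G c) (Cmp C (G a) (G b) (G c) (on_mor H b c g) (on_mor H a b f))"
        using FD(4)[of "G a" "G b" "G c"] H_mor FH o f g by simp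
      finally show "on_mor F (G a) (G c) (on_mor H a c (Cmp D a b c g f)) =
        on_mor F (G a) (G c) (Cmp C (G a) (G b) (G c) (on_mor H b c g) (on_mor H a b f))" .
    qed (use o H_mor gf f g C(2) in auto)
  qed
  moreover have "nat_isomorphic C C (comp_func H F) id_func"
    unfolding nat_isomorphic_def comp_func_def id_func_def func.simps H_ob
  proof (intro exI conjI ballI)
    let ?\<eta> = "\<lambda>a. K (G (on_ob F a)) a (e (on_ob F a))"
    have \<eta>: "?\<eta> a \<in> Mor C (G (on_ob F a)) a" and F\<eta>: "on_mor F (G (on_ob F a)) a (?\<eta> a) = e (on_ob F a)"
      if "a \<in> Ob C" for a using K[OF G _ e] FD(1) that by auto
    fix a assume a: "a \<in> Ob C"
    let ?d = "on_ob F a"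
    have d: "?d \<in> Ob D" using FD(1) a .
    note o = a d G[OF d] FD(1)[OF G[OF d]]
    define \<theta> where "\<theta> = K a (G ?d) (e' ?d)"
    have \<theta>: "\<theta> \<in> Mor C a (G ?d)" "on_mor F a (G ?d) \<theta> = e' ?d"
      unfolding \<theta>_def using K[OF a G e'] d by auto
    have "Cmp C (G ?d) a (G ?d) \<theta> (?\<eta> a) = Idt C (G ?d)"
    proof (rule inj[OF o(3) o(3)])
      show "Cmp C (G ?d) a (G ?d) \<theta> (?\<eta> a) \<in> Mor C (G ?d) (G ?d)"
        using C(2)[OF o(3) a o(3) \<eta>[OF a] \<theta>(1)] .
      show "on_mor F (G ?d) (G ?d) (Cmp C (G ?d) a (G ?d) \<theta> (?\<eta> a)) =
          on_mor F (G ?d) (G ?d) (Idt C (G ?d))"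
        using FD(4)[OF o(3) a o(3) \<eta>[OF a] \<theta>(1)] FD(3)[OF o(3)] e'e[OF d] F\<eta>[OF a] \<theta>(2) by simp
    qed (rule C(1)[OF o(3)])
    moreover have "Cmp C a (G ?d) a (?\<eta> a) \<theta> = Idt C a"
      by (rule inj[OF a a]) (use o \<theta> \<eta> F\<eta> C(1,2) FD(3,4) ee' in simp_all)
    ultimately show "iso_mor C (G ?d) a (?\<eta> a)"
      unfolding iso_mor_def using \<eta>[OF a] \<theta>(1) by blast
    fix b f assume b: "b \<in> Ob C" and f: "f \<in> Mor C a b"
    let ?c = "on_ob F b"
    have c: "?c \<in> Ob D" using FD(1) b .
    have Ff: "on_mor F a b f \<in> Mor D ?d ?c" using FD(2) a b f .
    show "Cmp C (G ?d) (G ?c) b (?\<eta> b) (on_mor H ?d ?c (on_mor F a b f)) = Cmp C (G ?d) a b f (?\<eta> a)"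
    proof (rule inj[OF G[OF d] b])
      have "Cmp D (on_ob F (G ?d)) ?d ?c (on_mor F a b f) (e ?d) \<in> Mor D (on_ob F (G ?d)) ?c"
        using o c Ff e[OF d] by (intro D(2)) auto
      then show "on_mor F (G ?d) b (Cmp C (G ?d) (G ?c) b (?\<eta> b) (on_mor H ?d ?c (on_mor F a b f))) =
          on_mor F (G ?d) b (Cmp C (G ?d) a b f (?\<eta> a))"
        using o b c f Ff G[OF c] \<eta> F\<eta> H_mor[OF d c Ff] FH[OF d c Ff] can1 by (simp add: FD(4) Q_def)
    qed (use o b c f Ff G[OF c] \<eta> H_mor[OF d c Ff] in \<open>auto intro!: C(2)\<close>)
  qed
  moreover have "nat_isomorphic D D (comp_func F H) id_func"
    unfolding nat_isomorphic_def comp_func_def id_func_def func.simps H_ob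
  proof (intro exI conjI ballI)
    fix a assume a: "a \<in> Ob D"
    show "iso_mor D (on_ob F (G a)) a (e a)"
      unfolding iso_mor_def using a e e' e'e ee' by (auto intro!: bexI[of _ "e' a"])
    fix b f assume b: "b \<in> Ob D" and f: "f \<in> Mor D a b"
    have "Cmp D (on_ob F (G a)) a b f (e a) \<in> Mor D (on_ob F (G a)) b"
      using a b f G FD(1) e by (intro D(2)) auto
    then show "Cmp D (on_ob F (G a)) (on_ob F (G b)) b (e b) (on_mor F (G a) (G b) (on_mor H a b f)) =
        Cmp D (on_ob F (G a)) a b f (e a)"
      using FH[OF a b f] can1 a b FD(1) G by (simp add: Q_def)
  qed
  ultimately show ?thesis unfolding is_equivalence_def using F by blast
qed

definition congruence :: "('o, 'm) cat \<Rightarrow> ('o \<Rightarrow> 'o \<Rightarrow> ('m \<times> 'm) set) \<Rightarrow> bool" where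
  "congruence C R \<longleftrightarrow>
     (\<forall>a\<in>Ob C. \<forall>b\<in>Ob C. equiv (Mor C a b) (R a b)) \<and>
     (\<forall>a\<in>Ob C. \<forall>b\<in>Ob C. \<forall>c\<in>Ob C. \<forall>(f, f')\<in>R a b. \<forall>(g, g')\<in>R b c.
        (Cmp C a b c g f, Cmp C a b c g' f') \<in> R a c)"

lemma congruenceD:
  assumes "congruence C R"
  shows "\<And>a b. a \<in> Ob C \<Longrightarrow> b \<in> Ob C \<Longrightarrow> equiv (Mor C a b) (R a b)"
    "\<And>a b c f f' g g'. \<lbrakk>a \<in> Ob C; b \<in> Ob C; c \<in> Ob C; (f, f') \<in> R a b; (g, g') \<in> R b c\<rbrakk>
      \<Longrightarrow> (Cmp C a b c g f, Cmp C a b c g' f') \<in> R a c"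
  using assms unfolding congruence_def by (blast, fastforce)

lemma congruenceI:
  assumes "\<And>a b. a \<in> Ob C \<Longrightarrow> b \<in> Ob C \<Longrightarrow> equiv (Mor C a b) (R a b)"
    and "\<And>a b c f f' g g'. \<lbrakk>a \<in> Ob C; b \<in> Ob C; c \<in> Ob C; (f, f') \<in> R a b; (g, g') \<in> R b c\<rbrakk>
      \<Longrightarrow> (Cmp C a b c g f, Cmp C a b c g' f') \<in> R a c"
  shows "congruence C R"
  unfolding congruence_def using assms by (intro conjI ballI) auto

lemma quotient_cat_simps:
  "Ob (quotient_cat C R) = Ob C" "Mor (quotient_cat C R) a b = Mor C a b // R a b"
  "Idt (quotient_cat C R) a = R a a `` {Idt C a}"
  by (simp_all add: quotient_cat_def)

lemma equiv_class_UN_const: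
  assumes "equiv A r" "x \<in> A" and "\<And>y. (x, y) \<in> r \<Longrightarrow> h y = H"
  shows "(\<Union>y\<in>r `` {x}. h y) = H"
  using assms equiv_class_self[OF assms(1,2)] by blast

text \<open>The composite of two classes is defined as a union over all representatives; compatibility of the
relation with composition makes that union a single class, that of any composite of
representatives.\<close>

lemma quotient_cat_Cmp:
  assumes R: "congruence C R" and C: "category C"
    and o: "a \<in> Ob C" "b \<in> Ob C" "c \<in> Ob C" and fg: "f \<in> Mor C a b" "g \<in> Mor C b c"
  shows "Cmp (quotient_cat C R) a b c (R b c `` {g}) (R a b `` {f}) = R a c `` {Cmp C a b c g f}"
proof -
  have E: "equiv (Mor C a b) (R a b)" "equiv (Mor C b c) (R b c)" "equiv (Mor C a c) (R a c)"
    using congruenceD(1)[OF R] o by blast+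
  have "R a c `` {Cmp C a b c g' f'} = R a c `` {Cmp C a b c g f}"
    if "(f, f') \<in> R a b" "(g, g') \<in> R b c" for f' g'
    using equiv_class_eq[OF E(3) congruenceD(2)[OF R o that]] by simp
  then have "(\<Union>f'\<in>R a b `` {f}. R a c `` {Cmp C a b c g' f'}) = R a c `` {Cmp C a b c g f}"
    if "(g, g') \<in> R b c" for g'
    using that by (intro equiv_class_UN_const[OF E(1) fg(1)])
  then have "(\<Union>g'\<in>R b c `` {g}. \<Union>f'\<in>R a b `` {f}. R a c `` {Cmp C a b c g' f'}) = R a c `` {Cmp C a b c g f}"
    by (intro equiv_class_UN_const[OF E(2) fg(2)])
  then show ?thesis by (simp add: quotient_cat_def)
qed

lemma category_quotient_cat:
  assumes C: "category C" and R: "congruence C R"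
  shows "category (quotient_cat C R)"
  unfolding category_def quotient_cat_simps
proof (intro conjI ballI)
  note D = categoryD[OF C]
  note Q = quotient_cat_Cmp[OF R C]
  fix a assume a: "a \<in> Ob C"
  show "R a a `` {Idt C a} \<in> Mor C a a // R a a" using D(1)[OF a] by (rule quotientI)
  fix b assume b: "b \<in> Ob C"
  { fix F assume "F \<in> Mor C a b // R a b"
    then obtain f where f: "f \<in> Mor C a b" "F = R a b `` {f}" by (rule quotientE)
    show "Cmp (quotient_cat C R) a a b F (R a a `` {Idt C a}) = F"
      using f a b D(1,3) Q by simp
    show "Cmp (quotient_cat C R) a b b (R b b `` {Idt C b}) F = F"
      using f a b D(1,4) Q by simp }
  fix c F G assume c: "c \<in> Ob C" and F: "F \<in> Mor C a b // R a b" and G: "G \<in> Mor C b c // R b c"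
  obtain f where f: "f \<in> Mor C a b" "F = R a b `` {f}" using F by (rule quotientE)
  obtain g where g: "g \<in> Mor C b c" "G = R b c `` {g}" using G by (rule quotientE)
  show "Cmp (quotient_cat C R) a b c G F \<in> Mor C a c // R a c"
    unfolding f(2) g(2) Q[OF a b c f(1) g(1)] using D(2)[OF a b c f(1) g(1)] by (rule quotientI)
  fix d H assume d: "d \<in> Ob C" and H: "H \<in> Mor C c d // R c d"
  obtain h where h: "h \<in> Mor C c d" "H = R c d `` {h}" using H by (rule quotientE)
  show "Cmp (quotient_cat C R) a b d (Cmp (quotient_cat C R) b c d H G) F =
      Cmp (quotient_cat C R) a c d H (Cmp (quotient_cat C R) a b c G F)"
    using a b c d f g h D(2,5) Q by simp
qed

text \<open>The functor induced on quotient categories. No representative is chosen: the value at a class is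
the union of the classes of the values, which is a class if the functor preserves the relations.\<close>

definition quotient_functor ::
    "('p \<Rightarrow> 'p \<Rightarrow> ('n \<times> 'n) set) \<Rightarrow> ('o, 'm, 'p, 'n) func \<Rightarrow> ('o, 'm set, 'p, 'n set) func" where
  "quotient_functor R F = \<lparr>on_ob = on_ob F,
     on_mor = (\<lambda>a b \<Phi>. \<Union>f\<in>\<Phi>. R (on_ob F a) (on_ob F b) `` {on_mor F a b f})\<rparr>"

text \<open>The hypothesis \<open>ker\<close> asks for preservation and reflection of the relations at once. One
direction makes the functor well defined on classes, the other makes it faithful.\<close>

lemma quotient_functor:
  assumes F: "is_functor C D F" and Q: "congruence C Q" and R: "congruence D R"
    and full: "\<And>a b h. \<lbrakk>a \<in> Ob C; b \<in> Ob C; h \<in> Mor D (on_ob F a) (on_ob F b)\<rbrakk> \<Longrightarrow> \<exists>f\<in>Mor C a b. on_mor F a b f = h"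
    and ker: "\<And>a b f g. \<lbrakk>a \<in> Ob C; b \<in> Ob C; f \<in> Mor C a b; g \<in> Mor C a b\<rbrakk>
      \<Longrightarrow> (on_mor F a b f, on_mor F a b g) \<in> R (on_ob F a) (on_ob F b) \<longleftrightarrow> (f, g) \<in> Q a b"
  shows "is_functor (quotient_cat C Q) (quotient_cat D R) (quotient_functor R F)"
    and "fully_faithful (quotient_cat C Q) (quotient_cat D R) (quotient_functor R F)"
proof -
  let ?F = "quotient_functor R F" and ?R = "\<lambda>a b. R (on_ob F a) (on_ob F b)"
  have C: "category C" and D: "category D" using is_functorD[OF F] by blast+
  note FD = is_functorD(3-)[OF F]
  have eqQ: "equiv (Mor C a b) (Q a b)" if "a \<in> Ob C" "b \<in> Ob C" for a b
    using congruenceD(1)[OF Q] that .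
  have eqR: "equiv (Mor D (on_ob F a) (on_ob F b)) (?R a b)" if "a \<in> Ob C" "b \<in> Ob C" for a b
    using congruenceD(1)[OF R] that FD(1) by blast
  have ob: "on_ob ?F = on_ob F" by (simp add: quotient_functor_def)
  have mor: "on_mor ?F a b (Q a b `` {f}) = ?R a b `` {on_mor F a b f}"
    if ab: "a \<in> Ob C" "b \<in> Ob C" and f: "f \<in> Mor C a b" for a b f
  proof -
    have "?R a b `` {on_mor F a b g} = ?R a b `` {on_mor F a b f}"
      if fg: "(f, g) \<in> Q a b" for g
    proof -
      have "g \<in> Mor C a b" using fg eqQ[OF ab] by (auto simp: equiv_def refl_on_def)
      then have "(on_mor F a b f, on_mor F a b g) \<in> ?R a b" using ker[OF ab f] fg by blast
      then show ?thesis using equiv_class_eq[OF eqR[OF ab]] by metis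
    qed
    then show ?thesis unfolding quotient_functor_def func.simps
      by (intro equiv_class_UN_const[OF eqQ[OF ab] f])
  qed
  show "is_functor (quotient_cat C Q) (quotient_cat D R) ?F"
    unfolding is_functor_def quotient_cat_simps ob
  proof (intro conjI ballI)
    show "category (quotient_cat C Q)" "category (quotient_cat D R)"
      using category_quotient_cat C D Q R by blast+
    fix a assume a: "a \<in> Ob C"
    show "on_ob F a \<in> Ob D" using FD(1) a .
    show "on_mor ?F a a (Q a a `` {Idt C a}) = R (on_ob F a) (on_ob F a) `` {Idt D (on_ob F a)}"
      using mor[OF a a] categoryD(1)[OF C a] FD(3)[OF a] by simp
    fix b assume b: "b \<in> Ob C"
    { fix \<Phi> assume "\<Phi> \<in> Mor C a b // Q a b"
      then obtain f where f: "f \<in> Mor C a b" "\<Phi> = Q a b `` {f}" by (rule quotientE)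
      show "on_mor ?F a b \<Phi> \<in> Mor D (on_ob F a) (on_ob F b) // ?R a b"
        unfolding f(2) mor[OF a b f(1)] using FD(2)[OF a b f(1)] by (rule quotientI) }
    fix c \<Phi> \<Psi> assume c: "c \<in> Ob C" and \<Phi>: "\<Phi> \<in> Mor C a b // Q a b" and \<Psi>: "\<Psi> \<in> Mor C b c // Q b c"
    obtain f where f: "f \<in> Mor C a b" "\<Phi> = Q a b `` {f}" using \<Phi> by (rule quotientE)
    obtain g where g: "g \<in> Mor C b c" "\<Psi> = Q b c `` {g}" using \<Psi> by (rule quotientE)
    show "on_mor ?F a c (Cmp (quotient_cat C Q) a b c \<Psi> \<Phi>) =
        Cmp (quotient_cat D R) (on_ob F a) (on_ob F b) (on_ob F c) (on_mor ?F b c \<Psi>) (on_mor ?F a b \<Phi>)"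
      using a b c f g FD mor categoryD(2)[OF C] by (simp add: quotient_cat_Cmp[OF Q C] quotient_cat_Cmp[OF R D])
  qed
  show "fully_faithful (quotient_cat C Q) (quotient_cat D R) ?F"
    unfolding fully_faithful_def quotient_cat_simps ob
  proof (intro ballI)
    fix a b assume ab: "a \<in> Ob C" "b \<in> Ob C"
    show "bij_betw (on_mor ?F a b) (Mor C a b // Q a b) (Mor D (on_ob F a) (on_ob F b) // ?R a b)"
      unfolding bij_betw_def
    proof
      show "inj_on (on_mor ?F a b) (Mor C a b // Q a b)"
      proof (rule inj_onI)
        fix \<Phi> \<Psi> assume \<Phi>: "\<Phi> \<in> Mor C a b // Q a b" and \<Psi>: "\<Psi> \<in> Mor C a b // Q a b"
          and eq: "on_mor ?F a b \<Phi> = on_mor ?F a b \<Psi>"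
        obtain f where f: "f \<in> Mor C a b" "\<Phi> = Q a b `` {f}" using \<Phi> by (rule quotientE)
        obtain g where g: "g \<in> Mor C a b" "\<Psi> = Q a b `` {g}" using \<Psi> by (rule quotientE)
        have "?R a b `` {on_mor F a b f} = ?R a b `` {on_mor F a b g}"
          using eq f g mor[OF ab] by simp
        then have "(on_mor F a b f, on_mor F a b g) \<in> ?R a b"
          using eq_equiv_class[OF _ eqR[OF ab]] FD(2)[OF ab g(1)] by blast
        then have "(f, g) \<in> Q a b" using ker[OF ab f(1) g(1)] by blast
        then show "\<Phi> = \<Psi>" using equiv_class_eq[OF eqQ[OF ab]] f g by metis
      qed
      show "on_mor ?F a b ` (Mor C a b // Q a b) = Mor D (on_ob F a) (on_ob F b) // ?R a b"
      proof (intro equalityI subsetI)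
        fix \<Theta> assume "\<Theta> \<in> on_mor ?F a b ` (Mor C a b // Q a b)"
        then obtain \<Phi> where \<Phi>: "\<Phi> \<in> Mor C a b // Q a b" "\<Theta> = on_mor ?F a b \<Phi>" by blast
        obtain f where f: "f \<in> Mor C a b" "\<Phi> = Q a b `` {f}" using \<Phi>(1) by (rule quotientE)
        show "\<Theta> \<in> Mor D (on_ob F a) (on_ob F b) // ?R a b"
          unfolding \<Phi>(2) f(2) mor[OF ab f(1)] using FD(2)[OF ab f(1)] by (rule quotientI)
      next
        fix \<Theta> assume "\<Theta> \<in> Mor D (on_ob F a) (on_ob F b) // ?R a b"
        then obtain h where h: "h \<in> Mor D (on_ob F a) (on_ob F b)" "\<Theta> = ?R a b `` {h}" by (rule quotientE)
        obtain f where f: "f \<in> Mor C a b" "on_mor F a b f = h" using full[OF ab h(1)] by blast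
        have "\<Theta> = on_mor ?F a b (Q a b `` {f})" using mor[OF ab f(1)] f(2) h(2) by simp
        then show "\<Theta> \<in> on_mor ?F a b ` (Mor C a b // Q a b)" using quotientI[OF f(1)] by blast
      qed
    qed
  qed
qed

section \<open>Boolean lattices and their ultrafilters\<close>

text \<open>Lattice operations depend on the carrier and the order alone. This transports facts between a
lattice and the contact algebras built on it, which live in different record types.\<close>

lemma order_structure_cong:
  fixes L :: "('a, 'b) gorder_scheme" and M :: "('a, 'c) gorder_scheme"
  assumes "carrier L = carrier M" and "le L = le M"
  shows "Upper L = Upper M" "Lower L = Lower M" "least L = least M" "greatest L = greatest M"
    "Lattice.sup L = Lattice.sup M" "join L = join M" "meet L = meet M"
    "\<top>\<^bsub>L\<^esub> = \<top>\<^bsub>M\<^esub>" "\<bottom>\<^bsub>L\<^esub> = \<bottom>\<^bsub>M\<^esub>" "cmpl L = cmpl M"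
proof -
  show U: "Upper L = Upper M" and Lo: "Lower L = Lower M"
    using assms by (auto simp: fun_eq_iff Upper_def Lower_def)
  show l: "least L = least M" and g: "greatest L = greatest M"
    using assms by (auto simp: fun_eq_iff least_def greatest_def)
  show s: "Lattice.sup L = Lattice.sup M"
    by (simp add: fun_eq_iff sup_def U l)
  show j: "join L = join M" by (simp add: fun_eq_iff join_def s)
  show m: "meet L = meet M" by (simp add: fun_eq_iff meet_def inf_def Lo g)
  show t: "\<top>\<^bsub>L\<^esub> = \<top>\<^bsub>M\<^esub>" and b: "\<bottom>\<^bsub>L\<^esub> = \<bottom>\<^bsub>M\<^esub>"
    using assms by (simp_all add: top_def bottom_def l g)
  show "cmpl L = cmpl M" using assms by (simp add: fun_eq_iff cmpl_def j m t b)
qed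

lemma ultrafilter_cong:
  fixes L :: "('a, 'b) gorder_scheme" and M :: "('a, 'c) gorder_scheme"
  assumes "carrier L = carrier M" and "le L = le M"
  shows "ultrafilter_on L = ultrafilter_on M" "stone_set L = stone_set M" "Ult L = Ult M"
proof -
  note c = order_structure_cong[OF assms]
  have "proper_filter L = proper_filter M"
    using assms by (simp add: fun_eq_iff proper_filter_def c)
  then show u: "ultrafilter_on L = ultrafilter_on M"
    by (simp add: fun_eq_iff ultrafilter_on_def)
  then show s: "stone_set L = stone_set M" by (simp add: fun_eq_iff stone_set_def)
  show "Ult L = Ult M" using assms by (simp add: Ult_def s)
qed

context boolean_lattice
begin

lemma bottom_join_eq: "x \<in> carrier L \<Longrightarrow> \<bottom> \<squnion> x = x"
  using bottom_join by (simp add: eq_is_equal)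

lemma join_bottom_eq: "x \<in> carrier L \<Longrightarrow> x \<squnion> \<bottom> = x"
  using bottom_join_eq join_comm by metis

lemma top_meet_eq: "x \<in> carrier L \<Longrightarrow> \<top> \<sqinter> x = x"
  using top_meet by (simp add: eq_is_equal)

lemma meet_top_eq: "x \<in> carrier L \<Longrightarrow> x \<sqinter> \<top> = x"
  using top_meet_eq meet_comm by metis

lemma le_bottom_iff: "x \<in> carrier L \<Longrightarrow> x \<sqsubseteq> \<bottom> \<longleftrightarrow> x = \<bottom>"
  using le_antisym bottom_lower bottom_closed le_refl by metis

lemma join_meet_distrib:
  assumes "x \<in> carrier L" "y \<in> carrier L" "z \<in> carrier L"
  shows "x \<squnion> (y \<sqinter> z) = (x \<squnion> y) \<sqinter> (x \<squnion> z)"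
proof -
  have 1: "(x \<squnion> y) \<sqinter> x = x"
    using assms by (metis join_closed join_left le_iff_join meet_comm)
  have "(x \<squnion> y) \<sqinter> (x \<squnion> z) = ((x \<squnion> y) \<sqinter> x) \<squnion> ((x \<squnion> y) \<sqinter> z)"
    using assms by (simp add: meet_join_distrib)
  also have "\<dots> = x \<squnion> ((z \<sqinter> x) \<squnion> (z \<sqinter> y))"
    using assms 1 meet_join_distrib meet_comm[of L "x \<squnion> y" z] by simp
  also have "\<dots> = (x \<squnion> (z \<sqinter> x)) \<squnion> (z \<sqinter> y)"
    using assms by (simp add: join_assoc)
  also have "x \<squnion> (z \<sqinter> x) = x"
    using assms by (metis join_comm le_iff_meet meet_closed meet_right)
  finally show ?thesis using meet_comm by metis
qed

lemma complement_unique: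
  assumes "x \<in> carrier L" "y \<in> carrier L" "z \<in> carrier L"
    "x \<squnion> y = \<top>" "x \<sqinter> y = \<bottom>" "x \<squnion> z = \<top>" "x \<sqinter> z = \<bottom>"
  shows "y = z"
proof -
  have *: "v \<sqsubseteq> w" if "v \<in> carrier L" "w \<in> carrier L" "x \<sqinter> v = \<bottom>" "x \<squnion> w = \<top>" for v w
  proof -
    have "v = v \<sqinter> (x \<squnion> w)" using that by (simp add: meet_top_eq)
    also have "\<dots> = (v \<sqinter> x) \<squnion> (v \<sqinter> w)" using that assms meet_join_distrib[of v x w] by simp
    also have "\<dots> = v \<sqinter> w" using that assms meet_comm[of L v x] by (simp add: bottom_join_eq)
    finally show ?thesis using le_iff_join that by blast
  qed
  show ?thesis using * assms le_antisym by metis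
qed

lemma cmpl_props:
  assumes "x \<in> carrier L"
  shows "cmpl L x \<in> carrier L \<and> x \<squnion> cmpl L x = \<top> \<and> x \<sqinter> cmpl L x = \<bottom>"
proof -
  have "\<exists>!y. y \<in> carrier L \<and> x \<squnion> y = \<top> \<and> x \<sqinter> y = \<bottom>"
    using complemented[OF assms] complement_unique[OF assms] by blast
  from theI'[OF this] show ?thesis unfolding cmpl_def .
qed

lemma cmpl_closed [simp]: "x \<in> carrier L \<Longrightarrow> cmpl L x \<in> carrier L"
  and join_cmpl: "x \<in> carrier L \<Longrightarrow> x \<squnion> cmpl L x = \<top>"
  and meet_cmpl: "x \<in> carrier L \<Longrightarrow> x \<sqinter> cmpl L x = \<bottom>"
  using cmpl_props by auto

lemma cmpl_cmpl [simp]: "x \<in> carrier L \<Longrightarrow> cmpl L (cmpl L x) = x"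
  by (rule complement_unique[of "cmpl L x"])
    (use join_cmpl meet_cmpl join_comm meet_comm cmpl_closed in metis)+

lemma disjoint_le_cmpl:
  assumes "x \<in> carrier L" "y \<in> carrier L" "x \<sqinter> y = \<bottom>"
  shows "x \<sqsubseteq> cmpl L y"
proof -
  have "x = x \<sqinter> (y \<squnion> cmpl L y)" using assms by (simp add: join_cmpl meet_top_eq)
  also have "\<dots> = x \<sqinter> cmpl L y" using assms by (simp add: meet_join_distrib bottom_join_eq)
  finally show ?thesis using assms le_iff_join by simp
qed

lemma ultrafilter_onD:
  assumes "ultrafilter_on L u"
  shows "u \<subseteq> carrier L" "\<top> \<in> u" "\<bottom> \<notin> u" "\<And>x y. x \<in> u \<Longrightarrow> y \<in> u \<Longrightarrow> x \<sqinter> y \<in> u"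
    "\<And>x y. x \<in> u \<Longrightarrow> y \<in> carrier L \<Longrightarrow> x \<sqsubseteq> y \<Longrightarrow> y \<in> u"
    "\<And>F. proper_filter L F \<Longrightarrow> u \<subseteq> F \<Longrightarrow> F = u"
  using assms unfolding ultrafilter_on_def proper_filter_def by blast+

text \<open>If \<open>x\<close> is not in \<open>u\<close>, the filter generated by \<open>u\<close> and
\<open>x\<close> cannot be proper by maximality, so some \<open>f \<in> u\<close> is disjoint from \<open>x\<close> and lies below its complement.\<close>

lemma ultrafilter_cmpl:
  assumes u: "ultrafilter_on L u" and x: "x \<in> carrier L"
  shows "cmpl L x \<in> u \<longleftrightarrow> x \<notin> u"
proof
  assume "cmpl L x \<in> u"
  then show "x \<notin> u" using ultrafilter_onD(3,4)[OF u] meet_cmpl[OF x] by metis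
next
  assume nx: "x \<notin> u"
  let ?F = "{y \<in> carrier L. \<exists>f\<in>u. f \<sqinter> x \<sqsubseteq> y}"
  have uc: "f \<in> carrier L" if "f \<in> u" for f using that ultrafilter_onD(1)[OF u] by blast
  have "u \<subseteq> ?F" using uc x meet_left by blast
  moreover have "x \<in> ?F" using ultrafilter_onD(2)[OF u] x meet_right uc by blast
  ultimately have "\<not> proper_filter L ?F" using ultrafilter_onD(6)[OF u] nx by blast
  moreover have "\<top> \<in> ?F" using \<open>u \<subseteq> ?F\<close> ultrafilter_onD(2)[OF u] by blast
  moreover have "y \<sqinter> z \<in> ?F" if y: "y \<in> ?F" and z: "z \<in> ?F" for y z
  proof -
    obtain f g where fg: "f \<in> u" "f \<sqinter> x \<sqsubseteq> y" "g \<in> u" "g \<sqinter> x \<sqsubseteq> z" using y z by blast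
    have c: "f \<in> carrier L" "g \<in> carrier L" "y \<in> carrier L" "z \<in> carrier L"
      using fg uc y z by auto
    have h: "(f \<sqinter> g) \<sqinter> x \<sqsubseteq> f \<sqinter> x" "(f \<sqinter> g) \<sqinter> x \<sqsubseteq> g \<sqinter> x"
      using c x by (meson meet_closed meet_le meet_left meet_right le_trans)+
    have "(f \<sqinter> g) \<sqinter> x \<sqsubseteq> y \<sqinter> z"
      using c x h fg by (meson meet_closed meet_le le_trans)
    then show ?thesis using ultrafilter_onD(4)[OF u fg(1,3)] c by auto
  qed
  moreover have "z \<in> ?F" if "y \<in> ?F" "z \<in> carrier L" "y \<sqsubseteq> z" for y z
    using that x uc by (blast intro: le_trans meet_closed)
  ultimately have "\<bottom> \<in> ?F" unfolding proper_filter_def by blast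
  then obtain f where f: "f \<in> u" "f \<sqinter> x = \<bottom>" using le_bottom_iff uc x by auto
  then show "cmpl L x \<in> u"
    using disjoint_le_cmpl[of f x] ultrafilter_onD(5)[OF u f(1)] uc x by auto
qed

lemma ultrafilter_meet:
  assumes "ultrafilter_on L u" "x \<in> carrier L" "y \<in> carrier L"
  shows "x \<sqinter> y \<in> u \<longleftrightarrow> x \<in> u \<and> y \<in> u"
  using ultrafilter_onD(4,5)[OF assms(1)] assms(2,3) meet_left[OF assms(2,3)] meet_right[OF assms(2,3)]
  by blast

lemma ultrafilter_join:
  assumes u: "ultrafilter_on L u" and "x \<in> carrier L" "y \<in> carrier L"
  shows "x \<squnion> y \<in> u \<longleftrightarrow> x \<in> u \<or> y \<in> u"
proof
  assume j: "x \<squnion> y \<in> u"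
  show "x \<in> u \<or> y \<in> u"
  proof (rule ccontr)
    assume "\<not> (x \<in> u \<or> y \<in> u)"
    then have "cmpl L x \<in> u" and ny: "y \<notin> u" using ultrafilter_cmpl assms by auto
    then have "cmpl L x \<sqinter> (x \<squnion> y) \<in> u" using ultrafilter_onD(4)[OF u] j by blast
    moreover have "cmpl L x \<sqinter> (x \<squnion> y) = cmpl L x \<sqinter> y"
      using assms meet_join_distrib meet_cmpl meet_comm[of L "cmpl L x" x] bottom_join_eq by simp
    ultimately show False using ny ultrafilter_meet assms by auto
  qed
next
  assume "x \<in> u \<or> y \<in> u"
  then show "x \<squnion> y \<in> u"
    using ultrafilter_onD(5)[OF u _ join_closed[OF assms(2,3)]] join_left[OF assms(2,3)]
      join_right[OF assms(2,3)] by blast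
qed

lemma ultrafilterI:
  assumes "u \<subseteq> carrier L" "\<top> \<in> u"
    and m: "\<And>x y. x \<in> carrier L \<Longrightarrow> y \<in> carrier L \<Longrightarrow> x \<sqinter> y \<in> u \<longleftrightarrow> x \<in> u \<and> y \<in> u"
    and c: "\<And>x. x \<in> carrier L \<Longrightarrow> cmpl L x \<in> u \<longleftrightarrow> x \<notin> u"
  shows "ultrafilter_on L u"
proof -
  have b: "\<bottom> \<notin> u" using m[of \<top> "cmpl L \<top>"] c[of \<top>] assms(2) meet_cmpl[of \<top>] by auto
  have up: "y \<in> u" if "x \<in> u" "y \<in> carrier L" "x \<sqsubseteq> y" for x y
    using that m[of x y] le_iff_join[of x y] assms(1) by auto
  have mt: "x \<sqinter> y \<in> u" if "x \<in> u" "y \<in> u" for x y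
    using that m[of x y] assms(1) by blast
  have "proper_filter L u" unfolding proper_filter_def
    using assms(1,2) b mt up by (intro conjI ballI impI) assumption+
  moreover have "F = u" if F: "proper_filter L F" "u \<subseteq> F" for F
  proof -
    have "x \<in> u" if "x \<in> F" for x
    proof (rule ccontr)
      assume "x \<notin> u"
      have x: "x \<in> carrier L" using F that by (auto simp: proper_filter_def)
      then have "cmpl L x \<in> F" using c \<open>x \<notin> u\<close> F by auto
      then show False using F that x meet_cmpl[OF x] unfolding proper_filter_def by metis
    qed
    then show ?thesis using F by blast
  qed
  ultimately show ?thesis unfolding ultrafilter_on_def by blast
qed

lemma proper_filter_extends:
  assumes F: "proper_filter L F"
  shows "\<exists>u. ultrafilter_on L u \<and> F \<subseteq> u"
proof -
  let ?A = "{G. proper_filter L G \<and> F \<subseteq> G}"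
  have "\<Union>\<C> \<in> ?A" if ne: "\<C> \<noteq> {}" and ch: "subset.chain ?A \<C>" for \<C>
  proof -
    have A: "\<And>G. G \<in> \<C> \<Longrightarrow> proper_filter L G \<and> F \<subseteq> G"
      and lin: "\<And>G H. G \<in> \<C> \<Longrightarrow> H \<in> \<C> \<Longrightarrow> G \<subseteq> H \<or> H \<subseteq> G"
      using ch unfolding subset_chain_def by blast+
    have "x \<sqinter> y \<in> \<Union>\<C>" if xy: "x \<in> \<Union>\<C>" "y \<in> \<Union>\<C>" for x y
    proof -
      obtain G where "G \<in> \<C>" "x \<in> G" "y \<in> G" using xy lin by blast
      then show ?thesis using A[of G] unfolding proper_filter_def by blast
    qed
    moreover have "y \<in> \<Union>\<C>" if "x \<in> \<Union>\<C>" "y \<in> carrier L" "x \<sqsubseteq> y" for x y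
      using that A unfolding proper_filter_def by blast
    moreover have "\<Union>\<C> \<subseteq> carrier L" "\<top> \<in> \<Union>\<C>" "\<bottom> \<notin> \<Union>\<C>" "F \<subseteq> \<Union>\<C>"
      using A ne unfolding proper_filter_def by blast+
    ultimately show ?thesis unfolding proper_filter_def by blast
  qed
  moreover have "?A \<noteq> {}" using F by blast
  ultimately obtain M where "M \<in> ?A" "\<forall>X\<in>?A. M \<subseteq> X \<longrightarrow> X = M"
    using subset_Zorn_nonempty[of ?A] by blast
  then show ?thesis unfolding ultrafilter_on_def by blast
qed

text \<open>The prime ideal theorem. The elements that cover \<open>a\<close> up
to an error in \<open>I\<close> form a proper filter which contains \<open>a\<close> and the complements of the members
of \<open>I\<close>; any ultrafilter above it works.\<close>

lemma ultrafilter_avoiding_ideal: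
  assumes I: "\<bottom> \<in> I" "\<And>x y. x \<in> I \<Longrightarrow> y \<in> I \<Longrightarrow> x \<squnion> y \<in> I"
      "\<And>x y. y \<in> I \<Longrightarrow> x \<in> carrier L \<Longrightarrow> x \<sqsubseteq> y \<Longrightarrow> x \<in> I" "I \<subseteq> carrier L"
    and a: "a \<in> carrier L" "a \<notin> I"
  shows "\<exists>u. ultrafilter_on L u \<and> a \<in> u \<and> u \<inter> I = {}"
proof -
  let ?F = "{x \<in> carrier L. \<exists>d\<in>I. a \<sqsubseteq> x \<squnion> d}"
  have Ic: "d \<in> carrier L" if "d \<in> I" for d using that I(4) by blast
  have upper: "a \<sqsubseteq> x \<squnion> (d \<squnion> e) \<and> a \<sqsubseteq> x \<squnion> (e \<squnion> d)"
    if "a \<sqsubseteq> x \<squnion> d" "x \<in> carrier L" "d \<in> carrier L" "e \<in> carrier L" for x d e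
  proof -
    have "a \<sqsubseteq> (x \<squnion> d) \<squnion> e"
      using le_trans[OF that(1) join_left[of "x \<squnion> d" e]] that a by simp
    then show ?thesis using join_assoc[of x d e] join_comm[of L e d] that by simp
  qed
  have "\<bottom> \<notin> ?F"
  proof
    assume "\<bottom> \<in> ?F"
    then obtain d where "d \<in> I" "a \<sqsubseteq> d" using bottom_join_eq Ic by auto
    then show False using I(3) a by blast
  qed
  moreover have "\<top> \<in> ?F" using I(1) a join_bottom_eq[of \<top>] by (auto intro!: bexI[of _ \<bottom>])
  moreover have "x \<sqinter> y \<in> ?F" if x: "x \<in> ?F" and y: "y \<in> ?F" for x y
  proof -
    obtain d e where de: "d \<in> I" "a \<sqsubseteq> x \<squnion> d" "e \<in> I" "a \<sqsubseteq> y \<squnion> e" using x y by blast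
    have c: "d \<in> carrier L" "e \<in> carrier L" "x \<in> carrier L" "y \<in> carrier L"
      using de Ic x y by auto
    have "a \<sqsubseteq> x \<squnion> (d \<squnion> e)" "a \<sqsubseteq> y \<squnion> (d \<squnion> e)"
      using upper[OF de(2) c(3,1,2)] upper[OF de(4) c(4,2,1)] by simp_all
    then have "a \<sqsubseteq> ((d \<squnion> e) \<squnion> x) \<sqinter> ((d \<squnion> e) \<squnion> y)"
      using c a meet_le join_comm[of L "d \<squnion> e"] by simp
    then have "a \<sqsubseteq> (x \<sqinter> y) \<squnion> (d \<squnion> e)"
      using join_meet_distrib[of "d \<squnion> e" x y] join_comm[of L "d \<squnion> e"] c by simp
    then show ?thesis using c I(2)[OF de(1,3)] by auto
  qed
  moreover have "y \<in> ?F" if "x \<in> ?F" "y \<in> carrier L" "x \<sqsubseteq> y" for x y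
  proof -
    obtain d where d: "d \<in> I" "a \<sqsubseteq> x \<squnion> d" "x \<in> carrier L" using \<open>x \<in> ?F\<close> by blast
    have dc: "d \<in> carrier L" using Ic d by blast
    have "x \<squnion> d \<sqsubseteq> y \<squnion> d"
      using le_trans[OF that(3) join_left[of y d]] join_right[of y d] that(2) d dc by (intro join_le) simp_all
    then have "a \<sqsubseteq> y \<squnion> d" using le_trans[OF d(2)] that(2) a d(3) dc by simp
    then show ?thesis using d that by blast
  qed
  ultimately have "proper_filter L ?F" unfolding proper_filter_def by blast
  then obtain u where u: "ultrafilter_on L u" "?F \<subseteq> u" using proper_filter_extends by blast
  have "a \<in> ?F" using a I(1) join_bottom_eq by (auto intro!: bexI[of _ \<bottom>])
  moreover have "d \<notin> u" if "d \<in> I" for d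
  proof -
    have "cmpl L d \<squnion> d = \<top>" using join_cmpl Ic[OF that] join_comm by metis
    then have "cmpl L d \<in> ?F" using that Ic a by (auto intro!: bexI[of _ d])
    then show ?thesis using u ultrafilter_cmpl[OF u(1) Ic[OF that]] by blast
  qed
  ultimately show ?thesis using u by blast
qed

section \<open>The Stone space\<close>

lemma mem_stone_set: "u \<in> stone_set L a \<longleftrightarrow> ultrafilter_on L u \<and> a \<in> u"
  by (simp add: stone_set_def)

lemma stone_set_top: "stone_set L \<top> = {u. ultrafilter_on L u}"
  using ultrafilter_onD(2) by (auto simp: stone_set_def)

lemma topspace_Ult: "topspace (Ult L) = {u. ultrafilter_on L u}"
proof -
  have "(\<Union>a\<in>carrier L. stone_set L a) = {u. ultrafilter_on L u}"
    using stone_set_top by (auto simp: stone_set_def)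
  then show ?thesis by (simp add: Ult_def)
qed

lemma stone_set_meet:
  "x \<in> carrier L \<Longrightarrow> y \<in> carrier L \<Longrightarrow> stone_set L (x \<sqinter> y) = stone_set L x \<inter> stone_set L y"
  using ultrafilter_meet by (auto simp: stone_set_def)

lemma stone_set_join:
  "x \<in> carrier L \<Longrightarrow> y \<in> carrier L \<Longrightarrow> stone_set L (x \<squnion> y) = stone_set L x \<union> stone_set L y"
  using ultrafilter_join by (auto simp: stone_set_def)

lemma stone_set_cmpl:
  "x \<in> carrier L \<Longrightarrow> stone_set L (cmpl L x) = topspace (Ult L) - stone_set L x"
  using ultrafilter_cmpl by (auto simp: stone_set_def topspace_Ult)

lemma stone_set_bottom: "stone_set L \<bottom> = {}"
  using ultrafilter_onD(3) by (auto simp: stone_set_def)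

lemma stone_set_subset_topspace: "stone_set L x \<subseteq> topspace (Ult L)"
  by (auto simp: stone_set_def topspace_Ult)

lemma stone_set_empty_iff:
  assumes "x \<in> carrier L" shows "stone_set L x = {} \<longleftrightarrow> x = \<bottom>"
proof
  assume e: "stone_set L x = {}"
  show "x = \<bottom>"
  proof (rule ccontr)
    assume "x \<noteq> \<bottom>"
    then have "\<exists>u. ultrafilter_on L u \<and> x \<in> u \<and> u \<inter> {\<bottom>} = {}"
      by (intro ultrafilter_avoiding_ideal) (use assms bottom_join_eq le_bottom_iff in auto)
    then show False using e by (auto simp: stone_set_def)
  qed
qed (simp add: stone_set_bottom)

lemma stone_set_subset_iff:
  assumes "x \<in> carrier L" "y \<in> carrier L"
  shows "stone_set L x \<subseteq> stone_set L y \<longleftrightarrow> x \<sqsubseteq> y"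
proof
  assume "stone_set L x \<subseteq> stone_set L y"
  then have "stone_set L (x \<sqinter> cmpl L y) = {}"
    using assms by (auto simp: stone_set_meet stone_set_cmpl)
  then have "x \<sqinter> cmpl L y = \<bottom>" using assms stone_set_empty_iff by simp
  then show "x \<sqsubseteq> y" using disjoint_le_cmpl[of x "cmpl L y"] assms by simp
qed (use assms ultrafilter_onD(5) in \<open>auto simp: stone_set_def\<close>)

lemma stone_set_eq_iff:
  assumes "x \<in> carrier L" "y \<in> carrier L"
  shows "stone_set L x = stone_set L y \<longleftrightarrow> x = y"
  using stone_set_subset_iff[OF assms] stone_set_subset_iff[OF assms(2,1)] assms le_antisym by auto

lemma openin_stone_set: "a \<in> carrier L \<Longrightarrow> openin (Ult L) (stone_set L a)"
  by (auto simp: Ult_def openin_topology_generated_by_iff intro: generate_topology_on.Basis)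

lemma closedin_stone_set: "a \<in> carrier L \<Longrightarrow> closedin (Ult L) (stone_set L a)"
  using openin_stone_set[of "cmpl L a"] stone_set_cmpl[of a] stone_set_subset_topspace
  by (simp add: closedin_def)

lemma openin_Ult_base:
  assumes "openin (Ult L) U" "u \<in> U"
  shows "\<exists>a\<in>carrier L. u \<in> stone_set L a \<and> stone_set L a \<subseteq> U"
proof -
  have "generate_topology_on (stone_set L ` carrier L) U"
    using assms(1) by (simp add: Ult_def openin_topology_generated_by_iff)
  then show ?thesis using assms(2)
  proof (induction arbitrary: u)
    case (Int V W)
    obtain a b where ab: "a \<in> carrier L" "b \<in> carrier L" "u \<in> stone_set L a" "stone_set L a \<subseteq> V"
       "u \<in> stone_set L b" "stone_set L b \<subseteq> W"
      using Int by (metis IntD1 IntD2)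
    then show ?case by (intro bexI[of _ "a \<sqinter> b"]) (auto simp: stone_set_meet)
  qed blast+
qed

lemma closedin_Ult_basic_complement:
  assumes "closedin (Ult L) Z" "Z \<noteq> topspace (Ult L)"
  shows "\<exists>a\<in>carrier L. a \<noteq> \<bottom> \<and> Z \<inter> stone_set L a = {}"
proof -
  obtain u where u: "u \<in> topspace (Ult L) - Z" using assms closedin_subset by fastforce
  moreover have "openin (Ult L) (topspace (Ult L) - Z)" using assms(1) by blast
  ultimately obtain a where "a \<in> carrier L" "u \<in> stone_set L a" "stone_set L a \<subseteq> topspace (Ult L) - Z"
    using openin_Ult_base by blast
  moreover have "a \<noteq> \<bottom>" using calculation stone_set_bottom by auto
  ultimately show ?thesis by blast
qed

lemma stone_set_finite_Union:
  assumes "finite F" "F \<subseteq> carrier L"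
  shows "\<exists>c\<in>carrier L. stone_set L c = \<Union>(stone_set L ` F)"
  using assms
proof (induction F)
  case empty
  then show ?case using stone_set_bottom by (intro bexI[of _ \<bottom>]) auto
next
  case (insert x F)
  then obtain c where "c \<in> carrier L" "stone_set L c = \<Union>(stone_set L ` F)" by auto
  then show ?case using insert.prems by (intro bexI[of _ "x \<squnion> c"]) (auto simp: stone_set_join)
qed

text \<open>The elements whose Stone set is covered by finitely many members of a given open cover form an
ideal. An ultrafilter avoiding it would be a point outside the cover, so the ideal contains the
top element.\<close>

lemma compact_space_Ult: "compact_space (Ult L)"
  unfolding compact_space_alt
proof (intro allI impI, elim conjE)
  fix \<U>
  assume op: "\<forall>U\<in>\<U>. openin (Ult L) U" and cov: "topspace (Ult L) \<subseteq> \<Union>\<U>"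
  define I where "I = {a \<in> carrier L. \<exists>\<F>. finite \<F> \<and> \<F> \<subseteq> \<U> \<and> stone_set L a \<subseteq> \<Union>\<F>}"
  have Iin: "a \<in> I" if "a \<in> carrier L" "stone_set L a \<subseteq> U" "U \<in> \<U>" for a U
    unfolding I_def using that by (auto intro!: exI[of _ "{U}"])
  have "\<top> \<in> I"
  proof (rule ccontr)
    assume "\<top> \<notin> I"
    have "\<exists>u. ultrafilter_on L u \<and> \<top> \<in> u \<and> u \<inter> I = {}"
    proof (rule ultrafilter_avoiding_ideal)
      show "\<bottom> \<in> I" unfolding I_def using stone_set_bottom by auto
      show "x \<squnion> y \<in> I" if xy: "x \<in> I" "y \<in> I" for x y
      proof -
        obtain \<F> \<G> where "finite \<F>" "\<F> \<subseteq> \<U>" "stone_set L x \<subseteq> \<Union>\<F>"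
          "finite \<G>" "\<G> \<subseteq> \<U>" "stone_set L y \<subseteq> \<Union>\<G>" using xy unfolding I_def by blast
        moreover have "x \<in> carrier L" "y \<in> carrier L" using xy by (auto simp: I_def)
        ultimately show ?thesis unfolding I_def
          by (auto simp: stone_set_join intro!: exI[of _ "\<F> \<union> \<G>"])
      qed
      show "x \<in> I" if xy: "y \<in> I" "x \<in> carrier L" "x \<sqsubseteq> y" for x y
      proof -
        have "stone_set L x \<subseteq> stone_set L y" using xy stone_set_subset_iff[of x y] by (simp add: I_def)
        then show ?thesis using xy(1,2) unfolding I_def by (blast intro: subset_trans)
      qed
    qed (use \<open>\<top> \<notin> I\<close> in \<open>auto simp: I_def\<close>)
    then obtain u where u: "ultrafilter_on L u" "u \<inter> I = {}" by blast
    then obtain U where U: "U \<in> \<U>" "u \<in> U" using cov topspace_Ult by blast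
    then obtain a where "a \<in> carrier L" "u \<in> stone_set L a" "stone_set L a \<subseteq> U"
      using openin_Ult_base op by metis
    then show False using Iin U u mem_stone_set by blast
  qed
  then show "\<exists>\<F>. finite \<F> \<and> \<F> \<subseteq> \<U> \<and> topspace (Ult L) \<subseteq> \<Union>\<F>"
    unfolding I_def by (simp add: stone_set_top topspace_Ult)
qed

lemma Hausdorff_space_Ult: "Hausdorff_space (Ult L)"
  unfolding Hausdorff_space_def
proof (intro allI impI, elim conjE)
  fix u v assume uv: "u \<in> topspace (Ult L)" "v \<in> topspace (Ult L)" "u \<noteq> v"
  then have U: "ultrafilter_on L u" "ultrafilter_on L v" by (auto simp: topspace_Ult)
  then obtain a where a: "a \<in> u" "a \<notin> v" "a \<in> carrier L"
    using uv(3) U ultrafilter_onD(1,6) ultrafilter_on_def by (metis subset_iff)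
  then show "\<exists>V W. openin (Ult L) V \<and> openin (Ult L) W \<and> u \<in> V \<and> v \<in> W \<and> disjnt V W"
  proof (intro exI conjI)
    show "openin (Ult L) (stone_set L a)" "openin (Ult L) (stone_set L (cmpl L a))"
      using a by (simp_all add: openin_stone_set)
    show "u \<in> stone_set L a" "v \<in> stone_set L (cmpl L a)"
      using a U by (simp_all add: mem_stone_set ultrafilter_cmpl)
    show "disjnt (stone_set L a) (stone_set L (cmpl L a))"
      using a by (auto simp: disjnt_def stone_set_cmpl)
  qed
qed

lemma compact_Hausdorff_Ult: "compact_Hausdorff (Ult L)"
  by (simp add: compact_Hausdorff_def compact_space_Ult Hausdorff_space_Ult)

text \<open>Stone sets separate disjoint closed sets, because they form a base closed under finite unions and
closed sets are compact.\<close>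

lemma stone_set_between:
  assumes K: "closedin (Ult L) K" and U: "openin (Ult L) U" and KU: "K \<subseteq> U"
  shows "\<exists>a\<in>carrier L. K \<subseteq> stone_set L a \<and> stone_set L a \<subseteq> U"
proof -
  have "compactin (Ult L) K" using K compact_space_Ult closedin_compact_space by blast
  let ?\<U> = "stone_set L ` {a \<in> carrier L. stone_set L a \<subseteq> U}"
  have "K \<subseteq> \<Union>?\<U>"
    using KU openin_Ult_base[OF U] by blast
  then have "\<exists>\<F>. finite \<F> \<and> \<F> \<subseteq> ?\<U> \<and> K \<subseteq> \<Union>\<F>"
    using \<open>compactin (Ult L) K\<close> openin_stone_set by (intro compactinD) auto
  then obtain F where F: "finite F" "F \<subseteq> {a \<in> carrier L. stone_set L a \<subseteq> U}" "K \<subseteq> \<Union>(stone_set L ` F)"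
    using finite_subset_image by (metis (no_types, lifting))
  then have "F \<subseteq> carrier L" by blast
  then obtain c where "c \<in> carrier L" "stone_set L c = \<Union>(stone_set L ` F)"
    using stone_set_finite_Union F(1) by blast
  then show ?thesis using F by (intro bexI[of _ c]) auto
qed

lemma clopen_is_stone_set:
  assumes "closedin (Ult L) K" "openin (Ult L) K"
  shows "\<exists>a\<in>carrier L. stone_set L a = K"
  using stone_set_between[OF assms] by blast

end

lemma complete_booleanD:
  assumes "complete_boolean L"
  shows "boolean_lattice L" "Complete_Lattice.complete_lattice L"
  using assms by (auto simp: complete_boolean_def)

text \<open>Joins become closures of unions rather than unions. The closure cannot be smaller: a basic
neighbourhood missing the union is the Stone set of an element whose complement is an upper bound.\<close>

lemma stone_set_Sup:
  assumes L: "complete_boolean L" and M: "M \<subseteq> carrier L"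
  shows "stone_set L (\<Squnion>\<^bsub>L\<^esub> M) = Ult L closure_of (\<Union>(stone_set L ` M))"
proof -
  interpret boolean_lattice L using L complete_booleanD by blast
  interpret c: Complete_Lattice.complete_lattice L using L complete_booleanD by blast
  have sc: "\<Squnion>\<^bsub>L\<^esub> M \<in> carrier L" using M by simp
  have "\<Union>(stone_set L ` M) \<subseteq> stone_set L (\<Squnion>\<^bsub>L\<^esub> M)"
  proof clarify
    fix u a assume a: "a \<in> M" "u \<in> stone_set L a"
    then have "a \<sqsubseteq>\<^bsub>L\<^esub> \<Squnion>\<^bsub>L\<^esub> M" using M c.weak.sup_upper by blast
    then show "u \<in> stone_set L (\<Squnion>\<^bsub>L\<^esub> M)" using a stone_set_subset_iff[of a "\<Squnion>\<^bsub>L\<^esub> M"] M sc by blast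
  qed
  then have "Ult L closure_of (\<Union>(stone_set L ` M)) \<subseteq> stone_set L (\<Squnion>\<^bsub>L\<^esub> M)"
    using closedin_stone_set[OF sc] closure_of_minimal by blast
  moreover have "u \<in> Ult L closure_of (\<Union>(stone_set L ` M))" if u: "u \<in> stone_set L (\<Squnion>\<^bsub>L\<^esub> M)" for u
    unfolding in_closure_of
  proof (intro conjI allI impI)
    show "u \<in> topspace (Ult L)" using u stone_set_subset_topspace by blast
    fix T assume "u \<in> T \<and> openin (Ult L) T"
    then obtain b where b: "b \<in> carrier L" "u \<in> stone_set L b" "stone_set L b \<subseteq> T"
      using openin_Ult_base by blast
    show "\<exists>v. v \<in> \<Union>(stone_set L ` M) \<and> v \<in> T"
    proof (rule ccontr)
      assume "\<nexists>v. v \<in> \<Union>(stone_set L ` M) \<and> v \<in> T"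
      then have "stone_set L a \<subseteq> stone_set L (cmpl L b)" if "a \<in> M" for a
        using that b stone_set_cmpl[OF b(1)] stone_set_subset_topspace[of a] by blast
      then have "a \<sqsubseteq>\<^bsub>L\<^esub> cmpl L b" if "a \<in> M" for a
        using that M b stone_set_subset_iff[of a "cmpl L b"] by auto
      then have "\<Squnion>\<^bsub>L\<^esub> M \<sqsubseteq>\<^bsub>L\<^esub> cmpl L b" using M b c.weak.sup_least by simp
      then have "u \<in> stone_set L (cmpl L b)" using u stone_set_subset_iff[OF sc, of "cmpl L b"] b by auto
      then show False using b stone_set_cmpl by auto
    qed
  qed
  ultimately show ?thesis by blast
qed

lemma extremally_disconnected_Ult:
  assumes L: "complete_boolean L"
  shows "extremally_disconnected (Ult L)"
  unfolding extremally_disconnected_def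
proof (intro allI impI)
  interpret boolean_lattice L using L complete_booleanD by blast
  interpret c: Complete_Lattice.complete_lattice L using L complete_booleanD by blast
  fix U assume U: "openin (Ult L) U"
  let ?M = "{a \<in> carrier L. stone_set L a \<subseteq> U}"
  have "\<Union>(stone_set L ` ?M) = U" using openin_Ult_base[OF U] by blast
  moreover have M: "?M \<subseteq> carrier L" by blast
  ultimately have "Ult L closure_of U = stone_set L (\<Squnion>\<^bsub>L\<^esub> ?M)" using stone_set_Sup[OF L M] by simp
  then show "openin (Ult L) (Ult L closure_of U)" using openin_stone_set c.weak.sup_closed[OF M] by simp
qed

section \<open>Dual spaces of contact algebras\<close>

lemma disjoint_imageI: "(\<And>x. x \<in> S \<Longrightarrow> f x \<notin> T) \<Longrightarrow> T \<inter> f ` S = {}"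
  by auto

text \<open>The contact relation is constrained on the carrier only, since this is all that an algebra
determines; the record may contain arbitrary values elsewhere.\<close>

locale dual_space = boolean_lattice A
  for A :: "'a contact_lattice" (structure) and p :: "'a set \<Rightarrow> 'y" and Y :: "'y topology" +
  assumes complete: "complete_boolean A"
    and in_class_P: "class_P (Ult A) Y p"
    and contact_iff: "\<lbrakk>a \<in> carrier A; b \<in> carrier A\<rbrakk>
      \<Longrightarrow> a \<frown> b \<longleftrightarrow> p ` stone_set A a \<inter> p ` stone_set A b \<noteq> {}"
begin

lemma continuous_p: "continuous_map (Ult A) Y p"
  and surj_p: "p ` topspace (Ult A) = topspace Y"
  and compact_Y: "compact_space Y"
  and Hausdorff_Y: "Hausdorff_space Y"
  and irreducible_p: "\<And>Z. \<lbrakk>closedin (Ult A) Z; Z \<noteq> topspace (Ult A)\<rbrakk> \<Longrightarrow> p ` Z \<noteq> topspace Y"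
  using in_class_P
  by (auto simp: class_P_def ext_continuous_def irreducible_map_def compact_Hausdorff_def)

lemma closed_map_p: "closed_map (Ult A) Y p"
  using continuous_imp_closed_map[OF continuous_p compact_space_Ult Hausdorff_Y] .

lemma quotient_map_p: "quotient_map (Ult A) Y p"
  using continuous_closed_imp_quotient_map[OF continuous_p closed_map_p surj_p] .

lemma p_in: "u \<in> topspace (Ult A) \<Longrightarrow> p u \<in> topspace Y"
  using surj_p by blast

lemma surj_p_obtain:
  assumes "y \<in> topspace Y" obtains u where "u \<in> topspace (Ult A)" "p u = y"
proof -
  from assms have "y \<in> p ` topspace (Ult A)" by (simp add: surj_p)
  then show ?thesis using that by blast
qed

lemma closedin_image_stone_set: "a \<in> carrier A \<Longrightarrow> closedin Y (p ` stone_set A a)"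
  using closed_map_p closedin_stone_set unfolding closed_map_def by blast

lemma basic_neighbourhood:
  assumes "openin Y U" "u \<in> topspace (Ult A)" "p u \<in> U"
  shows "\<exists>a\<in>carrier A. u \<in> stone_set A a \<and> p ` stone_set A a \<subseteq> U"
proof -
  have "openin (Ult A) {v \<in> topspace (Ult A). p v \<in> U}"
    using openin_continuous_map_preimage[OF continuous_p assms(1)] .
  from openin_Ult_base[OF this, of u] show ?thesis using assms(2,3) by blast
qed

text \<open>In terms of the relation \<open>\<lless>\<close>, the point \<open>y\<close> lies in the open set determined by
\<open>a\<close>, while \<open>z\<close> is not even in its closure. The fibres of \<open>y\<close> and \<open>z\<close> are disjoint
closed sets, so some Stone set contains one and misses the other.\<close>

lemma separate_points:
  assumes "y \<in> topspace Y" "z \<in> topspace Y" "y \<noteq> z"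
  shows "\<exists>a\<in>carrier A. y \<notin> p ` stone_set A (cmpl A a) \<and> z \<notin> p ` stone_set A a"
proof -
  have cl: "closedin (Ult A) {u \<in> topspace (Ult A). p u \<in> {w}}" if "w \<in> topspace Y" for w
    using closedin_continuous_map_preimage[OF continuous_p
        closedin_Hausdorff_singleton[OF Hausdorff_Y that]] .
  let ?U = "topspace (Ult A) - {u \<in> topspace (Ult A). p u \<in> {z}}"
  have "openin (Ult A) ?U" using cl[OF assms(2)] by blast
  moreover have "{u \<in> topspace (Ult A). p u \<in> {y}} \<subseteq> ?U" using assms(3) by auto
  ultimately obtain a where a: "a \<in> carrier A" "{u \<in> topspace (Ult A). p u \<in> {y}} \<subseteq> stone_set A a"
    "stone_set A a \<subseteq> ?U" using stone_set_between[OF cl[OF assms(1)]] by blast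
  then have "y \<notin> p ` stone_set A (cmpl A a)" by (auto simp: stone_set_cmpl)
  moreover have "z \<notin> p ` stone_set A a" using a(3) by auto
  ultimately show ?thesis using a(1) by blast
qed

text \<open>The fibres of \<open>p\<close> are recovered from the contact relation, because images of basic
neighbourhoods become arbitrarily small. This identifies the dual space of an algebra up to
homeomorphism.\<close>

lemma same_point_iff:
  assumes u: "u \<in> topspace (Ult A)" and v: "v \<in> topspace (Ult A)"
  shows "p u = p v \<longleftrightarrow> (\<forall>a\<in>u. \<forall>b\<in>v. a \<frown> b)"
proof
  have uv: "ultrafilter_on A u" "ultrafilter_on A v" using u v by (auto simp: topspace_Ult)
  then have c: "u \<subseteq> carrier A" "v \<subseteq> carrier A" using ultrafilter_onD(1) by blast+
  { assume eq: "p u = p v"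
    show "\<forall>a\<in>u. \<forall>b\<in>v. a \<frown> b"
    proof (intro ballI)
      fix a b assume ab: "a \<in> u" "b \<in> v"
      then have "u \<in> stone_set A a" "v \<in> stone_set A b"
        using uv by (auto simp: mem_stone_set)
      then have "p u \<in> p ` stone_set A a" "p v \<in> p ` stone_set A b"
        by (simp_all add: imageI)
      then show "a \<frown> b" using eq contact_iff[of a b] ab c by auto
    qed }
  assume ct: "\<forall>a\<in>u. \<forall>b\<in>v. a \<frown> b"
  show "p u = p v"
  proof (rule ccontr)
    assume "p u \<noteq> p v"
    then obtain U V where UV: "openin Y U" "openin Y V" "p u \<in> U" "p v \<in> V" "disjnt U V"
      using Hausdorff_Y p_in u v unfolding Hausdorff_space_def by metis
    obtain a b where ab: "a \<in> carrier A" "u \<in> stone_set A a" "p ` stone_set A a \<subseteq> U"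
      "b \<in> carrier A" "v \<in> stone_set A b" "p ` stone_set A b \<subseteq> V"
      using basic_neighbourhood[OF UV(1) u UV(3)] basic_neighbourhood[OF UV(2) v UV(4)] by blast
    then have "\<not> a \<frown> b" using contact_iff[OF ab(1,4)] UV(5) unfolding disjnt_def by blast
    then show False using ct ab by (auto simp: mem_stone_set)
  qed
qed

lemma well_inside_iff:
  assumes "a \<in> carrier A" "b \<in> carrier A"
  shows "well_inside A b a \<longleftrightarrow> p ` stone_set A b \<inter> p ` stone_set A (cmpl A a) = {}"
  using contact_iff[of b "cmpl A a"] assms by (auto simp: well_inside_def)

text \<open>The separation axiom comes from zero-dimensionality of the Stone space, applied to the disjoint
saturated closed sets over the images of \<open>a\<close> and \<open>b\<close>. The density axiom is irreducibility: the
image of a proper closed set misses an open set, and a small Stone set is mapped into that.\<close>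

lemma de_vries: "de_vries_algebra A"
proof -
  have pos: "\<bottom> \<sqsubset> a \<longleftrightarrow> stone_set A a \<noteq> {}" if "a \<in> carrier A" for a
    using that stone_set_empty_iff[OF that] bottom_lower[OF that] by (auto simp: lless_def eq_is_equal)
  have "normal_contact_algebra A"
  proof
    fix a b c assume a: "a \<in> carrier A"
    { assume "\<bottom> \<sqsubset> a"
      then show "a \<frown> a" using pos[OF a] contact_iff[OF a a] by auto }
    { assume "a \<sqsubset> \<top>"
      then have "a \<noteq> \<top>" by (auto simp: lless_def eq_is_equal)
      then have "stone_set A a \<noteq> topspace (Ult A)"
        using stone_set_eq_iff[of a \<top>] a stone_set_top topspace_Ult by simp
      then have "p ` stone_set A a \<noteq> topspace Y" using irreducible_p closedin_stone_set[OF a] by blast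
      then obtain y where y: "y \<in> topspace Y - p ` stone_set A a"
        using closedin_subset[OF closedin_image_stone_set[OF a]] by blast
      then obtain u where u: "u \<in> topspace (Ult A)" "p u = y" using surj_p_obtain by blast
      have "openin Y (topspace Y - p ` stone_set A a)" using closedin_image_stone_set[OF a] by blast
      then obtain b where b: "b \<in> carrier A" "u \<in> stone_set A b"
        "p ` stone_set A b \<subseteq> topspace Y - p ` stone_set A a"
        using basic_neighbourhood u y by blast
      then show "\<exists>b\<in>carrier A. \<bottom> \<sqsubset> b \<and> \<not> b \<frown> a"
        using pos[OF b(1)] contact_iff[OF b(1) a] by blast }
    assume b: "b \<in> carrier A"
    { assume "a \<frown> b"
      then show "\<bottom> \<sqsubset> a \<and> \<bottom> \<sqsubset> b" using pos[OF a] pos[OF b] contact_iff[OF a b] by blast }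
    { assume "a \<frown> b"
      then show "b \<frown> a" using contact_iff[OF a b] contact_iff[OF b a] by blast }
    { assume "c \<in> carrier A"
      then show "a \<frown> (b \<squnion> c) \<longleftrightarrow> a \<frown> b \<or> a \<frown> c"
        using contact_iff a b by (auto simp: stone_set_join) }
    { assume "\<not> a \<frown> b"
      then have dis: "p ` stone_set A a \<inter> p ` stone_set A b = {}" using contact_iff[OF a b] by blast
      have cl: "closedin (Ult A) {u \<in> topspace (Ult A). p u \<in> p ` stone_set A d}" if "d \<in> carrier A" for d
        using closedin_continuous_map_preimage[OF continuous_p closedin_image_stone_set[OF that]] .
      let ?U = "topspace (Ult A) - {u \<in> topspace (Ult A). p u \<in> p ` stone_set A a}"
      have "openin (Ult A) ?U" using cl[OF a] by blast
      moreover have "{u \<in> topspace (Ult A). p u \<in> p ` stone_set A b} \<subseteq> ?U" using dis by auto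
      ultimately obtain c where c: "c \<in> carrier A"
        "{u \<in> topspace (Ult A). p u \<in> p ` stone_set A b} \<subseteq> stone_set A c" "stone_set A c \<subseteq> ?U"
        using stone_set_between[OF cl[OF b]] by blast
      have "p ` stone_set A a \<inter> p ` stone_set A c = {}"
      proof (rule disjoint_imageI)
        fix v assume "v \<in> stone_set A c"
        from subsetD[OF c(3) this] show "p v \<notin> p ` stone_set A a" by simp
      qed
      moreover have "p ` stone_set A b \<inter> p ` stone_set A (cmpl A c) = {}"
      proof (rule disjoint_imageI)
        fix v assume "v \<in> stone_set A (cmpl A c)"
        then have "v \<in> topspace (Ult A)" "v \<notin> stone_set A c" using stone_set_cmpl[OF c(1)] by auto
        then show "p v \<notin> p ` stone_set A b" using subsetD[OF c(2), of v] by blast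
      qed
      ultimately show "\<exists>c\<in>carrier A. \<not> a \<frown> c \<and> \<not> b \<frown> cmpl A c"
        using c(1) contact_iff[OF a c(1)] contact_iff[OF b cmpl_closed[OF c(1)]] by blast }
  qed
  then show ?thesis using complete by (simp add: de_vries_algebra_def)
qed

text \<open>A regular open set is determined by the clopen closure of its preimage, hence by an element of the
algebra. It is the largest set whose preimage is contained in that closure.\<close>

lemma regular_opens_lepoll: "regular_opens Y \<lesssim> carrier A"
proof -
  let ?W = "\<lambda>U. Ult A closure_of {u \<in> topspace (Ult A). p u \<in> U}"
  have opU: "openin Y U" if "U \<in> regular_opens Y" for U
    using that openin_interior_of[of Y "Y closure_of U"] by (simp add: regular_opens_def)
  have "\<exists>c\<in>carrier A. stone_set A c = ?W U" if "U \<in> regular_opens Y" for U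
  proof (rule clopen_is_stone_set)
    have "extremally_disconnected (Ult A)" using in_class_P by (simp add: class_P_def)
    then show "openin (Ult A) (?W U)"
      using openin_continuous_map_preimage[OF continuous_p opU[OF that]]
      unfolding extremally_disconnected_def by blast
  qed simp
  then obtain c where c: "\<And>U. U \<in> regular_opens Y \<Longrightarrow> c U \<in> carrier A \<and> stone_set A (c U) = ?W U"
    by metis
  \<comment> \<open>The right-hand side is open, since \<open>p\<close> is closed, and it lies between \<open>U\<close> and its closure.\<close>
  have rec: "U = topspace Y - p ` (topspace (Ult A) - ?W U)" if U: "U \<in> regular_opens Y" for U
  proof
    have sub: "{u \<in> topspace (Ult A). p u \<in> U} \<subseteq> ?W U" by (rule closure_of_subset) blast
    show "U \<subseteq> topspace Y - p ` (topspace (Ult A) - ?W U)"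
      using openin_subset[OF opU[OF U]] sub by blast
    let ?V = "topspace Y - p ` (topspace (Ult A) - ?W U)"
    have "openin (Ult A) (?W U)" using c[OF U] openin_stone_set by metis
    then have "closedin (Ult A) (topspace (Ult A) - ?W U)" by blast
    then have "openin Y ?V" using closed_map_p unfolding closed_map_def by blast
    moreover have "?V \<subseteq> Y closure_of U"
    proof
      fix y assume y: "y \<in> ?V"
      then obtain u where u: "u \<in> topspace (Ult A)" "p u = y" using surj_p_obtain by blast
      then have "u \<in> ?W U" using y by blast
      moreover have "p ` ?W U \<subseteq> Y closure_of (p ` {u \<in> topspace (Ult A). p u \<in> U})"
        using continuous_map_image_closure_subset[OF continuous_p] .
      moreover have "Y closure_of (p ` {u \<in> topspace (Ult A). p u \<in> U}) \<subseteq> Y closure_of U"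
        by (rule closure_of_mono) blast
      ultimately show "y \<in> Y closure_of U" using u by blast
    qed
    ultimately have "?V \<subseteq> Y interior_of (Y closure_of U)" by (rule interior_of_maximal[rotated])
    then show "?V \<subseteq> U" using U by (simp add: regular_opens_def)
  qed
  have "inj_on c (regular_opens Y)"
  proof (rule inj_onI)
    fix U V assume UV: "U \<in> regular_opens Y" "V \<in> regular_opens Y" "c U = c V"
    then have "?W U = ?W V" using c[OF UV(1)] c[OF UV(2)] by simp
    then show "U = V" using rec[OF UV(1)] rec[OF UV(2)] by simp
  qed
  moreover have "c ` regular_opens Y \<subseteq> carrier A" using c by blast
  ultimately show ?thesis unfolding lepoll_def by blast
qed

end

section \<open>Morphisms and their dual maps\<close>

lemma boolean_homD:
  assumes "\<phi> \<in> boolean_hom L M"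
  shows "\<phi> \<in> extensional (carrier L)" "\<And>x. x \<in> carrier L \<Longrightarrow> \<phi> x \<in> carrier M"
    "\<And>x y. \<lbrakk>x \<in> carrier L; y \<in> carrier L\<rbrakk> \<Longrightarrow> \<phi> (x \<squnion>\<^bsub>L\<^esub> y) = \<phi> x \<squnion>\<^bsub>M\<^esub> \<phi> y"
    "\<And>x y. \<lbrakk>x \<in> carrier L; y \<in> carrier L\<rbrakk> \<Longrightarrow> \<phi> (x \<sqinter>\<^bsub>L\<^esub> y) = \<phi> x \<sqinter>\<^bsub>M\<^esub> \<phi> y"
    "\<And>x. x \<in> carrier L \<Longrightarrow> \<phi> (cmpl L x) = cmpl M (\<phi> x)"
    "\<phi> \<bottom>\<^bsub>L\<^esub> = \<bottom>\<^bsub>M\<^esub>" "\<phi> \<top>\<^bsub>L\<^esub> = \<top>\<^bsub>M\<^esub>"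
  using assms unfolding boolean_hom_def by (auto simp: PiE_def)

lemma ultrafilter_preimage:
  assumes L: "boolean_lattice L" and M: "boolean_lattice M"
    and \<phi>: "\<phi> \<in> boolean_hom L M" and u: "ultrafilter_on M u"
  shows "ultrafilter_on L {a \<in> carrier L. \<phi> a \<in> u}"
proof -
  interpret L: boolean_lattice L by fact
  interpret M: boolean_lattice M by fact
  note h = boolean_homD[OF \<phi>]
  show ?thesis
  proof (rule L.ultrafilterI)
    show "\<top>\<^bsub>L\<^esub> \<in> {a \<in> carrier L. \<phi> a \<in> u}" using h(7) M.ultrafilter_onD(2)[OF u] by simp
    show "x \<sqinter>\<^bsub>L\<^esub> y \<in> {a \<in> carrier L. \<phi> a \<in> u} \<longleftrightarrow>
        x \<in> {a \<in> carrier L. \<phi> a \<in> u} \<and> y \<in> {a \<in> carrier L. \<phi> a \<in> u}"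
      if "x \<in> carrier L" "y \<in> carrier L" for x y
      using that h(2,4) M.ultrafilter_meet[OF u] by simp
    show "cmpl L x \<in> {a \<in> carrier L. \<phi> a \<in> u} \<longleftrightarrow> x \<notin> {a \<in> carrier L. \<phi> a \<in> u}"
      if "x \<in> carrier L" for x
      using that h(2,5) M.ultrafilter_cmpl[OF u] by simp
  qed blast
qed

text \<open>The square of a morphism of \<open>C\<close>, written pointwise and for contact algebras: \<open>\<phi>\<close> induces
\<open>u \<mapsto> {a. \<phi> a \<in> u}\<close> on Stone spaces, and \<open>f\<close> is the map to which this descends.\<close>

definition dual_map ::
    "'a contact_lattice \<Rightarrow> ('a set \<Rightarrow> 'y) \<Rightarrow> 'y topology \<Rightarrow> 'a contact_lattice \<Rightarrow> ('a set \<Rightarrow> 'y) \<Rightarrow> 'y topology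
      \<Rightarrow> ('a \<Rightarrow> 'a) \<Rightarrow> ('y \<Rightarrow> 'y) \<Rightarrow> bool" where
  "dual_map A p Y A' p' Y' \<phi> f \<longleftrightarrow> \<phi> \<in> boolean_hom A A' \<and> f \<in> ext_continuous Y' Y \<and>
     (\<forall>u\<in>topspace (Ult A'). p {a \<in> carrier A. \<phi> a \<in> u} = f (p' u))"

locale dual_space_pair = A: dual_space A p Y + A': dual_space A' p' Y'
  for A :: "'a contact_lattice" and p :: "'a set \<Rightarrow> 'y" and Y
    and A' :: "'a contact_lattice" and p' :: "'a set \<Rightarrow> 'y" and Y'
begin

abbreviation dual :: "('a \<Rightarrow> 'a) \<Rightarrow> ('y \<Rightarrow> 'y) \<Rightarrow> bool" where
  "dual \<equiv> dual_map A p Y A' p' Y'"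

lemma preimage_in:
  assumes "\<phi> \<in> boolean_hom A A'" "u \<in> topspace (Ult A')"
  shows "{a \<in> carrier A. \<phi> a \<in> u} \<in> topspace (Ult A)"
  using ultrafilter_preimage[OF A.boolean_lattice_axioms A'.boolean_lattice_axioms assms(1)] assms(2)
  by (simp add: A.topspace_Ult A'.topspace_Ult)

text \<open>If \<open>\<phi> a\<close> and \<open>\<phi> b\<close> are in contact, they have members \<open>u\<close> and \<open>v\<close> over the same point;
the preimages of \<open>u\<close> and \<open>v\<close> then lie over the same point too, and they contain \<open>a\<close> and \<open>b\<close>.\<close>

lemma dual_imp_mor:
  assumes "dual \<phi> f" shows "\<phi> \<in> deVBoo_mor A A'"
proof -
  have \<phi>: "\<phi> \<in> boolean_hom A A'" and eq: "\<And>u. u \<in> topspace (Ult A') \<Longrightarrow> p {a \<in> carrier A. \<phi> a \<in> u} = f (p' u)"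
    using assms by (auto simp: dual_map_def)
  have "a \<frown>\<^bsub>A\<^esub> b" if ab: "a \<in> carrier A" "b \<in> carrier A" "\<phi> a \<frown>\<^bsub>A'\<^esub> \<phi> b" for a b
  proof -
    have "p' ` stone_set A' (\<phi> a) \<inter> p' ` stone_set A' (\<phi> b) \<noteq> {}"
      using ab(3) A'.contact_iff[OF boolean_homD(2)[OF \<phi> ab(1)] boolean_homD(2)[OF \<phi> ab(2)]] by simp
    then obtain u v where uv: "u \<in> stone_set A' (\<phi> a)" "v \<in> stone_set A' (\<phi> b)" "p' u = p' v" by blast
    then have uv': "u \<in> topspace (Ult A')" "v \<in> topspace (Ult A')"
      using A'.stone_set_subset_topspace by blast+
    then have "p {a \<in> carrier A. \<phi> a \<in> u} = p {a \<in> carrier A. \<phi> a \<in> v}" using eq uv(3) by simp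
    then show ?thesis
      using A.same_point_iff[OF preimage_in[OF \<phi> uv'(1)] preimage_in[OF \<phi> uv'(2)]] uv ab
      by (auto simp: A'.mem_stone_set)
  qed
  then show ?thesis using \<phi> unfolding deVBoo_mor_def by blast
qed

text \<open>Ultrafilters over the same point have all their members in contact, and reflection of contact
passes this on to their preimages. So the induced map of Stone spaces is constant on the fibres of
\<open>p'\<close> modulo \<open>p\<close>, and it descends because \<open>p'\<close> is a quotient map.\<close>

lemma mor_imp_dual:
  assumes \<phi>: "\<phi> \<in> deVBoo_mor A A'" shows "\<exists>f. dual \<phi> f"
proof -
  have h: "\<phi> \<in> boolean_hom A A'"
    and refl: "\<And>a b. \<lbrakk>a \<in> carrier A; b \<in> carrier A; \<phi> a \<frown>\<^bsub>A'\<^esub> \<phi> b\<rbrakk> \<Longrightarrow> a \<frown>\<^bsub>A\<^esub> b"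
    using \<phi> by (auto simp: deVBoo_mor_def)
  let ?g = "\<lambda>u. {a \<in> carrier A. \<phi> a \<in> u}"
  have wd: "p (?g u) = p (?g v)" if uv: "u \<in> topspace (Ult A')" "v \<in> topspace (Ult A')" "p' u = p' v" for u v
    unfolding A.same_point_iff[OF preimage_in[OF h uv(1)] preimage_in[OF h uv(2)]]
    using A'.same_point_iff[OF uv(1,2)] uv(3) refl by blast
  have cont: "continuous_map (Ult A') Y (\<lambda>u. p (?g u))"
    unfolding continuous_map_def
  proof (intro conjI allI impI)
    show "(\<lambda>u. p (?g u)) \<in> topspace (Ult A') \<rightarrow> topspace Y"
      using preimage_in[OF h] A.p_in by auto
    fix U assume U: "openin Y U"
    let ?V = "{u \<in> topspace (Ult A'). p (?g u) \<in> U}"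
    show "openin (Ult A') ?V"
    proof (subst openin_subopen, intro ballI)
      fix u assume u: "u \<in> ?V"
      then obtain a where a: "a \<in> carrier A" "?g u \<in> stone_set A a" "p ` stone_set A a \<subseteq> U"
        using A.basic_neighbourhood[OF U preimage_in[OF h]] by blast
      have "stone_set A' (\<phi> a) \<subseteq> ?V"
      proof
        fix v assume v: "v \<in> stone_set A' (\<phi> a)"
        then have "v \<in> topspace (Ult A')" using A'.stone_set_subset_topspace by blast
        moreover have "?g v \<in> stone_set A a"
          using preimage_in[OF h calculation] v a(1)
          by (simp add: A.mem_stone_set A'.mem_stone_set A.topspace_Ult)
        ultimately show "v \<in> ?V" using a(3) by blast
      qed
      moreover have "u \<in> stone_set A' (\<phi> a)"
        using u a(2) by (simp add: A.mem_stone_set A'.mem_stone_set A'.topspace_Ult)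
      moreover have "openin (Ult A') (stone_set A' (\<phi> a))"
        using A'.openin_stone_set boolean_homD(2)[OF h a(1)] by blast
      ultimately show "\<exists>T. openin (Ult A') T \<and> u \<in> T \<and> T \<subseteq> ?V"
        by blast
    qed
  qed
  obtain f where f: "continuous_map Y' Y f" "\<And>u. u \<in> topspace (Ult A') \<Longrightarrow> f (p' u) = p (?g u)"
  proof (rule quotient_map_lift_exists[OF A'.quotient_map_p cont wd])
    fix f assume "continuous_map Y' Y f" "\<And>u. u \<in> topspace (Ult A') \<Longrightarrow> f (p' u) = p (?g u)"
    then show thesis by (rule that)
  qed
  define f' where "f' = restrict f (topspace Y')"
  have "continuous_map Y' Y f'" unfolding f'_def using f(1) by (simp add: continuous_map_eq[of _ _ f])
  then have "dual \<phi> f'" unfolding dual_map_def ext_continuous_def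
    using h f(2) A'.p_in by (auto simp: f'_def)
  then show ?thesis by (intro exI[of _ f'])
qed

lemma dual_unique:
  assumes "dual \<phi> f" "dual \<phi> g" shows "f = g"
proof (rule extensionalityI)
  show "f \<in> extensional (topspace Y')" "g \<in> extensional (topspace Y')"
    using assms by (auto simp: dual_map_def ext_continuous_def)
  fix y assume "y \<in> topspace Y'"
  then obtain u where "u \<in> topspace (Ult A')" "p' u = y" using A'.surj_p_obtain by blast
  then show "f y = g y" using assms unfolding dual_map_def by metis
qed

lemma lower_reg_closed:
  assumes "\<phi> \<in> boolean_hom A A'" "a \<in> carrier A"
  shows "lower_reg A A' \<phi> a \<in> carrier A'"
proof -
  interpret c: Complete_Lattice.complete_lattice A' using A'.complete complete_booleanD by blast
  have "\<phi> ` {b \<in> carrier A. well_inside A b a} \<subseteq> carrier A'"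
    using boolean_homD(2)[OF assms(1)] by blast
  then show ?thesis using assms(2) by (simp add: lower_reg_def)
qed

text \<open>The elements \<open>b \<lless> a\<close> are those with \<open>p (\<epsilon> b)\<close> disjoint from \<open>p (\<epsilon> (a\<^sup>*))\<close>; their
Stone sets exhaust the open set of all points over the complement of \<open>p (\<epsilon> (a\<^sup>*))\<close>. Taking
preimages and closures turns this into the join that defines the operator.\<close>

lemma stone_set_lower_reg:
  assumes d: "dual \<phi> f" and a: "a \<in> carrier A"
  shows "stone_set A' (lower_reg A A' \<phi> a) =
    Ult A' closure_of {u \<in> topspace (Ult A'). f (p' u) \<notin> p ` stone_set A (cmpl A a)}"
proof -
  have h: "\<phi> \<in> boolean_hom A A'"
    and eq: "\<And>u. u \<in> topspace (Ult A') \<Longrightarrow> p {a \<in> carrier A. \<phi> a \<in> u} = f (p' u)"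
    using d by (auto simp: dual_map_def)
  let ?W = "{u \<in> topspace (Ult A'). f (p' u) \<notin> p ` stone_set A (cmpl A a)}"
  let ?B = "{b \<in> carrier A. well_inside A b a}"
  have sub: "\<phi> ` ?B \<subseteq> carrier A'" using boolean_homD(2)[OF h] by blast
  have "\<Union>(stone_set A' ` \<phi> ` ?B) = ?W"
  proof (intro equalityI subsetI)
    fix u assume "u \<in> \<Union>(stone_set A' ` \<phi> ` ?B)"
    then obtain b where b: "b \<in> carrier A" "well_inside A b a" "u \<in> stone_set A' (\<phi> b)" by blast
    then have u: "u \<in> topspace (Ult A')" using A'.stone_set_subset_topspace by blast
    have "{a \<in> carrier A. \<phi> a \<in> u} \<in> stone_set A b"
      using preimage_in[OF h u] b by (simp add: A.mem_stone_set A'.mem_stone_set A.topspace_Ult)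
    then have "p {a \<in> carrier A. \<phi> a \<in> u} \<in> p ` stone_set A b" by (rule imageI)
    then have "f (p' u) \<in> p ` stone_set A b" by (simp only: eq[OF u])
    then show "u \<in> ?W"
      using A.well_inside_iff[OF a b(1)] b(2) u by blast
  next
    fix u assume u: "u \<in> ?W"
    let ?v = "{a \<in> carrier A. \<phi> a \<in> u}"
    have v: "?v \<in> topspace (Ult A)" using u preimage_in[OF h] by blast
    have op: "openin Y (topspace Y - p ` stone_set A (cmpl A a))"
      using A.closedin_image_stone_set[OF A.cmpl_closed[OF a]] by blast
    have "p ?v \<in> topspace Y - p ` stone_set A (cmpl A a)"
      using u eq[of u] A.p_in[OF v] by simp
    from A.basic_neighbourhood[OF op v this]
    obtain b where b: "b \<in> carrier A" "?v \<in> stone_set A b"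
      "p ` stone_set A b \<subseteq> topspace Y - p ` stone_set A (cmpl A a)"
      by blast
    then have "b \<in> ?B" using A.well_inside_iff[OF a b(1)] by blast
    moreover have "u \<in> stone_set A' (\<phi> b)"
      using b(2) u by (simp add: A.mem_stone_set A'.mem_stone_set A'.topspace_Ult)
    ultimately show "u \<in> \<Union>(stone_set A' ` \<phi> ` ?B)" by blast
  qed
  then show ?thesis using stone_set_Sup[OF A'.complete sub] a by (simp add: lower_reg_def)
qed

text \<open>By the preceding lemma the operator depends on \<open>f\<close> only. Conversely let \<open>f y \<noteq> g y\<close>, with \<open>u\<close>
over \<open>y\<close> and \<open>a\<close> separating \<open>f y\<close> from \<open>g y\<close>. Then \<open>u\<close> belongs to the Stone set computed from
\<open>f\<close>, whereas the one computed from \<open>g\<close> stays inside the closed set of points that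
\<open>g \<circ> p'\<close> sends into \<open>p (\<epsilon> a)\<close>.\<close>

lemma lower_reg_eq_iff:
  assumes f: "dual \<phi> f" and g: "dual \<psi> g"
  shows "lower_reg A A' \<phi> = lower_reg A A' \<psi> \<longleftrightarrow> f = g"
proof
  have h: "\<phi> \<in> boolean_hom A A'" "\<psi> \<in> boolean_hom A A'"
    and fg: "f \<in> ext_continuous Y' Y" "g \<in> ext_continuous Y' Y"
    using f g by (auto simp: dual_map_def)
  { assume "f = g"
    then have "stone_set A' (lower_reg A A' \<phi> a) = stone_set A' (lower_reg A A' \<psi> a)"
      if "a \<in> carrier A" for a
      using stone_set_lower_reg[OF f that] stone_set_lower_reg[OF g that] by simp
    then have "lower_reg A A' \<phi> a = lower_reg A A' \<psi> a" if "a \<in> carrier A" for a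
      using that A'.stone_set_eq_iff lower_reg_closed h by metis
    then show "lower_reg A A' \<phi> = lower_reg A A' \<psi>"
      by (intro extensionalityI[of _ "carrier A"]) (auto simp: lower_reg_def) }
  assume eq: "lower_reg A A' \<phi> = lower_reg A A' \<psi>"
  show "f = g"
  proof (rule extensionalityI)
    show "f \<in> extensional (topspace Y')" "g \<in> extensional (topspace Y')"
      using fg by (auto simp: ext_continuous_def)
    fix y assume y: "y \<in> topspace Y'"
    then obtain u where u: "u \<in> topspace (Ult A')" "p' u = y" using A'.surj_p_obtain by blast
    have cg: "continuous_map Y' Y g" and "continuous_map Y' Y f" using fg by (auto simp: ext_continuous_def)
    then have fy: "f y \<in> topspace Y" "g y \<in> topspace Y"
      using y by (auto simp: continuous_map_def)
    show "f y = g y"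
    proof (rule ccontr)
      assume "f y \<noteq> g y"
      then obtain a where a: "a \<in> carrier A" "f y \<notin> p ` stone_set A (cmpl A a)" "g y \<notin> p ` stone_set A a"
        using A.separate_points fy by blast
      let ?W = "\<lambda>h. {u \<in> topspace (Ult A'). h (p' u) \<notin> p ` stone_set A (cmpl A a)}"
      let ?K = "{u \<in> topspace (Ult A'). g (p' u) \<in> p ` stone_set A a}"
      have "?W f \<subseteq>
          Ult A' closure_of ?W f"
        by (rule closure_of_subset) blast
      then have "u \<in> Ult A' closure_of ?W f"
        using u a(2) by blast
      also have "\<dots> = Ult A' closure_of ?W g"
        using stone_set_lower_reg[OF f a(1)] stone_set_lower_reg[OF g a(1)] eq by simp
      also have "\<dots> \<subseteq> ?K"
      proof (rule closure_of_minimal)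
        show "?W g \<subseteq> ?K"
        proof
          fix v assume v: "v \<in> ?W g"
          then have "g (p' v) \<in> topspace Y" using cg A'.p_in by (auto simp: continuous_map_def)
          then obtain w where w: "w \<in> topspace (Ult A)" "p w = g (p' v)" using A.surj_p_obtain by blast
          then have "w \<notin> stone_set A (cmpl A a)" using v image_eqI[of "g (p' v)" p w] by auto
          then have "w \<in> stone_set A a" using w(1) A.stone_set_cmpl[OF a(1)] by blast
          then have "g (p' v) \<in> p ` stone_set A a" unfolding w(2)[symmetric] by (rule imageI)
          then show "v \<in> ?K" using v by simp
        qed
        have "continuous_map (Ult A') Y (g \<circ> p')" using continuous_map_compose[OF A'.continuous_p cg] .
        from closedin_continuous_map_preimage[OF this A.closedin_image_stone_set[OF a(1)]]
        show "closedin (Ult A') ?K" by simp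
      qed
      finally show False using u a(3) by blast
    qed
  qed
qed

lemma deVBoo_rel_iff:
  assumes f: "dual \<phi> f" and g: "dual \<psi> g"
  shows "(\<phi>, \<psi>) \<in> deVBoo_rel A A' \<longleftrightarrow> f = g"
  using lower_reg_eq_iff[OF f g] dual_imp_mor[OF f] dual_imp_mor[OF g] by (simp add: deVBoo_rel_def)

end

lemma compose_boolean_hom:
  assumes "\<phi> \<in> boolean_hom L M" "\<psi> \<in> boolean_hom M N"
    and "boolean_lattice L"
  shows "compose (carrier L) \<psi> \<phi> \<in> boolean_hom L N"
proof -
  interpret boolean_lattice L by fact
  note h = boolean_homD[OF assms(1)] and k = boolean_homD[OF assms(2)]
  show ?thesis unfolding boolean_hom_def by (auto simp: compose_def h k)
qed

lemma id_boolean_hom: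
  assumes "boolean_lattice L" shows "(\<lambda>a\<in>carrier L. a) \<in> boolean_hom L L"
proof -
  interpret boolean_lattice L by fact
  show ?thesis unfolding boolean_hom_def by auto
qed

lemma id_ext_continuous: "(\<lambda>y\<in>topspace Y. y) \<in> ext_continuous Y Y"
proof -
  have "continuous_map Y Y (\<lambda>y\<in>topspace Y. y)"
    by (rule continuous_map_eq[OF continuous_map_id]) simp
  then show ?thesis by (simp add: ext_continuous_def)
qed

lemma compose_ext_continuous:
  assumes "f \<in> ext_continuous X Y" "g \<in> ext_continuous Y Z"
  shows "compose (topspace X) g f \<in> ext_continuous X Z"
proof -
  have "continuous_map X Z (g \<circ> f)"
    using assms by (auto simp: ext_continuous_def intro: continuous_map_compose)
  then have "continuous_map X Z (compose (topspace X) g f)"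
    by (rule continuous_map_eq) (simp add: compose_def)
  then show ?thesis by (simp add: ext_continuous_def)
qed

lemma dual_map_compose:
  assumes A: "dual_space A p Y" and A': "dual_space A' p' Y'" and A'': "dual_space A'' p'' Y''"
    and f: "dual_map A p Y A' p' Y' \<phi> f" and g: "dual_map A' p' Y' A'' p'' Y'' \<psi> g"
  shows "dual_map A p Y A'' p'' Y'' (compose (carrier A) \<psi> \<phi>) (compose (topspace Y'') f g)"
proof -
  interpret A: dual_space A p Y by fact
  interpret A'': dual_space A'' p'' Y'' by fact
  interpret p: dual_space_pair A' p' Y' A'' p'' Y''
    using A' A'' by (simp add: dual_space_pair_def)
  have h: "\<phi> \<in> boolean_hom A A'" "\<psi> \<in> boolean_hom A' A''" using f g by (auto simp: dual_map_def)
  have "compose (topspace Y'') f g \<in> ext_continuous Y'' Y"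
    using f g by (intro compose_ext_continuous) (auto simp: dual_map_def)
  moreover have "p {a \<in> carrier A. compose (carrier A) \<psi> \<phi> a \<in> u} = compose (topspace Y'') f g (p'' u)"
    if u: "u \<in> topspace (Ult A'')" for u
  proof -
    let ?v = "{a \<in> carrier A'. \<psi> a \<in> u}"
    have "{a \<in> carrier A. compose (carrier A) \<psi> \<phi> a \<in> u} = {a \<in> carrier A. \<phi> a \<in> ?v}"
      using boolean_homD(2)[OF h(1)] by (auto simp: compose_def)
    also have "p \<dots> = f (p' ?v)" using f p.preimage_in[OF h(2) u] unfolding dual_map_def by blast
    also have "p' ?v = g (p'' u)" using g u unfolding dual_map_def by blast
    finally show ?thesis using A''.p_in[OF u] by (simp add: compose_def)
  qed
  ultimately show ?thesis
    using compose_boolean_hom[OF h A.boolean_lattice_axioms] by (simp add: dual_map_def)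
qed

section \<open>Lifting continuous maps along irreducible maps\<close>

text \<open>A family of proper ideals \<open>I u\<close> indexed by the points of a space, such that membership of a
fixed element is an open condition on \<open>u\<close>. Complementing the fibres, it is a join-preserving
assignment of closed sets to the elements of the lattice. It is encoded as the set of all pairs
\<open>(x, u)\<close> with \<open>x \<in> I u\<close>, so that enlarging the ideals is inclusion and Zorn's lemma for
inclusion applies.\<close>

definition ideal_family :: "('a, 'b) gorder_scheme \<Rightarrow> 'x topology \<Rightarrow> ('a \<times> 'x) set \<Rightarrow> bool" where
  "ideal_family L X D \<longleftrightarrow> D \<subseteq> carrier L \<times> topspace X \<and>
     (\<forall>x\<in>carrier L. \<forall>y\<in>carrier L. \<forall>u. (x \<squnion>\<^bsub>L\<^esub> y, u) \<in> D \<longleftrightarrow> (x, u) \<in> D \<and> (y, u) \<in> D) \<and>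
     (\<forall>u\<in>topspace X. (\<bottom>\<^bsub>L\<^esub>, u) \<in> D \<and> (\<top>\<^bsub>L\<^esub>, u) \<notin> D) \<and>
     (\<forall>x\<in>carrier L. openin X {u. (x, u) \<in> D})"

lemma ideal_familyD:
  assumes "ideal_family L X D"
  shows "D \<subseteq> carrier L \<times> topspace X"
    "\<And>x y u. \<lbrakk>x \<in> carrier L; y \<in> carrier L\<rbrakk> \<Longrightarrow> (x \<squnion>\<^bsub>L\<^esub> y, u) \<in> D \<longleftrightarrow> (x, u) \<in> D \<and> (y, u) \<in> D"
    "\<And>u. u \<in> topspace X \<Longrightarrow> (\<bottom>\<^bsub>L\<^esub>, u) \<in> D"
    "\<And>u. (\<top>\<^bsub>L\<^esub>, u) \<notin> D"
    "\<And>x. x \<in> carrier L \<Longrightarrow> openin X {u. (x, u) \<in> D}"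
proof -
  show "D \<subseteq> carrier L \<times> topspace X"
    and "\<And>x y u. \<lbrakk>x \<in> carrier L; y \<in> carrier L\<rbrakk> \<Longrightarrow> (x \<squnion>\<^bsub>L\<^esub> y, u) \<in> D \<longleftrightarrow> (x, u) \<in> D \<and> (y, u) \<in> D"
    and "\<And>u. u \<in> topspace X \<Longrightarrow> (\<bottom>\<^bsub>L\<^esub>, u) \<in> D"
    and "\<And>x. x \<in> carrier L \<Longrightarrow> openin X {u. (x, u) \<in> D}"
    using assms by (simp_all add: ideal_family_def)
  show "(\<top>\<^bsub>L\<^esub>, u) \<notin> D" for u
    using assms by (cases "u \<in> topspace X") (auto simp: ideal_family_def)
qed

text \<open>Over an extremally disconnected space a maximal family consists of prime ideals. For an element
\<open>a\<close> let \<open>Op a\<close> be the open set of points whose ideal contains \<open>a\<close>. A maximal family cannot be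
enlarged by the following family \<open>N\<close>: the ideal at \<open>u\<close> gets all \<open>x\<close> for which
\<open>x \<sqinter> a\<close> was already there and \<open>u\<close> is not in the closure \<open>X closure_of E a x\<close> of the set of points
whose ideals contain \<open>a\<close> but not \<open>x \<sqinter> a\<^sup>*\<close>. For \<open>x = a\<^sup>*\<close> this says that \<open>Op (a\<^sup>*)\<close> is the complement of
the closure of \<open>Op a\<close>. Applied to \<open>a\<^sup>*\<close> as well, and with closures of open sets being open, it
follows that \<open>Op a\<close> is closed.\<close>

lemma (in boolean_lattice) prime_ideal_family_extension:
  assumes X: "extremally_disconnected X" and D: "ideal_family L X D"
  shows "\<exists>M. ideal_family L X M \<and> D \<subseteq> M \<and>
    (\<forall>a\<in>carrier L. \<forall>u\<in>topspace X. (cmpl L a, u) \<in> M \<longleftrightarrow> (a, u) \<notin> M)"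
proof -
  let ?F = "{M. ideal_family L X M \<and> D \<subseteq> M}"
  have chain: "\<Union>\<C> \<in> ?F" if ne: "\<C> \<noteq> {}" and ch: "subset.chain ?F \<C>" for \<C>
  proof -
    have fam: "\<And>M. M \<in> \<C> \<Longrightarrow> ideal_family L X M" and DM: "\<And>M. M \<in> \<C> \<Longrightarrow> D \<subseteq> M"
      and lin: "\<And>M N. M \<in> \<C> \<Longrightarrow> N \<in> \<C> \<Longrightarrow> M \<subseteq> N \<or> N \<subseteq> M"
      using ch unfolding subset_chain_def by blast+
    have "ideal_family L X (\<Union>\<C>)" unfolding ideal_family_def
    proof (intro conjI ballI allI)
      show "\<Union>\<C> \<subseteq> carrier L \<times> topspace X" using ideal_familyD(1)[OF fam] by (rule Union_least)
      fix u assume u: "u \<in> topspace X"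
      show "(\<bottom>, u) \<in> \<Union>\<C>" using ideal_familyD(3)[OF fam u] ne by blast
      show "(\<top>, u) \<notin> \<Union>\<C>" using ideal_familyD(4)[OF fam] by blast
    next
      fix x y u assume xy: "x \<in> carrier L" "y \<in> carrier L"
      have *: "(x \<squnion> y, u) \<in> M \<longleftrightarrow> (x, u) \<in> M \<and> (y, u) \<in> M" if "M \<in> \<C>" for M
        using ideal_familyD(2)[OF fam[OF that] xy] .
      have "\<exists>M\<in>\<C>. (x, u) \<in> M \<and> (y, u) \<in> M" if xu: "(x, u) \<in> \<Union>\<C>" and yu: "(y, u) \<in> \<Union>\<C>"
      proof -
        obtain M N where "M \<in> \<C>" "(x, u) \<in> M" "N \<in> \<C>" "(y, u) \<in> N" using xu yu by blast
        then show ?thesis using lin[of M N] by blast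
      qed
      then show "(x \<squnion> y, u) \<in> \<Union>\<C> \<longleftrightarrow> (x, u) \<in> \<Union>\<C> \<and> (y, u) \<in> \<Union>\<C>" using * by blast
    next
      fix x assume x: "x \<in> carrier L"
      have "openin X (\<Union>M\<in>\<C>. {u. (x, u) \<in> M})"
        using ideal_familyD(5)[OF fam x] by blast
      moreover have "(\<Union>M\<in>\<C>. {u. (x, u) \<in> M}) = {u. (x, u) \<in> \<Union>\<C>}" by blast
      ultimately show "openin X {u. (x, u) \<in> \<Union>\<C>}" by simp
    qed
    then show ?thesis using DM ne by blast
  qed
  have "?F \<noteq> {}" using D by blast
  then have "\<exists>M\<in>?F. \<forall>N\<in>?F. M \<subseteq> N \<longrightarrow> N = M" using chain by (rule subset_Zorn_nonempty)
  then obtain M where "M \<in> ?F" and "\<forall>N\<in>?F. M \<subseteq> N \<longrightarrow> N = M" by (elim bexE)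
  then have M: "ideal_family L X M" "D \<subseteq> M"
    and max: "\<And>N. ideal_family L X N \<Longrightarrow> D \<subseteq> N \<Longrightarrow> M \<subseteq> N \<Longrightarrow> N = M"
    by simp_all
  have dom: "M \<subseteq> carrier L \<times> topspace X"
    and jn: "\<And>x y u. x \<in> carrier L \<Longrightarrow> y \<in> carrier L \<Longrightarrow> (x \<squnion> y, u) \<in> M \<longleftrightarrow> (x, u) \<in> M \<and> (y, u) \<in> M"
    and bt: "\<And>u. u \<in> topspace X \<Longrightarrow> (\<bottom>, u) \<in> M" and tp: "\<And>u. (\<top>, u) \<notin> M"
    and op: "\<And>x. x \<in> carrier L \<Longrightarrow> openin X {u. (x, u) \<in> M}"
    using ideal_familyD[OF M(1)] by simp_all
  have down: "(x, u) \<in> M" if "(y, u) \<in> M" "x \<in> carrier L" "y \<in> carrier L" "x \<sqsubseteq> y" for x y u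
    using jn[of x y u] that le_iff_meet[of x y] by simp
  define Op where "Op x = {u. (x, u) \<in> M}" for x
  define E where "E a x = {u \<in> topspace X. (x \<sqinter> cmpl L a, u) \<notin> M \<and> (a, u) \<in> M}" for a x
  have key: "Op (cmpl L a) = topspace X - X closure_of (Op a)" if a: "a \<in> carrier L" for a
  proof -
    define N where "N = {(x, u). x \<in> carrier L \<and> u \<in> topspace X \<and> (x \<sqinter> a, u) \<in> M \<and> u \<notin> X closure_of (E a x)}"
    have Ejn: "E a (x \<squnion> y) = E a x \<union> E a y" if "x \<in> carrier L" "y \<in> carrier L" for x y
    proof -
      have "(x \<squnion> y) \<sqinter> cmpl L a = (x \<sqinter> cmpl L a) \<squnion> (y \<sqinter> cmpl L a)"
        using meet_join_distrib[of "cmpl L a" x y] that a meet_comm[of L "cmpl L a"] by simp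
      then show ?thesis using jn[of "x \<sqinter> cmpl L a" "y \<sqinter> cmpl L a"] that a by (auto simp: E_def)
    qed
    have "M \<subseteq> N"
    proof
      fix z assume z: "z \<in> M"
      then obtain x u where xu: "z = (x, u)" "x \<in> carrier L" "u \<in> topspace X" using dom by blast
      have "(x \<sqinter> a, u) \<in> M" using down[of x u "x \<sqinter> a"] z xu a meet_left by simp
      moreover have "u \<notin> X closure_of (E a x)"
      proof
        assume "u \<in> X closure_of (E a x)"
        moreover have "u \<in> Op x" "openin X (Op x)" using z xu op by (auto simp: Op_def)
        ultimately obtain v where "v \<in> E a x" "v \<in> Op x" unfolding in_closure_of by blast
        then show False using down[of x v "x \<sqinter> cmpl L a"] xu a meet_left by (auto simp: E_def Op_def)
      qed
      ultimately show "z \<in> N" using xu by (simp add: N_def)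
    qed
    moreover have "ideal_family L X N" unfolding ideal_family_def
    proof (intro conjI ballI allI)
      show "N \<subseteq> carrier L \<times> topspace X" unfolding N_def by blast
    next
      fix x y u assume xy: "x \<in> carrier L" "y \<in> carrier L"
      have "(x \<squnion> y) \<sqinter> a = (x \<sqinter> a) \<squnion> (y \<sqinter> a)"
        using meet_join_distrib[of a x y] xy a meet_comm[of L a] by simp
      then show "(x \<squnion> y, u) \<in> N \<longleftrightarrow> (x, u) \<in> N \<and> (y, u) \<in> N"
        using jn[of "x \<sqinter> a" "y \<sqinter> a" u] xy a by (auto simp: N_def Ejn closure_of_Un)
    next
      fix u assume u: "u \<in> topspace X"
      have "E a \<bottom> = {}" using bt bottom_meet a by (auto simp: E_def eq_is_equal)
      then show "(\<bottom>, u) \<in> N" using u bt bottom_meet[OF a] by (simp add: N_def eq_is_equal)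
      show "(\<top>, u) \<notin> N"
      proof
        assume "(\<top>, u) \<in> N"
        then have au: "(a, u) \<in> M" and nc: "u \<notin> X closure_of (E a \<top>)"
          using a by (auto simp: N_def top_meet_eq)
        then have "(cmpl L a, u) \<notin> M" using jn[of a "cmpl L a" u] a tp by (simp add: join_cmpl)
        then have "u \<in> E a \<top>" using u au a by (simp add: E_def top_meet_eq)
        moreover have "E a \<top> \<subseteq> X closure_of (E a \<top>)" by (rule closure_of_subset) (auto simp: E_def)
        ultimately show False using nc by blast
      qed
    next
      fix x assume x: "x \<in> carrier L"
      have "{u. (x, u) \<in> N} = {u. (x \<sqinter> a, u) \<in> M} \<inter> (topspace X - X closure_of (E a x))"
        using x dom by (auto simp: N_def)
      moreover have "openin X (topspace X - X closure_of (E a x))"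
        by (simp add: openin_diff)
      ultimately show "openin X {u. (x, u) \<in> N}" using op[of "x \<sqinter> a"] x a by (simp add: openin_Int)
    qed
    ultimately have NM: "N = M" using max M(2) by blast
    have "E a (cmpl L a) = Op a"
    proof -
      have "cmpl L a \<sqinter> cmpl L a = cmpl L a" using a le_iff_join[of "cmpl L a" "cmpl L a"] by simp
      moreover have "(cmpl L a, u) \<notin> M" if "(a, u) \<in> M" for u
        using that jn[of a "cmpl L a" u] a tp by (simp add: join_cmpl)
      ultimately show ?thesis using dom by (auto simp: E_def Op_def)
    qed
    moreover have "cmpl L a \<sqinter> a = \<bottom>" using meet_cmpl[OF a] meet_comm by metis
    ultimately have "{u. (cmpl L a, u) \<in> N} = topspace X - X closure_of (Op a)"
      using a bt by (auto simp: N_def)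
    then show ?thesis using NM by (simp add: Op_def)
  qed
  have "Op (cmpl L a) = topspace X - Op a" if a: "a \<in> carrier L" for a
  proof -
    have "openin X (Op (cmpl L a))" using op a by (simp add: Op_def)
    then have "openin X (X closure_of (Op (cmpl L a)))" using X by (simp add: extremally_disconnected_def)
    moreover have "Op a = topspace X - X closure_of (Op (cmpl L a))" using key[of "cmpl L a"] a by simp
    ultimately have "closedin X (Op a)" by auto
    then show ?thesis using key[OF a] by (simp add: closure_of_closedin)
  qed
  then show ?thesis using M by (intro exI[of _ M]) (auto simp: Op_def)
qed

text \<open>Gleason's theorem that extremally disconnected spaces are projective, in algebraic form. A
homomorphism \<open>\<phi>\<close> descends to \<open>f\<close> exactly if \<open>\<phi> a \<in> u\<close> implies \<open>f (p' u) \<in> p (\<epsilon> a)\<close>. The set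
of points satisfying the conclusion is closed and sends joins to unions, but it need not be clopen. The
complementary family of ideals is therefore enlarged to a family of prime ideals, whose members
have clopen complements; these are the Stone sets of the values of \<open>\<phi>\<close>.\<close>

lemma (in dual_space_pair) dual_map_exists:
  assumes f: "f \<in> ext_continuous Y' Y"
  shows "\<exists>\<phi>. dual \<phi> f"
proof -
  have cf: "continuous_map Y' Y f" using f by (simp add: ext_continuous_def)
  have cfp: "continuous_map (Ult A') Y (f \<circ> p')" using continuous_map_compose[OF A'.continuous_p cf] .
  have fin: "f (p' u) \<in> topspace Y" if "u \<in> topspace (Ult A')" for u
    using cfp that by (auto simp: continuous_map_def)
  define D where "D = {(a, u). a \<in> carrier A \<and> u \<in> topspace (Ult A') \<and> f (p' u) \<notin> p ` stone_set A a}"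
  have "ideal_family A (Ult A') D" unfolding ideal_family_def
  proof (intro conjI ballI allI)
    show "D \<subseteq> carrier A \<times> topspace (Ult A')" by (auto simp: D_def)
    show "(x \<squnion>\<^bsub>A\<^esub> y, u) \<in> D \<longleftrightarrow> (x, u) \<in> D \<and> (y, u) \<in> D" if "x \<in> carrier A" "y \<in> carrier A" for x y u
      using that by (auto simp: D_def A.stone_set_join)
    show "(\<bottom>\<^bsub>A\<^esub>, u) \<in> D" "(\<top>\<^bsub>A\<^esub>, u) \<notin> D" if "u \<in> topspace (Ult A')" for u
      using that fin[OF that] A.surj_p
      by (simp_all add: D_def A.stone_set_bottom A.stone_set_top A.topspace_Ult)
    show "openin (Ult A') {u. (x, u) \<in> D}" if x: "x \<in> carrier A" for x
    proof -
      have "{u. (x, u) \<in> D} = {u \<in> topspace (Ult A'). (f \<circ> p') u \<in> topspace Y - p ` stone_set A x}"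
        using x fin by (auto simp: D_def)
      moreover have "openin Y (topspace Y - p ` stone_set A x)"
        using A.closedin_image_stone_set[OF x] by blast
      ultimately show ?thesis using openin_continuous_map_preimage[OF cfp] by (simp only:)
    qed
  qed
  from A.prime_ideal_family_extension[OF extremally_disconnected_Ult[OF A'.complete] this]
  obtain M where M: "ideal_family A (Ult A') M" "D \<subseteq> M"
    and pr: "\<And>a u. a \<in> carrier A \<Longrightarrow> u \<in> topspace (Ult A') \<Longrightarrow> (cmpl A a, u) \<in> M \<longleftrightarrow> (a, u) \<notin> M"
    by blast
  define K where "K a = {u \<in> topspace (Ult A'). (a, u) \<notin> M}" for a
  have jn: "\<And>x y u. x \<in> carrier A \<Longrightarrow> y \<in> carrier A \<Longrightarrow> (x \<squnion>\<^bsub>A\<^esub> y, u) \<in> M \<longleftrightarrow> (x, u) \<in> M \<and> (y, u) \<in> M"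
    and bt: "\<And>u. u \<in> topspace (Ult A') \<Longrightarrow> (\<bottom>\<^bsub>A\<^esub>, u) \<in> M"
    and tp: "\<And>u. (\<top>\<^bsub>A\<^esub>, u) \<notin> M"
    and op: "\<And>x. x \<in> carrier A \<Longrightarrow> openin (Ult A') {u. (x, u) \<in> M}"
    and dom: "M \<subseteq> carrier A \<times> topspace (Ult A')"
    using ideal_familyD[OF M(1)] by simp_all
  have "\<exists>b\<in>carrier A'. stone_set A' b = K a" if a: "a \<in> carrier A" for a
  proof (rule A'.clopen_is_stone_set)
    have "K a = topspace (Ult A') - {u. (a, u) \<in> M}" by (auto simp: K_def)
    then show "closedin (Ult A') (K a)" using op[OF a] by auto
    have "K a = {u. (cmpl A a, u) \<in> M}" using pr[OF a] dom by (auto simp: K_def)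
    then show "openin (Ult A') (K a)" using op[of "cmpl A a"] a by simp
  qed
  then obtain \<phi>0 where \<phi>0: "\<And>a. a \<in> carrier A \<Longrightarrow> \<phi>0 a \<in> carrier A' \<and> stone_set A' (\<phi>0 a) = K a"
    by metis
  define \<phi> where "\<phi> = restrict \<phi>0 (carrier A)"
  have \<phi>c: "\<phi> a \<in> carrier A'" and \<phi>s: "stone_set A' (\<phi> a) = K a" if "a \<in> carrier A" for a
    using \<phi>0[OF that] that by (auto simp: \<phi>_def)
  have Kj: "K (x \<squnion>\<^bsub>A\<^esub> y) = K x \<union> K y" if "x \<in> carrier A" "y \<in> carrier A" for x y
    using jn[OF that] by (auto simp: K_def)
  have Kc: "K (cmpl A x) = topspace (Ult A') - K x" if "x \<in> carrier A" for x
    using pr[OF that] by (auto simp: K_def)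
  have Km: "K (x \<sqinter>\<^bsub>A\<^esub> y) = K x \<inter> K y" if xy: "x \<in> carrier A" "y \<in> carrier A" for x y
  proof -
    have "x \<sqinter>\<^bsub>A\<^esub> y = cmpl A (cmpl A x \<squnion>\<^bsub>A\<^esub> cmpl A y)"
      using xy A.stone_set_subset_topspace[of x] A.stone_set_subset_topspace[of y]
      by (subst A.stone_set_eq_iff[symmetric])
        (auto simp: A.stone_set_meet A.stone_set_join A.stone_set_cmpl)
    then have "K (x \<sqinter>\<^bsub>A\<^esub> y) = topspace (Ult A') - ((topspace (Ult A') - K x) \<union> (topspace (Ult A') - K y))"
      using xy by (simp add: Kc Kj)
    then show ?thesis by (auto simp: K_def)
  qed
  have eqI: "a = b" if "a \<in> carrier A'" "b \<in> carrier A'" "stone_set A' a = stone_set A' b" for a b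
    using that A'.stone_set_eq_iff by blast
  have hom: "\<phi> \<in> boolean_hom A A'" unfolding boolean_hom_def
  proof (intro CollectI conjI ballI)
    show "\<phi> \<in> carrier A \<rightarrow>\<^sub>E carrier A'" using \<phi>c by (auto simp: \<phi>_def)
    fix x assume x: "x \<in> carrier A"
    show "\<phi> (cmpl A x) = cmpl A' (\<phi> x)"
      by (rule eqI) (use x \<phi>c in \<open>simp_all add: \<phi>s Kc A'.stone_set_cmpl\<close>)
    fix y assume y: "y \<in> carrier A"
    show "\<phi> (x \<squnion>\<^bsub>A\<^esub> y) = \<phi> x \<squnion>\<^bsub>A'\<^esub> \<phi> y"
      by (rule eqI) (use x y \<phi>c in \<open>simp_all add: \<phi>s Kj A'.stone_set_join\<close>)
    show "\<phi> (x \<sqinter>\<^bsub>A\<^esub> y) = \<phi> x \<sqinter>\<^bsub>A'\<^esub> \<phi> y"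
      by (rule eqI) (use x y \<phi>c in \<open>simp_all add: \<phi>s Km A'.stone_set_meet\<close>)
  next
    show "\<phi> \<bottom>\<^bsub>A\<^esub> = \<bottom>\<^bsub>A'\<^esub>"
      by (rule eqI) (use \<phi>c bt in \<open>simp_all add: \<phi>s A'.stone_set_bottom K_def\<close>)
    show "\<phi> \<top>\<^bsub>A\<^esub> = \<top>\<^bsub>A'\<^esub>"
      by (rule eqI) (use \<phi>c tp in \<open>auto simp: \<phi>s A'.stone_set_top A'.topspace_Ult K_def\<close>)
  qed
  have "p {a \<in> carrier A. \<phi> a \<in> u} = f (p' u)" if u: "u \<in> topspace (Ult A')" for u
  proof (rule ccontr)
    let ?g = "{a \<in> carrier A. \<phi> a \<in> u}"
    assume ne: "p ?g \<noteq> f (p' u)"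
    have g: "?g \<in> topspace (Ult A)" using preimage_in[OF hom u] .
    then obtain U V where UV: "openin Y U" "openin Y V" "p ?g \<in> U" "f (p' u) \<in> V" "disjnt U V"
      using A.Hausdorff_Y A.p_in[OF g] fin[OF u] ne unfolding Hausdorff_space_def by blast
    obtain a where a: "a \<in> carrier A" "?g \<in> stone_set A a" "p ` stone_set A a \<subseteq> U"
      using A.basic_neighbourhood[OF UV(1) g UV(3)] by blast
    \<comment> \<open>\<open>U\<close> and \<open>V\<close> are disjoint neighbourhoods of the two points, and the Stone set of \<open>a\<close> is mapped into \<open>U\<close>.\<close>
    have "f (p' u) \<notin> p ` stone_set A a" using a(3) UV(4,5) by (auto simp: disjnt_def)
    then have "(a, u) \<in> M" using M(2) a(1) u by (auto simp: D_def)
    moreover have "\<phi> a \<in> u" using a(2) by (simp add: A.mem_stone_set)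
    then have "u \<in> stone_set A' (\<phi> a)" using u by (simp add: A'.mem_stone_set A'.topspace_Ult)
    then have "u \<in> K a" using \<phi>s[OF a(1)] by simp
    ultimately show False by (simp add: K_def)
  qed
  then show ?thesis using hom f by (intro exI[of _ \<phi>]) (simp add: dual_map_def)
qed

section \<open>The dual space of a de Vries algebra\<close>

text \<open>The quotient topology on the image. The hypothesis says that \<open>q\<close> is a closed map to it, and closed
continuous images of normal Hausdorff spaces are normal Hausdorff.\<close>

lemma compact_Hausdorff_quotient:
  assumes X: "compact_space X" "Hausdorff_space X"
    and sat: "\<And>F. closedin X F \<Longrightarrow> closedin X {x \<in> topspace X. q x \<in> q ` F}"
  shows "\<exists>Y. topspace Y = q ` topspace X \<and> continuous_map X Y q \<and> compact_Hausdorff Y"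
proof -
  let ?P = "\<lambda>U. U \<subseteq> q ` topspace X \<and> openin X {x \<in> topspace X. q x \<in> U}"
  define Y where "Y = topology ?P"
  have "istopology ?P" unfolding istopology_def
  proof (intro conjI allI impI)
    fix U V assume UV: "?P U" "?P V"
    have "{x \<in> topspace X. q x \<in> U \<inter> V} = {x \<in> topspace X. q x \<in> U} \<inter> {x \<in> topspace X. q x \<in> V}" by blast
    then show "U \<inter> V \<subseteq> q ` topspace X" "openin X {x \<in> topspace X. q x \<in> U \<inter> V}" using UV by auto
  next
    fix \<U> assume U: "\<forall>U\<in>\<U>. ?P U"
    have "{x \<in> topspace X. q x \<in> \<Union>\<U>} = (\<Union>U\<in>\<U>. {x \<in> topspace X. q x \<in> U})" by blast
    then show "\<Union>\<U> \<subseteq> q ` topspace X" "openin X {x \<in> topspace X. q x \<in> \<Union>\<U>}" using U by auto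
  qed
  then have op: "openin Y U \<longleftrightarrow> ?P U" for U unfolding Y_def by (simp add: topology_inverse')
  have "{x \<in> topspace X. q x \<in> q ` topspace X} = topspace X" by blast
  then have top: "topspace Y = q ` topspace X"
    using op[of "q ` topspace X"] op[of "topspace Y"] openin_subset[of Y "q ` topspace X"] by auto
  have cont: "continuous_map X Y q"
    unfolding continuous_map_def using op top by auto
  have cl: "closed_map X Y q" unfolding closed_map_def
  proof (intro allI impI)
    fix F assume F: "closedin X F"
    have sub: "q ` F \<subseteq> topspace Y" using closedin_subset[OF F] top by blast
    have "{x \<in> topspace X. q x \<in> topspace Y - q ` F} = topspace X - {x \<in> topspace X. q x \<in> q ` F}"
      using top by blast
    then have "openin Y (topspace Y - q ` F)" using sat[OF F] op top by auto
    then show "closedin Y (q ` F)" using sub by (simp add: closedin_def)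
  qed
  have "Hausdorff_space Y"
    using normal_Hausdorff_space_closed_continuous_map_image[OF _ X(2) cl cont top[symmetric]]
      compact_Hausdorff_or_regular_imp_normal_space X by blast
  moreover have "compact_space Y"
    using image_compactin[of X "topspace X" Y q] X(1) cont top by (simp add: compact_space_def)
  ultimately show ?thesis using top cont by (auto simp: compact_Hausdorff_def)
qed

context normal_contact_algebra
begin

definition touches :: "'a set \<Rightarrow> 'a set \<Rightarrow> bool" where
  "touches u v \<longleftrightarrow> (\<forall>a\<in>u. \<forall>b\<in>v. a \<frown> b)"

lemma contact_mono:
  assumes "a \<frown> b" "a \<in> carrier A" "b \<in> carrier A" "c \<in> carrier A" "d \<in> carrier A" "a \<sqsubseteq> c" "b \<sqsubseteq> d"
  shows "c \<frown> d"
proof -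
  have "a \<frown> d" using contact_join[of a b d] assms le_iff_meet[of b d] by simp
  then have "d \<frown> a" using contact_sym assms by blast
  then have "d \<frown> c" using contact_join[of d a c] assms le_iff_meet[of a c] by simp
  then show ?thesis using contact_sym assms by blast
qed

lemma not_contact_bottom: "a \<in> carrier A \<Longrightarrow> \<not> a \<frown> \<bottom>"
  using contact_pos[of a \<bottom>] by (auto simp: lless_def eq_is_equal)

lemma touches_refl:
  assumes u: "ultrafilter_on A u" shows "touches u u"
  unfolding touches_def
proof (intro ballI)
  fix a b assume ab: "a \<in> u" "b \<in> u"
  then have c: "a \<in> carrier A" "b \<in> carrier A" using ultrafilter_onD(1)[OF u] by blast+
  have "a \<sqinter> b \<noteq> \<bottom>" using ultrafilter_onD(3,4)[OF u] ab by metis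
  then have "\<bottom> \<sqsubset> a \<sqinter> b" using c by (simp add: lless_def eq_is_equal)
  then have "a \<sqinter> b \<frown> a \<sqinter> b" using contact_refl c by simp
  from contact_mono[OF this _ _ c meet_left[OF c] meet_right[OF c]]
  show "a \<frown> b" using c by simp
qed

lemma touches_sym:
  assumes "ultrafilter_on A u" "ultrafilter_on A v" "touches u v" shows "touches v u"
proof -
  have "u \<subseteq> carrier A" "v \<subseteq> carrier A" using assms ultrafilter_onD(1) by auto
  then show ?thesis using assms(3) contact_sym unfolding touches_def by blast
qed

text \<open>The separation axiom splits \<open>a\<close> from \<open>c\<close> by some \<open>d\<close>; the ultrafilter in the middle contains
\<open>d\<close> or its complement, and either contradicts one of the hypotheses.\<close>

lemma touches_trans:
  assumes uvw: "ultrafilter_on A u" "ultrafilter_on A v" "ultrafilter_on A w"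
    and "touches u v" "touches v w"
  shows "touches u w"
  unfolding touches_def
proof (intro ballI)
  fix a c assume ac: "a \<in> u" "c \<in> w"
  then have car: "a \<in> carrier A" "c \<in> carrier A" using uvw ultrafilter_onD(1) by blast+
  show "a \<frown> c"
  proof (rule ccontr)
    assume "\<not> a \<frown> c"
    then obtain d where d: "d \<in> carrier A" "\<not> a \<frown> d" "\<not> c \<frown> cmpl A d"
      using contact_separation car by blast
    then have "\<not> cmpl A d \<frown> c" using contact_sym[of "cmpl A d" c] car by auto
    moreover have "d \<in> v \<or> cmpl A d \<in> v" using ultrafilter_cmpl[OF uvw(2) d(1)] by blast
    ultimately show False using assms(4,5) ac d(2) unfolding touches_def by blast
  qed
qed

text \<open>The elements that are not in contact with some member of \<open>v\<close> form an ideal, since \<open>v\<close> is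
closed under meets; an ultrafilter touches \<open>v\<close> exactly if it avoids this ideal.\<close>

lemma touching_ultrafilter_exists:
  assumes v: "v \<subseteq> carrier A" "v \<noteq> {}" "\<And>x y. \<lbrakk>x \<in> v; y \<in> v\<rbrakk> \<Longrightarrow> x \<sqinter> y \<in> v"
    and a: "a \<in> carrier A" "\<And>b. b \<in> v \<Longrightarrow> a \<frown> b"
  shows "\<exists>u. ultrafilter_on A u \<and> a \<in> u \<and> touches u v"
proof -
  define J where "J = {x \<in> carrier A. \<exists>b\<in>v. \<not> x \<frown> b}"
  have vc: "b \<in> carrier A" if "b \<in> v" for b using that v(1) by blast
  have "\<exists>u. ultrafilter_on A u \<and> a \<in> u \<and> u \<inter> J = {}"
  proof (rule ultrafilter_avoiding_ideal)
    obtain b where b: "b \<in> v" using v(2) by blast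
    then have "\<not> \<bottom> \<frown> b" using not_contact_bottom[of b] contact_sym[of \<bottom> b] vc by auto
    then show "\<bottom> \<in> J" using b by (auto simp: J_def)
    show "x \<squnion> y \<in> J" if x: "x \<in> J" and y: "y \<in> J" for x y
    proof -
      obtain d e where de: "d \<in> v" "\<not> x \<frown> d" "e \<in> v" "\<not> y \<frown> e" using x y by (auto simp: J_def)
      have c: "x \<in> carrier A" "y \<in> carrier A" using x y by (auto simp: J_def)
      have m: "d \<sqinter> e \<in> carrier A" using de vc by simp
      have "\<not> x \<frown> d \<sqinter> e" using contact_mono[of x "d \<sqinter> e" x d] de vc c m meet_left by auto
      moreover have "\<not> y \<frown> d \<sqinter> e" using contact_mono[of y "d \<sqinter> e" y e] de vc c m meet_right by auto
      ultimately have "\<not> d \<sqinter> e \<frown> x \<squnion> y"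
        using contact_join[OF m c] contact_sym[OF m c(1)] contact_sym[OF m c(2)] by blast
      then have "\<not> x \<squnion> y \<frown> d \<sqinter> e" using contact_sym[OF join_closed[OF c] m] by blast
      then show ?thesis using v(3)[OF de(1,3)] c by (auto simp: J_def)
    qed
    show "x \<in> J" if xy: "y \<in> J" "x \<in> carrier A" "x \<sqsubseteq> y" for x y
    proof -
      obtain d where d: "d \<in> v" "\<not> y \<frown> d" "y \<in> carrier A" using xy(1) by (auto simp: J_def)
      then have "\<not> x \<frown> d" using contact_mono[of x d y d] vc xy by auto
      then show ?thesis using d xy(2) by (auto simp: J_def)
    qed
  qed (use a in \<open>auto simp: J_def\<close>)
  then obtain u where u: "ultrafilter_on A u" "a \<in> u" "u \<inter> J = {}" by blast
  then have "touches u v" using ultrafilter_onD(1)[OF u(1)] by (auto simp: touches_def J_def)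
  then show ?thesis using u by blast
qed

text \<open>The preceding lemma is applied twice, first to \<open>a\<close> and \<open>{b}\<close>, then to \<open>b\<close> and the ultrafilter
obtained.\<close>

lemma touching_ultrafilters_exist:
  assumes ab: "a \<in> carrier A" "b \<in> carrier A" "a \<frown> b"
  shows "\<exists>u v. ultrafilter_on A u \<and> ultrafilter_on A v \<and> a \<in> u \<and> b \<in> v \<and> touches u v"
proof -
  have bb: "b \<sqinter> b = b" using ab(2) le_iff_join[of b b] by simp
  have "\<exists>u. ultrafilter_on A u \<and> a \<in> u \<and> touches u {b}"
    by (rule touching_ultrafilter_exists) (use ab bb in auto)
  then obtain u where u: "ultrafilter_on A u" "a \<in> u" "touches u {b}" by blast
  have uc: "u \<subseteq> carrier A" using ultrafilter_onD(1)[OF u(1)] .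
  have "b \<frown> c" if "c \<in> u" for c
    using that u(3) contact_sym[of c b] uc ab(2) by (auto simp: touches_def)
  then have "\<exists>v. ultrafilter_on A v \<and> b \<in> v \<and> touches v u"
    using uc u(2) ultrafilter_onD(4)[OF u(1)] ab(2) by (intro touching_ultrafilter_exists) auto
  then show ?thesis using u(1,2) touches_sym by blast
qed

text \<open>If \<open>v\<close> touches no member of \<open>F\<close>, the elements that are not in contact with some member of \<open>v\<close>
have Stone sets covering \<open>F\<close>. They form an ideal \<open>J\<close>, so by compactness the Stone set of a single
\<open>a \<in> J\<close> covers \<open>F\<close>. The member of \<open>v\<close> not in contact with \<open>a\<close> defines a neighbourhood of \<open>v\<close>
outside the saturation.\<close>

lemma closedin_touches_saturation:
  assumes F: "closedin (Ult A) F"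
  shows "closedin (Ult A) {v \<in> topspace (Ult A). \<exists>u\<in>F. touches u v}"
proof -
  let ?S = "{v \<in> topspace (Ult A). \<exists>u\<in>F. touches u v}"
  have "openin (Ult A) (topspace (Ult A) - ?S)"
  proof (subst openin_subopen, intro ballI)
    fix v assume v: "v \<in> topspace (Ult A) - ?S"
    then have vu: "ultrafilter_on A v" by (simp add: topspace_Ult)
    have vc: "c \<in> carrier A" if "c \<in> v" for c using that ultrafilter_onD(1)[OF vu] by blast
    define J where "J = {a \<in> carrier A. \<exists>b\<in>v. \<not> a \<frown> b}"
    let ?U = "\<Union>(stone_set A ` J)"
    have "openin (Ult A) ?U" using openin_stone_set by (auto simp: J_def)
    moreover have "F \<subseteq> ?U"
    proof
      fix u assume u: "u \<in> F"
      then have uu: "ultrafilter_on A u" using closedin_subset[OF F] topspace_Ult by blast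
      then obtain a b where "a \<in> u" "b \<in> v" "\<not> a \<frown> b" using u v unfolding touches_def by blast
      then show "u \<in> ?U" using uu ultrafilter_onD(1)[OF uu] by (auto simp: J_def mem_stone_set)
    qed
    ultimately obtain a where a: "a \<in> carrier A" "F \<subseteq> stone_set A a" "stone_set A a \<subseteq> ?U"
      using stone_set_between[OF F] by blast
    \<comment> \<open>Every ultrafilter containing \<open>a\<close> has a member in \<open>J\<close>, and therefore does not touch \<open>v\<close>.\<close>
    have "a \<in> J"
    proof (rule ccontr)
      assume "a \<notin> J"
      then have "a \<frown> b" if "b \<in> v" for b using that a(1) by (auto simp: J_def)
      then have "\<exists>w. ultrafilter_on A w \<and> a \<in> w \<and> touches w v"
        using a(1) ultrafilter_onD(1,2,4)[OF vu] by (intro touching_ultrafilter_exists) auto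
      then obtain w where w: "w \<in> stone_set A a" "touches w v" by (auto simp: mem_stone_set)
      then obtain c where "c \<in> J" "w \<in> stone_set A c" using a(3) by blast
      then show False using w(2) by (auto simp: mem_stone_set J_def touches_def)
    qed
    then obtain b where b: "b \<in> v" "\<not> a \<frown> b" by (auto simp: J_def)
    have "stone_set A b \<subseteq> topspace (Ult A) - ?S"
      using b(2) a(2) stone_set_subset_topspace[of b] by (auto simp: mem_stone_set touches_def)
    then show "\<exists>T. openin (Ult A) T \<and> v \<in> T \<and> T \<subseteq> topspace (Ult A) - ?S"
      using openin_stone_set[OF vc[OF b(1)]] b(1) vu mem_stone_set by blast
  qed
  then show ?thesis by (simp add: closedin_def)
qed

end

text \<open>The quotient is realised on a set of representatives: each touching class is replaced by one of its
ultrafilters, and these are subsets of the carrier, which have a copy inside \<open>B\<close>. Irreducibility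
is the density axiom: a proper closed set lies in the Stone set of some \<open>a\<^sup>* < 1\<close>, and there is
\<open>b > 0\<close> not in contact with \<open>a\<^sup>*\<close>.\<close>

lemma de_vries_dual_space:
  fixes A :: "'a contact_lattice" (structure) and B :: "'y set"
  assumes A: "de_vries_algebra A" and B: "Pow (carrier A) \<lesssim> B"
  shows "\<exists>p Y. dual_space A p Y \<and> topspace Y \<subseteq> B"
proof -
  interpret normal_contact_algebra A using A by (simp add: de_vries_algebra_def)
  have comp: "complete_boolean A" using A by (simp add: de_vries_algebra_def)
  obtain g where g: "inj_on g (Pow (carrier A))" "g ` Pow (carrier A) \<subseteq> B"
    using B by (auto simp: lepoll_def)
  let ?X = "topspace (Ult A)"
  define r where "r u = (SOME v. v \<in> ?X \<and> touches u v)" for u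
  have r: "r u \<in> ?X \<and> touches u (r u)" if "u \<in> ?X" for u
    unfolding r_def by (rule someI[of _ u]) (use that touches_refl in \<open>auto simp: topspace_Ult\<close>)
  have rr: "r u = r v \<longleftrightarrow> touches u v" if uv: "u \<in> ?X" "v \<in> ?X" for u v
  proof
    have U: "ultrafilter_on A u" "ultrafilter_on A v" "ultrafilter_on A (r u)" "ultrafilter_on A (r v)"
      using uv r[OF uv(1)] r[OF uv(2)] by (simp_all add: topspace_Ult)
    show "touches u v" if "r u = r v"
      using that touches_trans[OF U(1,3,2)] touches_sym[OF U(2,4)] r[OF uv(1)] r[OF uv(2)] by simp
    assume t: "touches u v"
    have "touches u w \<longleftrightarrow> touches v w" if "w \<in> ?X" for w
      using that touches_trans[OF U(1,2), of w] touches_trans[OF U(2,1), of w] touches_sym[OF U(1,2) t] t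
      by (auto simp: topspace_Ult)
    then have "(\<lambda>w. w \<in> ?X \<and> touches u w) = (\<lambda>w. w \<in> ?X \<and> touches v w)" by blast
    then show "r u = r v" unfolding r_def by simp
  qed
  define q where "q = restrict (\<lambda>u. g (r u)) ?X"
  have rP: "r u \<in> Pow (carrier A)" if "u \<in> ?X" for u
    using r[OF that] ultrafilter_onD(1) by (auto simp: topspace_Ult)
  have q: "q u = q v \<longleftrightarrow> touches u v" if "u \<in> ?X" "v \<in> ?X" for u v
    using inj_on_eq_iff[OF g(1) rP[OF that(1)] rP[OF that(2)]] rr[OF that] that by (simp add: q_def)
  have "closedin (Ult A) {x \<in> ?X. q x \<in> q ` F}" if F: "closedin (Ult A) F" for F
  proof -
    have "{x \<in> ?X. q x \<in> q ` F} = {v \<in> ?X. \<exists>u\<in>F. touches u v}"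
      using q closedin_subset[OF F] by (auto simp: image_iff) (metis subsetD)+
    then show ?thesis using closedin_touches_saturation[OF F] by simp
  qed
  from compact_Hausdorff_quotient[OF compact_space_Ult Hausdorff_space_Ult this]
  obtain Y where Y: "topspace Y = q ` ?X" "continuous_map (Ult A) Y q" "compact_Hausdorff Y" by blast
  have ct: "a \<frown> b \<longleftrightarrow> q ` stone_set A a \<inter> q ` stone_set A b \<noteq> {}"
    if ab: "a \<in> carrier A" "b \<in> carrier A" for a b
  proof
    assume "a \<frown> b"
    then obtain u v where uv: "ultrafilter_on A u" "ultrafilter_on A v" "a \<in> u" "b \<in> v" "touches u v"
      using touching_ultrafilters_exist ab by blast
    then have "q u = q v" using q by (simp add: topspace_Ult)
    then show "q ` stone_set A a \<inter> q ` stone_set A b \<noteq> {}"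
      using uv by (auto simp: stone_set_def)
  next
    assume "q ` stone_set A a \<inter> q ` stone_set A b \<noteq> {}"
    then obtain u v where uv: "u \<in> stone_set A a" "v \<in> stone_set A b" "q u = q v" by blast
    then have "touches u v" using q[of u v] stone_set_subset_topspace by blast
    then show "a \<frown> b" using uv by (auto simp: touches_def mem_stone_set)
  qed
  have irr: "irreducible_map (Ult A) Y q" unfolding irreducible_map_def
  proof (intro conjI allI impI)
    show "q ` topspace (Ult A) = topspace Y" using Y(1) by simp
    fix Z assume Z: "closedin (Ult A) Z \<and> Z \<noteq> topspace (Ult A)"
    then obtain a where a: "a \<in> carrier A" "a \<noteq> \<bottom>" "Z \<inter> stone_set A a = {}"
      using closedin_Ult_basic_complement by blast
    have "cmpl A a \<noteq> \<top>" using a stone_set_cmpl[OF a(1)] stone_set_top topspace_Ult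
        stone_set_empty_iff[OF a(1)] stone_set_subset_topspace[of a] by auto
    then have "cmpl A a \<sqsubset> \<top>" using a(1) by (simp add: lless_def eq_is_equal)
    then obtain b where b: "b \<in> carrier A" "\<bottom> \<sqsubset> b" "\<not> b \<frown> cmpl A a"
      using contact_dense a(1) by (metis cmpl_closed)
    then have "b \<noteq> \<bottom>" by (auto simp: lless_def eq_is_equal)
    then obtain u where u: "u \<in> stone_set A b" using stone_set_empty_iff[OF b(1)] by blast
    have "Z \<subseteq> stone_set A (cmpl A a)"
      using a(3) closedin_subset[of "Ult A" Z] Z stone_set_cmpl[OF a(1)] by blast
    then have "q u \<notin> q ` Z" using ct[OF b(1) cmpl_closed[OF a(1)]] b(3) u by blast
    moreover have "q u \<in> topspace Y" using u stone_set_subset_topspace[of b] Y(1) by blast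
    ultimately show "q ` Z \<noteq> topspace Y" by blast
  qed
  have "class_P (Ult A) Y q"
    using irr Y(2,3) compact_Hausdorff_Ult extremally_disconnected_Ult[OF comp]
    by (simp add: class_P_def ext_continuous_def q_def)
  then have "dual_space A q Y"
    using comp ct by unfold_locales blast+
  moreover have "topspace Y \<subseteq> B" using Y(1) g(2) rP by (auto simp: q_def)
  ultimately show ?thesis by blast
qed

section \<open>The algebra of regular open sets\<close>

lemma complete_boolean_cong:
  fixes L :: "('a, 'b) gorder_scheme" and M :: "('a, 'c) gorder_scheme"
  assumes "carrier L = carrier M" "le L = le M" "eq L = eq M" and L: "complete_boolean L"
  shows "complete_boolean M"
proof -
  note c = order_structure_cong[OF assms(1,2)]
  have "equivalence L = equivalence M"
    by (simp add: equivalence_def assms(1-3))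
  then have wpo: "weak_partial_order L = weak_partial_order M"
    by (simp add: weak_partial_order_def weak_partial_order_axioms_def assms(1-3))
  then have po: "partial_order L = partial_order M"
    by (simp add: partial_order_def partial_order_axioms_def assms(1-3))
  have "Lattice.lattice L = Lattice.lattice M"
    by (simp add: lattice_def upper_semilattice_def lower_semilattice_def
        upper_semilattice_axioms_def lower_semilattice_axioms_def po c assms(1-3))
  then have "Lattice.bounded_lattice L = Lattice.bounded_lattice M"
    by (simp add: bounded_lattice_def weak_partial_order_bottom_def weak_partial_order_top_def
        weak_partial_order_bottom_axioms_def weak_partial_order_top_axioms_def wpo c assms(1-3))
  then have "boolean_lattice L = boolean_lattice M"
    by (simp add: boolean_lattice_def boolean_lattice_axioms_def c assms(1-3))
  moreover have "Complete_Lattice.complete_lattice L = Complete_Lattice.complete_lattice M"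
    by (simp add: Complete_Lattice.complete_lattice_def complete_lattice_axioms_def po c assms(1-3))
  ultimately show ?thesis using L by (simp add: complete_boolean_def)
qed

lemma dual_space_U_ob:
  assumes "complete_boolean L" and "class_P (Ult L) Y p"
  shows "dual_space (U_ob (L, p, Y)) p Y"
proof -
  let ?A = "U_ob (L, p, Y)"
  have c: "carrier L = carrier ?A" "le L = le ?A" "eq L = eq ?A" by simp_all
  have cb: "complete_boolean ?A" using complete_boolean_cong[OF c assms(1)] .
  interpret boolean_lattice ?A using cb complete_booleanD by blast
  note u = ultrafilter_cong[OF c(1,2)]
  have ct: "contact ?A = (\<lambda>a b. p ` stone_set L a \<inter> p ` stone_set L b \<noteq> {})" by simp
  show ?thesis
  proof unfold_locales
    show "class_P (Ult ?A) Y p" using assms(2) by (simp only: u)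
    show "a \<frown>\<^bsub>?A\<^esub> b \<longleftrightarrow> p ` stone_set ?A a \<inter> p ` stone_set ?A b \<noteq> {}" for a b
      by (simp only: ct u)
  qed (rule cb)
qed

lemma openin_regular_open: "U \<in> regular_opens Y \<Longrightarrow> openin Y U"
  using openin_interior_of[of Y "Y closure_of U"] by (simp add: regular_opens_def)

lemma regular_openD: "U \<in> regular_opens Y \<Longrightarrow> Y interior_of (Y closure_of U) = U"
  by (simp add: regular_opens_def)

lemma interior_of_closed_regular_open:
  assumes "closedin Y F" shows "Y interior_of F \<in> regular_opens Y"
proof -
  have "Y closure_of (Y interior_of F) \<subseteq> F"
    using assms by (simp add: closure_of_minimal interior_of_subset)
  then have "Y interior_of (Y closure_of (Y interior_of F)) \<subseteq> Y interior_of F"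
    by (rule interior_of_mono)
  moreover have "Y interior_of F \<subseteq> Y interior_of (Y closure_of (Y interior_of F))"
    by (intro interior_of_maximal closure_of_subset) (auto simp: interior_of_subset_topspace)
  ultimately show ?thesis by (simp add: regular_opens_def)
qed

lemma regular_open_hull:
  assumes "openin Y U"
  shows "Y interior_of (Y closure_of U) \<in> regular_opens Y" "U \<subseteq> Y interior_of (Y closure_of U)"
    "\<And>V. V \<in> regular_opens Y \<Longrightarrow> U \<subseteq> V \<Longrightarrow> Y interior_of (Y closure_of U) \<subseteq> V"
proof -
  show "Y interior_of (Y closure_of U) \<in> regular_opens Y"
    by (simp add: interior_of_closed_regular_open)
  show "U \<subseteq> Y interior_of (Y closure_of U)"
    by (intro interior_of_maximal closure_of_subset assms openin_subset[OF assms])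
  show "Y interior_of (Y closure_of U) \<subseteq> V" if "V \<in> regular_opens Y" "U \<subseteq> V" for V
    using interior_of_mono[OF closure_of_mono[OF that(2)], of Y Y] regular_openD[OF that(1)] by simp
qed

text \<open>The interior of the closure of this set is contained in every member of the family, because the
members are regular; so it is contained in the intersection.\<close>

lemma interior_regular_opens_Inter:
  assumes "\<And>V. V \<in> \<V> \<Longrightarrow> V \<in> regular_opens Y"
  shows "Y interior_of (topspace Y \<inter> \<Inter>\<V>) \<in> regular_opens Y"
proof -
  let ?S = "topspace Y \<inter> \<Inter>\<V>"
  let ?W = "Y interior_of ?S"
  have "Y interior_of (Y closure_of ?W) \<subseteq> V" if "V \<in> \<V>" for V
    using regular_open_hull(3)[OF openin_interior_of assms[OF that], of ?S] interior_of_subset[of Y ?S] that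
    by blast
  then have "Y interior_of (Y closure_of ?W) \<subseteq> ?S"
    using interior_of_subset_topspace[of Y "Y closure_of ?W"] by (simp add: le_Inf_iff)
  then have "Y interior_of (Y closure_of ?W) \<subseteq> ?W" by (intro interior_of_maximal) simp_all
  then show ?thesis using regular_open_hull(2)[of Y ?W] by (simp add: regular_opens_def)
qed

lemma regular_open_Int:
  assumes "U \<in> regular_opens Y" "V \<in> regular_opens Y" shows "U \<inter> V \<in> regular_opens Y"
proof -
  have "openin Y (U \<inter> V)" using assms openin_regular_open by blast
  then have "Y interior_of (topspace Y \<inter> \<Inter>{U, V}) = U \<inter> V"
    using openin_subset[of Y "U \<inter> V"] by (simp add: inf.absorb2 interior_of_openin)
  then show ?thesis using interior_regular_opens_Inter[of "{U, V}" Y] assms by auto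
qed

text \<open>The algebra of regular open sets, transported along a bijection \<open>r\<close> to a carrier in another
type: the spaces and the algebras of the duality live in different types.\<close>

locale regular_open_copy =
  fixes L :: "'a gorder" (structure) and Y :: "'y topology" and r :: "'a \<Rightarrow> 'y set"
  assumes bij: "bij_betw r (carrier L) (regular_opens Y)"
    and eq_eq: "eq L = (=)"
    and le_iff: "\<lbrakk>a \<in> carrier L; b \<in> carrier L\<rbrakk> \<Longrightarrow> a \<sqsubseteq> b \<longleftrightarrow> r a \<subseteq> r b"
    and compact_Hausdorff_Y: "compact_Hausdorff Y"
begin

lemma r_in: "a \<in> carrier L \<Longrightarrow> r a \<in> regular_opens Y"
  using bij by (auto simp: bij_betw_def)

lemma r_eq_iff: "a \<in> carrier L \<Longrightarrow> b \<in> carrier L \<Longrightarrow> r a = r b \<longleftrightarrow> a = b"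
  using bij by (auto simp: bij_betw_def inj_on_def)

lemma r_surj:
  assumes "U \<in> regular_opens Y" obtains a where "a \<in> carrier L" "r a = U"
proof -
  from assms have "U \<in> r ` carrier L" using bij by (simp add: bij_betw_def)
  then show ?thesis using that by blast
qed

lemma open_r: "a \<in> carrier L \<Longrightarrow> openin Y (r a)"
  using r_in openin_regular_open by blast

sublocale partial_order L
  by unfold_locales (auto simp: eq_eq le_iff r_eq_iff)

sublocale complete_lattice L
proof (rule complete_latticeI)
  fix M assume M: "M \<subseteq> carrier L"
  let ?U = "\<Union>(r ` M)"
  have op: "openin Y ?U" using M open_r by blast
  obtain s where s: "s \<in> carrier L" "r s = Y interior_of (Y closure_of ?U)"
    using r_surj[OF regular_open_hull(1)[OF op]] .
  have "least L s (Upper L M)"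
  proof (rule least_UpperI)
    show "x \<sqsubseteq> s" if "x \<in> M" for x
    proof -
      have "r x \<subseteq> r s" using regular_open_hull(2)[OF op] s(2) that by blast
      then show ?thesis using le_iff[of x s] M s(1) that by blast
    qed
    show "s \<sqsubseteq> y" if y: "y \<in> Upper L M" for y
    proof -
      have yc: "y \<in> carrier L" using y by (auto simp: Upper_def)
      have "?U \<subseteq> r y" using y M le_iff[OF _ yc] by (auto simp: Upper_def)
      then show ?thesis using regular_open_hull(3)[OF op r_in[OF yc]] s le_iff[OF s(1) yc] by simp
    qed
  qed (use M s in auto)
  then show "\<exists>s. least L s (Upper L M)" by blast
next
  fix M assume M: "M \<subseteq> carrier L"
  let ?W = "Y interior_of (topspace Y \<inter> \<Inter>(r ` M))"
  have "?W \<in> regular_opens Y" using M r_in by (intro interior_regular_opens_Inter) blast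
  then obtain i where i: "i \<in> carrier L" "r i = ?W" using r_surj by metis
  have "greatest L i (Lower L M)"
  proof (rule greatest_LowerI)
    show "i \<sqsubseteq> x" if "x \<in> M" for x
    proof -
      have "r i \<subseteq> r x"
        using interior_of_subset[of Y "topspace Y \<inter> \<Inter>(r ` M)"] i(2) that by blast
      then show ?thesis using le_iff[of i x] M i(1) that by blast
    qed
    show "y \<sqsubseteq> i" if y: "y \<in> Lower L M" for y
    proof -
      have yc: "y \<in> carrier L" using y by (auto simp: Lower_def)
      have "r y \<subseteq> topspace Y \<inter> \<Inter>(r ` M)"
        using y M le_iff[OF yc] openin_subset[OF open_r[OF yc]] by (auto simp: Lower_def)
      then have "r y \<subseteq> ?W" using open_r[OF yc] by (rule interior_of_maximal)
      then show ?thesis using i le_iff[OF yc i(1)] by simp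
    qed
  qed (use M i in auto)
  then show "\<exists>i. greatest L i (Lower L M)" by blast
qed

lemma r_meet:
  assumes "a \<in> carrier L" "b \<in> carrier L" shows "r (a \<sqinter> b) = r a \<inter> r b"
proof
  have c: "a \<sqinter> b \<in> carrier L" using assms by simp
  show "r (a \<sqinter> b) \<subseteq> r a \<inter> r b"
    using assms c le_iff[OF c assms(1)] le_iff[OF c assms(2)] meet_left meet_right by simp
  obtain i where i: "i \<in> carrier L" "r i = r a \<inter> r b"
    using r_surj[OF regular_open_Int[OF r_in r_in]] assms by metis
  then have "i \<sqsubseteq> a \<sqinter> b" using assms by (intro meet_le) (simp_all add: le_iff)
  then show "r a \<inter> r b \<subseteq> r (a \<sqinter> b)" using le_iff[OF i(1) c] i by simp
qed

lemma r_join: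
  assumes "a \<in> carrier L" "b \<in> carrier L"
  shows "r (a \<squnion> b) = Y interior_of (Y closure_of (r a \<union> r b))"
proof
  have c: "a \<squnion> b \<in> carrier L" using assms by simp
  have op: "openin Y (r a \<union> r b)" using assms open_r by blast
  have "r a \<union> r b \<subseteq> r (a \<squnion> b)"
    using assms c le_iff[OF assms(1) c] le_iff[OF assms(2) c] join_left join_right by simp
  then show "Y interior_of (Y closure_of (r a \<union> r b)) \<subseteq> r (a \<squnion> b)"
    using regular_open_hull(3)[OF op r_in[OF c]] by blast
  obtain j where j: "j \<in> carrier L" "r j = Y interior_of (Y closure_of (r a \<union> r b))"
    using r_surj[OF regular_open_hull(1)[OF op]] .
  then have "a \<squnion> b \<sqsubseteq> j"
    using assms regular_open_hull(2)[OF op] by (intro join_le) (simp_all add: le_iff)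
  then show "r (a \<squnion> b) \<subseteq> Y interior_of (Y closure_of (r a \<union> r b))" using le_iff[OF c j(1)] j by simp
qed

lemma r_bottom: "r \<bottom> = {}"
proof -
  have "{} \<in> regular_opens Y" by (simp add: regular_opens_def)
  then obtain e where "e \<in> carrier L" "r e = {}" using r_surj by metis
  then show ?thesis using le_iff[of \<bottom> e] weak.bottom_lower[of e] by simp
qed

lemma r_top: "r \<top> = topspace Y"
proof -
  have "topspace Y \<in> regular_opens Y" by (simp add: regular_opens_def)
  then obtain e where e: "e \<in> carrier L" "r e = topspace Y" using r_surj by metis
  then have "topspace Y \<subseteq> r \<top>" using le_iff[of e \<top>] weak.top_higher[of e] by simp
  then show ?thesis using openin_subset[OF open_r[of \<top>]] by simp
qed

lemma complement_exists:
  assumes "a \<in> carrier L"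
  shows "\<exists>b\<in>carrier L. a \<squnion> b = \<top> \<and> a \<sqinter> b = \<bottom> \<and> r b = topspace Y - Y closure_of (r a)"
proof -
  have "topspace Y - Y closure_of (r a) \<in> regular_opens Y"
    using interior_of_closed_regular_open[of Y "topspace Y - r a"] open_r[OF assms]
    by (simp add: interior_of_complement closedin_diff)
  then obtain b where b: "b \<in> carrier L" "r b = topspace Y - Y closure_of (r a)" using r_surj by metis
  have sub: "r a \<subseteq> Y closure_of (r a)"
    using openin_subset[OF open_r[OF assms]] by (rule closure_of_subset)
  have "topspace Y \<subseteq> Y closure_of (r a \<union> r b)"
    using closure_of_subset[of "r b" Y] b by (auto simp: closure_of_Un)
  then have "Y closure_of (r a \<union> r b) = topspace Y" by (simp add: closure_of_subset_topspace subset_antisym)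
  then have "r (a \<squnion> b) = r \<top>" using r_join[OF assms b(1)] r_top by simp
  moreover have "r (a \<sqinter> b) = r \<bottom>" using r_meet[OF assms b(1)] r_bottom b sub by auto
  ultimately show ?thesis using b r_eq_iff assms by (intro bexI[of _ b]) auto
qed

sublocale boolean_lattice L
proof unfold_locales
  fix x y z assume c: "x \<in> carrier L" "y \<in> carrier L" "z \<in> carrier L"
  let ?S = "r y \<union> r z" and ?T = "(r x \<inter> r y) \<union> (r x \<inter> r z)"
  have T: "?T = r x \<inter> ?S" by blast
  have opT: "openin Y ?T" using c open_r by blast
  have opS: "openin Y ?S" using c open_r by blast
  have "r x \<inter> Y interior_of (Y closure_of ?S) \<subseteq> Y closure_of ?T"
    using openin_Int_closure_of_subset[OF open_r[OF c(1)], of ?S] interior_of_subset[of Y "Y closure_of ?S"] T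
    by auto
  moreover have "openin Y (r x \<inter> Y interior_of (Y closure_of ?S))" using openin_Int[OF open_r[OF c(1)] openin_interior_of] .
  ultimately have "r x \<inter> Y interior_of (Y closure_of ?S) \<subseteq> Y interior_of (Y closure_of ?T)"
    by (rule interior_of_maximal)
  moreover have "Y interior_of (Y closure_of ?T) \<subseteq> r x"
    using regular_open_hull(3)[OF opT r_in[OF c(1)]] by blast
  moreover have "Y interior_of (Y closure_of ?T) \<subseteq> Y interior_of (Y closure_of ?S)"
    by (intro interior_of_mono closure_of_mono) blast
  ultimately have "r (x \<sqinter> (y \<squnion> z)) = r ((x \<sqinter> y) \<squnion> (x \<sqinter> z))"
    using c by (simp add: r_meet r_join) blast
  then show "x \<sqinter> (y \<squnion> z) = (x \<sqinter> y) \<squnion> (x \<sqinter> z)" using c r_eq_iff by simp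
next
  show "\<exists>y\<in>carrier L. x \<squnion> y = \<top> \<and> x \<sqinter> y = \<bottom>" if "x \<in> carrier L" for x
    using complement_exists[OF that] by blast
qed

lemma complete_boolean: "complete_boolean L"
  using boolean_lattice_axioms complete_lattice_axioms by (simp add: complete_boolean_def)

lemma r_cmpl:
  assumes "a \<in> carrier L" shows "r (cmpl L a) = topspace Y - Y closure_of (r a)"
proof -
  obtain b where b: "b \<in> carrier L" "a \<squnion> b = \<top>" "a \<sqinter> b = \<bottom>" "r b = topspace Y - Y closure_of (r a)"
    using complement_exists[OF assms] by blast
  then have "cmpl L a = b"
    using complement_unique[OF assms cmpl_closed[OF assms] b(1)] assms by (simp add: join_cmpl meet_cmpl)
  then show ?thesis using b by simp
qed

lemma small_regular_open:
  assumes "openin Y U" "y \<in> U"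
  shows "\<exists>a\<in>carrier L. y \<in> r a \<and> Y closure_of (r a) \<subseteq> U"
proof -
  have "regular_space Y"
    using compact_Hausdorff_imp_regular_space compact_Hausdorff_Y by (auto simp: compact_Hausdorff_def)
  then obtain V K where VK: "openin Y V" "closedin Y K" "y \<in> V" "V \<subseteq> K" "K \<subseteq> U"
    using assms unfolding neighbourhood_base_of_closedin[symmetric] neighbourhood_base_of by metis
  obtain a where a: "a \<in> carrier L" "r a = Y interior_of (Y closure_of V)"
    using r_surj[OF regular_open_hull(1)[OF VK(1)]] .
  have "y \<in> r a" using regular_open_hull(2)[OF VK(1)] VK(3) a(2) by blast
  moreover have "Y closure_of (r a) \<subseteq> Y closure_of V"
    unfolding a(2) by (intro closure_of_minimal interior_of_subset closedin_closure_of)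
  moreover have "Y closure_of V \<subseteq> U" using closure_of_minimal[OF VK(4,2)] VK(5) by blast
  ultimately show ?thesis using a(1) by blast
qed

text \<open>The unique point adherent to all members of an ultrafilter. Every regular open set
around it belongs to the ultrafilter, so in a Hausdorff space there is only one.\<close>

definition limit :: "'a set \<Rightarrow> 'y" where
  "limit = (\<lambda>u\<in>topspace (Ult L). SOME y. y \<in> topspace Y \<and> (\<forall>a\<in>u. y \<in> Y closure_of (r a)))"

text \<open>Otherwise the complements of the members cover the space, and by compactness the meet of finitely
many members is the empty set.\<close>

lemma adherent_point_exists:
  assumes u: "ultrafilter_on L u"
  shows "\<exists>y. y \<in> topspace Y \<and> (\<forall>a\<in>u. y \<in> Y closure_of (r a))"
proof (rule ccontr)
  assume no: "\<nexists>y. y \<in> topspace Y \<and> (\<forall>a\<in>u. y \<in> Y closure_of (r a))"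
  have uc: "a \<in> carrier L" if "a \<in> u" for a using that ultrafilter_onD(1)[OF u] by blast
  have "topspace Y \<subseteq> \<Union>((\<lambda>a. r (cmpl L a)) ` u)" using no r_cmpl uc by auto
  moreover have "compactin Y (topspace Y)"
    using compact_Hausdorff_Y by (simp add: compact_Hausdorff_def compact_space_def)
  ultimately have "\<exists>\<F>. finite \<F> \<and> \<F> \<subseteq> (\<lambda>a. r (cmpl L a)) ` u \<and> topspace Y \<subseteq> \<Union>\<F>"
    by (intro compactinD) (use uc open_r in auto)
  then obtain F where F: "finite F" "F \<subseteq> u" "topspace Y \<subseteq> \<Union>((\<lambda>a. r (cmpl L a)) ` F)"
    using finite_subset_image by (metis (no_types, lifting))
  have "\<exists>c\<in>u. r c \<inter> \<Union>((\<lambda>a. r (cmpl L a)) ` F) = {}"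
    using F(1,2)
  proof (induction F)
    case empty
    then show ?case using ultrafilter_onD(2)[OF u] by auto
  next
    case (insert a F)
    then obtain c where c: "c \<in> u" "r c \<inter> \<Union>((\<lambda>a. r (cmpl L a)) ` F) = {}" by auto
    have a: "a \<in> u" using insert by blast
    have "r a \<inter> r (cmpl L a) = {}" using r_meet[of a "cmpl L a"] uc[OF a] meet_cmpl r_bottom by simp
    then have "r (a \<sqinter> c) \<inter> \<Union>((\<lambda>a. r (cmpl L a)) ` insert a F) = {}"
      using c(2) r_meet[OF uc[OF a] uc[OF c(1)]] by auto
    then show ?case using ultrafilter_onD(4)[OF u a c(1)] by blast
  qed
  then obtain c where c: "c \<in> u" "r c = {}"
    using F(3) openin_subset[OF open_r[OF uc]] by blast
  then have "c = \<bottom>" using r_eq_iff[OF uc[OF c(1)], of \<bottom>] r_bottom by simp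
  then show False using c(1) ultrafilter_onD(3)[OF u] by simp
qed

lemma limit:
  assumes "u \<in> topspace (Ult L)"
  shows "limit u \<in> topspace Y" "\<And>a. a \<in> u \<Longrightarrow> limit u \<in> Y closure_of (r a)"
    "\<And>a. a \<in> carrier L \<Longrightarrow> limit u \<in> r a \<Longrightarrow> a \<in> u"
proof -
  have u: "ultrafilter_on L u" using assms by (simp add: topspace_Ult)
  have *: "limit u \<in> topspace Y \<and> (\<forall>a\<in>u. limit u \<in> Y closure_of (r a))"
    using someI_ex[OF adherent_point_exists[OF u]] assms by (simp add: limit_def)
  then show "limit u \<in> topspace Y" "\<And>a. a \<in> u \<Longrightarrow> limit u \<in> Y closure_of (r a)" by blast+
  fix a assume a: "a \<in> carrier L" "limit u \<in> r a"
  show "a \<in> u"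
  proof (rule ccontr)
    assume "a \<notin> u"
    then have "limit u \<in> Y closure_of (r (cmpl L a))" using * ultrafilter_cmpl[OF u a(1)] by blast
    then obtain z where "z \<in> r (cmpl L a)" "z \<in> r a"
      using open_r[OF a(1)] a(2) unfolding in_closure_of by blast
    then show False using r_meet[OF a(1) cmpl_closed[OF a(1)]] meet_cmpl[OF a(1)] r_bottom by auto
  qed
qed

text \<open>Continuity holds because the space is regular, so that small regular open sets have small closures.
For surjectivity, extend the regular open neighbourhoods of a point to an ultrafilter. For
irreducibility, a proper closed set of ultrafilters misses the Stone set of some nonempty
\<open>a\<close>, and no limit of its members can lie in the open set \<open>a\<close>.\<close>

lemma class_P_limit: "class_P (Ult L) Y limit"
proof -
  have cont: "continuous_map (Ult L) Y limit" unfolding continuous_map_def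
  proof (intro conjI allI impI)
    show "limit \<in> topspace (Ult L) \<rightarrow> topspace Y" using limit(1) by blast
    fix U assume U: "openin Y U"
    show "openin (Ult L) {u \<in> topspace (Ult L). limit u \<in> U}"
    proof (subst openin_subopen, intro ballI)
      fix u assume u: "u \<in> {u \<in> topspace (Ult L). limit u \<in> U}"
      then obtain a where a: "a \<in> carrier L" "limit u \<in> r a" "Y closure_of (r a) \<subseteq> U"
        using small_regular_open[OF U] by blast
      have "stone_set L a \<subseteq> {u \<in> topspace (Ult L). limit u \<in> U}"
      proof
        fix v assume v: "v \<in> stone_set L a"
        then have "v \<in> topspace (Ult L)" "a \<in> v" by (simp_all add: mem_stone_set topspace_Ult)
        then show "v \<in> {u \<in> topspace (Ult L). limit u \<in> U}" using limit(2) a(3) by blast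
      qed
      moreover have "u \<in> stone_set L a"
        using u limit(3)[of u a] a by (simp add: mem_stone_set topspace_Ult)
      ultimately show "\<exists>T. openin (Ult L) T \<and> u \<in> T \<and> T \<subseteq> {u \<in> topspace (Ult L). limit u \<in> U}"
        using openin_stone_set[OF a(1)] by blast
    qed
  qed
  have "y \<in> limit ` topspace (Ult L)" if y: "y \<in> topspace Y" for y
  proof -
    have "proper_filter L {a \<in> carrier L. y \<in> r a}"
      unfolding proper_filter_def using y by (auto simp: r_top r_bottom r_meet le_iff)
    then obtain u where u: "ultrafilter_on L u" "{a \<in> carrier L. y \<in> r a} \<subseteq> u"
      using proper_filter_extends by blast
    then have ut: "u \<in> topspace (Ult L)" by (simp add: topspace_Ult)
    have "limit u = y"
    proof (rule ccontr)
      assume "limit u \<noteq> y"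
      moreover have "closedin Y {limit u}"
        using limit(1)[OF ut] compact_Hausdorff_Y closedin_Hausdorff_singleton
        by (auto simp: compact_Hausdorff_def)
      ultimately obtain a where "a \<in> carrier L" "y \<in> r a" "Y closure_of (r a) \<subseteq> topspace Y - {limit u}"
        using small_regular_open[of "topspace Y - {limit u}" y] y by blast
      then show False using limit(2)[OF ut, of a] u(2) by blast
    qed
    then show ?thesis using ut by blast
  qed
  then have surj: "limit ` topspace (Ult L) = topspace Y" using limit(1) by blast
  have "limit ` Z \<noteq> topspace Y" if Z: "closedin (Ult L) Z" "Z \<noteq> topspace (Ult L)" for Z
  proof -
    obtain a where a: "a \<in> carrier L" "a \<noteq> \<bottom>" "Z \<inter> stone_set L a = {}"
      using closedin_Ult_basic_complement[OF Z] by blast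
    have "r a \<noteq> {}" using a r_eq_iff[OF a(1), of \<bottom>] r_bottom by simp
    then obtain y where y: "y \<in> r a" by blast
    have ny: "limit u \<noteq> y" if u: "u \<in> Z" for u
    proof
      assume "limit u = y"
      have ut: "u \<in> topspace (Ult L)" using u closedin_subset[OF Z(1)] by blast
      then have "a \<in> u" using limit(3)[OF ut a(1)] y \<open>limit u = y\<close> by simp
      then have "u \<in> stone_set L a" using ut by (simp add: mem_stone_set topspace_Ult)
      then show False using a(3) u by blast
    qed
    have "y \<in> topspace Y" using y openin_subset[OF open_r[OF a(1)]] by blast
    moreover have "y \<notin> limit ` Z" using ny by blast
    ultimately show ?thesis by metis
  qed
  then show ?thesis
    using cont surj compact_Hausdorff_Y compact_Hausdorff_Ult extremally_disconnected_Ult[OF complete_boolean]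
    by (simp add: class_P_def ext_continuous_def irreducible_map_def limit_def)
qed

end

lemma compact_Hausdorff_dual_algebra:
  fixes Y :: "'y topology" and B :: "'a set"
  assumes Y: "compact_Hausdorff Y" and B: "regular_opens Y \<lesssim> B"
  shows "\<exists>A p. dual_space A p Y \<and> carrier A \<subseteq> B"
proof -
  obtain g where g: "inj_on g (regular_opens Y)" "g ` regular_opens Y \<subseteq> B"
    using B by (auto simp: lepoll_def)
  define r where "r = inv_into (regular_opens Y) g"
  define L :: "'a gorder" where
    "L = \<lparr>carrier = g ` regular_opens Y, eq = (=), le = (\<lambda>a b. r a \<subseteq> r b)\<rparr>"
  interpret regular_open_copy L Y r
    by unfold_locales
      (use g Y in \<open>simp_all add: L_def r_def bij_betw_inv_into inj_on_imp_bij_betw\<close>)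
  have "dual_space (U_ob (L, limit, Y)) limit Y"
    using dual_space_U_ob[OF complete_boolean class_P_limit] .
  moreover have "carrier (U_ob (L, limit, Y)) \<subseteq> B" using g(2) by (simp add: L_def)
  ultimately show ?thesis by blast
qed

section \<open>The categories of the duality\<close>

lemma deVBoo_simps:
  "Ob (deVBoo S) = {A. de_vries_algebra A \<and> S (carrier A)}" "Mor (deVBoo S) = deVBoo_mor"
  "Idt (deVBoo S) A = (\<lambda>a\<in>carrier A. a)" "Cmp (deVBoo S) A A' A'' \<psi> \<phi> = compose (carrier A) \<psi> \<phi>"
  by (simp_all add: deVBoo_def)

lemma Cat_C_simps:
  "Ob (Cat_C S T) = {(L, p, Y). complete_boolean L \<and> class_P (Ult L) Y p \<and> S (carrier L) \<and> T (topspace Y)}"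
  "Mor (Cat_C S T) = C_hom" "Idt (Cat_C S T) = C_id" "Cmp (Cat_C S T) = C_comp"
  by (simp_all add: Cat_C_def)

lemma KHaus_on_simps:
  "Ob (KHaus_on P) = {Y. compact_Hausdorff Y \<and> P Y}" "Mor (KHaus_on P) = ext_continuous"
  "Idt (KHaus_on P) Y = (\<lambda>y\<in>topspace Y. y)" "Cmp (KHaus_on P) X Y Z g f = compose (topspace X) g f"
  by (simp_all add: KHaus_on_def)

lemma ext_continuousD:
  assumes "f \<in> ext_continuous X Y"
  shows "f \<in> extensional (topspace X)" "f \<in> topspace X \<rightarrow> topspace Y"
  using assms by (auto simp: ext_continuous_def continuous_map_def)

lemma category_KHaus_on: "category (KHaus_on P)"
  unfolding category_def KHaus_on_simps
  by (auto simp: id_ext_continuous compose_ext_continuous ext_continuousD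
      compose_Id[OF ext_continuousD(2,1)] Id_compose[OF ext_continuousD(2,1)]
      compose_assoc[OF ext_continuousD(2)])

lemma boolean_hom_funcset: "\<phi> \<in> boolean_hom L M \<Longrightarrow> \<phi> \<in> carrier L \<rightarrow> carrier M"
  by (rule funcsetI) (rule boolean_homD(2))

lemma deVBoo_morD:
  assumes "\<phi> \<in> deVBoo_mor A A'"
  shows "\<phi> \<in> boolean_hom A A'" "\<phi> \<in> carrier A \<rightarrow> carrier A'" "\<phi> \<in> extensional (carrier A)"
    "\<And>a b. \<lbrakk>a \<in> carrier A; b \<in> carrier A; \<phi> a \<frown>\<^bsub>A'\<^esub> \<phi> b\<rbrakk> \<Longrightarrow> a \<frown>\<^bsub>A\<^esub> b"
proof -
  show h: "\<phi> \<in> boolean_hom A A'"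
    and "\<And>a b. \<lbrakk>a \<in> carrier A; b \<in> carrier A; \<phi> a \<frown>\<^bsub>A'\<^esub> \<phi> b\<rbrakk> \<Longrightarrow> a \<frown>\<^bsub>A\<^esub> b"
    using assms by (auto simp: deVBoo_mor_def)
  show "\<phi> \<in> carrier A \<rightarrow> carrier A'" "\<phi> \<in> extensional (carrier A)"
    using boolean_hom_funcset[OF h] boolean_homD(1)[OF h] .
qed

lemma de_vries_boolean: "de_vries_algebra A \<Longrightarrow> boolean_lattice A"
  by (simp add: de_vries_algebra_def complete_boolean_def)

lemma category_deVBoo: "category (deVBoo S)"
  unfolding category_def deVBoo_simps
proof (intro conjI ballI; unfold mem_Collect_eq; (elim conjE)?)
  fix A :: "'a contact_lattice" assume A: "de_vries_algebra A"
  show "(\<lambda>a\<in>carrier A. a) \<in> deVBoo_mor A A"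
    using id_boolean_hom[OF de_vries_boolean[OF A]] by (simp add: deVBoo_mor_def)
  fix A' :: "'a contact_lattice"
  { fix \<phi> assume \<phi>: "\<phi> \<in> deVBoo_mor A A'"
    show "compose (carrier A) \<phi> (\<lambda>a\<in>carrier A. a) = \<phi>" "compose (carrier A) (\<lambda>a\<in>carrier A'. a) \<phi> = \<phi>"
      using compose_Id[OF deVBoo_morD(2,3)[OF \<phi>]] Id_compose[OF deVBoo_morD(2,3)[OF \<phi>]] . }
  fix A'' :: "'a contact_lattice" and \<phi> \<psi> assume \<phi>: "\<phi> \<in> deVBoo_mor A A'" and \<psi>: "\<psi> \<in> deVBoo_mor A' A''"
  show "compose (carrier A) \<psi> \<phi> \<in> deVBoo_mor A A''"
  proof -
    have "a \<frown>\<^bsub>A\<^esub> b" if "a \<in> carrier A" "b \<in> carrier A"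
      "compose (carrier A) \<psi> \<phi> a \<frown>\<^bsub>A''\<^esub> compose (carrier A) \<psi> \<phi> b" for a b
      using that deVBoo_morD(4)[OF \<psi>, of "\<phi> a" "\<phi> b"] deVBoo_morD(4)[OF \<phi>, of a b]
        boolean_homD(2)[OF deVBoo_morD(1)[OF \<phi>]] by (simp add: compose_def)
    then show ?thesis
      using compose_boolean_hom[OF deVBoo_morD(1)[OF \<phi>] deVBoo_morD(1)[OF \<psi>] de_vries_boolean[OF A]]
      by (simp add: deVBoo_mor_def)
  qed
  fix A''' :: "'a contact_lattice" and \<omega>
  show "compose (carrier A) (compose (carrier A') \<omega> \<psi>) \<phi> = compose (carrier A) \<omega> (compose (carrier A) \<psi> \<phi>)"
    using compose_assoc[OF deVBoo_morD(2)[OF \<phi>]] by metis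
qed

text \<open>Some dual space is needed in order to compare morphisms, and for this the type of its points is
immaterial; sets of elements of the algebra always suffice.\<close>

lemma dual_space_in_power_set:
  assumes "de_vries_algebra (A :: 'a contact_lattice)"
  shows "\<exists>p (Y :: 'a set topology). dual_space A p Y"
  using de_vries_dual_space[OF assms lepoll_refl] by blast

text \<open>Equivalent morphisms are those that descend to the same continuous map, and descending is
functorial.\<close>

lemma congruence_deVBoo_rel: "congruence (deVBoo S) deVBoo_rel"
proof (rule congruenceI; unfold deVBoo_simps mem_Collect_eq)
  show "equiv (deVBoo_mor A A') (deVBoo_rel A A')" for A A' :: "'a contact_lattice"
    by (rule equivI) (auto simp: deVBoo_rel_def refl_on_def sym_def trans_def)
next
  fix A A' A'' :: "'a contact_lattice" and \<phi> \<phi>' \<psi> \<psi>'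
  assume A: "de_vries_algebra A \<and> S (carrier A)" "de_vries_algebra A' \<and> S (carrier A')"
    "de_vries_algebra A'' \<and> S (carrier A'')"
    and \<phi>: "(\<phi>, \<phi>') \<in> deVBoo_rel A A'" and \<psi>: "(\<psi>, \<psi>') \<in> deVBoo_rel A' A''"
  show "(compose (carrier A) \<psi> \<phi>, compose (carrier A) \<psi>' \<phi>') \<in> deVBoo_rel A A''"
  proof -
    obtain p p' p'' and Y Y' Y'' :: "'a set topology" where
      ds: "dual_space A p Y" "dual_space A' p' Y'" "dual_space A'' p'' Y''"
      using dual_space_in_power_set A by metis
    interpret a: dual_space_pair A p Y A' p' Y' using ds by (simp add: dual_space_pair_def)
    interpret b: dual_space_pair A' p' Y' A'' p'' Y'' using ds by (simp add: dual_space_pair_def)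
    interpret c: dual_space_pair A p Y A'' p'' Y'' using ds by (simp add: dual_space_pair_def)
    have m: "\<phi> \<in> deVBoo_mor A A'" "\<phi>' \<in> deVBoo_mor A A'" "\<psi> \<in> deVBoo_mor A' A''" "\<psi>' \<in> deVBoo_mor A' A''"
      using \<phi> \<psi> by (auto simp: deVBoo_rel_def)
    obtain f f' g g' where f: "a.dual \<phi> f" "a.dual \<phi>' f'" "b.dual \<psi> g" "b.dual \<psi>' g'"
      using m a.mor_imp_dual b.mor_imp_dual by metis
    have "f = f'" "g = g'" using a.deVBoo_rel_iff b.deVBoo_rel_iff f \<phi> \<psi> by blast+
    then show "(compose (carrier A) \<psi> \<phi>, compose (carrier A) \<psi>' \<phi>') \<in> deVBoo_rel A A''"
      using c.deVBoo_rel_iff[OF dual_map_compose[OF ds f(1,3)] dual_map_compose[OF ds f(2,4)]] by simp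
  qed
qed

lemma dual_map_id:
  assumes "dual_space A p Y"
  shows "dual_map A p Y A p Y (\<lambda>a\<in>carrier A. a) (\<lambda>y\<in>topspace Y. y)"
proof -
  interpret dual_space A p Y by fact
  have "{a \<in> carrier A. (\<lambda>a\<in>carrier A. a) a \<in> u} = u" if "u \<in> topspace (Ult A)" for u
    using that ultrafilter_onD(1) by (auto simp: topspace_Ult)
  then show ?thesis unfolding dual_map_def
    using id_boolean_hom[OF boolean_lattice_axioms] id_ext_continuous p_in by simp
qed

text \<open>The classes of morphisms between two algebras correspond to the continuous maps between their dual
spaces.\<close>

lemma dual_maps_form_class:
  assumes A: "dual_space A p Y" and A': "dual_space A' p' Y'" and \<phi>: "dual_map A p Y A' p' Y' \<phi> f"
  shows "{\<psi>. dual_map A p Y A' p' Y' \<psi> f} = deVBoo_rel A A' `` {\<phi>}"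
proof -
  interpret dual_space_pair A p Y A' p' Y' using A A' by (simp add: dual_space_pair_def)
  have "dual \<psi> f" if "(\<phi>, \<psi>) \<in> deVBoo_rel A A'" for \<psi>
  proof -
    have "\<psi> \<in> deVBoo_mor A A'" using that by (simp add: deVBoo_rel_def)
    then obtain g where g: "dual \<psi> g" using mor_imp_dual by blast
    then show ?thesis using deVBoo_rel_iff[OF \<phi> g] that by simp
  qed
  moreover have "(\<phi>, \<psi>) \<in> deVBoo_rel A A'" if "dual \<psi> f" for \<psi>
    using deVBoo_rel_iff[OF \<phi> that] by simp
  ultimately show ?thesis by blast
qed

text \<open>The identity of the common dual space lifts in both directions, and both composites descend to the
identity.\<close>

lemma same_dual_space_iso:
  assumes ds: "dual_space A p Y" "dual_space A' p' Y" and S: "S (carrier A)" "S (carrier A')"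
  shows "\<exists>\<Phi>. iso_mor (deVBoo_quot S) A A' \<Phi>"
proof -
  interpret a: dual_space_pair A p Y A' p' Y using ds by (simp add: dual_space_pair_def)
  interpret b: dual_space_pair A' p' Y A p Y using ds by (simp add: dual_space_pair_def)
  interpret c: dual_space_pair A p Y A p Y using ds by (simp add: dual_space_pair_def)
  interpret d: dual_space_pair A' p' Y A' p' Y using ds by (simp add: dual_space_pair_def)
  let ?i = "\<lambda>y\<in>topspace Y. y"
  obtain \<phi> \<psi> where \<phi>: "a.dual \<phi> ?i" and \<psi>: "b.dual \<psi> ?i"
    using a.dual_map_exists b.dual_map_exists id_ext_continuous by metis
  have ii: "compose (topspace Y) ?i ?i = ?i" by (auto simp: compose_def)
  have o: "A \<in> Ob (deVBoo S)" "A' \<in> Ob (deVBoo S)"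
    using S a.A.de_vries a.A'.de_vries by (simp_all add: deVBoo_simps)
  have m: "\<phi> \<in> Mor (deVBoo S) A A'" "\<psi> \<in> Mor (deVBoo S) A' A"
    using a.dual_imp_mor[OF \<phi>] b.dual_imp_mor[OF \<psi>] by (simp_all add: deVBoo_simps)
  have 1: "deVBoo_rel A A `` {compose (carrier A) \<psi> \<phi>} = deVBoo_rel A A `` {\<lambda>a\<in>carrier A. a}"
    using dual_maps_form_class[OF ds(1) ds(1) dual_map_id[OF ds(1)]]
      dual_maps_form_class[OF ds(1) ds(1), of "compose (carrier A) \<psi> \<phi>" ?i]
      dual_map_compose[OF ds(1,2,1) \<phi> \<psi>] ii by simp
  have 2: "deVBoo_rel A' A' `` {compose (carrier A') \<phi> \<psi>} = deVBoo_rel A' A' `` {\<lambda>a\<in>carrier A'. a}"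
    using dual_maps_form_class[OF ds(2) ds(2) dual_map_id[OF ds(2)]]
      dual_maps_form_class[OF ds(2) ds(2), of "compose (carrier A') \<phi> \<psi>" ?i]
      dual_map_compose[OF ds(2,1,2) \<psi> \<phi>] ii by simp
  note Q = quotient_cat_Cmp[OF congruence_deVBoo_rel category_deVBoo]
  have "iso_mor (deVBoo_quot S) A A' (deVBoo_rel A A' `` {\<phi>})"
    unfolding iso_mor_def quotient_cat_simps
  proof (intro conjI bexI)
    show "deVBoo_rel A A' `` {\<phi>} \<in> Mor (deVBoo S) A A' // deVBoo_rel A A'"
      "deVBoo_rel A' A `` {\<psi>} \<in> Mor (deVBoo S) A' A // deVBoo_rel A' A"
      using m by (simp_all add: quotientI)
    show "Cmp (deVBoo_quot S) A A' A (deVBoo_rel A' A `` {\<psi>}) (deVBoo_rel A A' `` {\<phi>}) =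
        deVBoo_rel A A `` {Idt (deVBoo S) A}"
      using Q[OF o(1,2,1) m] 1 by (simp add: deVBoo_simps)
    show "Cmp (deVBoo_quot S) A' A A' (deVBoo_rel A A' `` {\<phi>}) (deVBoo_rel A' A `` {\<psi>}) =
        deVBoo_rel A' A' `` {Idt (deVBoo S) A'}"
      using Q[OF o(2,1,2) m(2,1)] 2 by (simp add: deVBoo_simps)
  qed
  then show ?thesis by blast
qed

section \<open>The equivalence\<close>

text \<open>The squares of \<open>C\<close> refer to the Stone space of the bare lattice; those used above refer to the
Stone space of the contact algebra built on it, which is the same.\<close>

lemma C_hom_iff:
  fixes L L' :: "'a gorder"
  shows "(\<phi>, f) \<in> C_hom (L, p, Y) (L', p', Y') \<longleftrightarrow>
    dual_map (U_ob (L, p, Y)) p Y (U_ob (L', p', Y')) p' Y' \<phi> f"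
proof -
  let ?A = "U_ob (L, p, Y)" and ?A' = "U_ob (L', p', Y')"
  have c: "carrier ?A = carrier L" "le ?A = le L" "carrier ?A' = carrier L'" "le ?A' = le L'" by simp_all
  note o = order_structure_cong[OF c(1,2)] order_structure_cong[OF c(3,4)]
  have "boolean_hom ?A ?A' = boolean_hom L L'" unfolding boolean_hom_def o c(1,3) ..
  moreover have "compose (topspace (Ult L')) p (Ult_map L L' \<phi>) = compose (topspace (Ult L')) f p' \<longleftrightarrow>
      (\<forall>u\<in>topspace (Ult L'). p {a \<in> carrier L. \<phi> a \<in> u} = f (p' u))"
    unfolding compose_def Ult_map_def by (auto simp: restrict_def fun_eq_iff)
  ultimately show ?thesis
    by (auto simp: dual_map_def ultrafilter_cong(3)[OF c(3,4)] c(1) simp del: U_ob.simps)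
qed

lemma C_homD:
  assumes "(\<phi>, f) \<in> C_hom (L, p, Y) (L', p', Y')"
  shows "\<phi> \<in> carrier L \<rightarrow> carrier L'" "\<phi> \<in> extensional (carrier L)"
    "f \<in> topspace Y' \<rightarrow> topspace Y" "f \<in> extensional (topspace Y')"
proof -
  have "\<phi> \<in> boolean_hom L L'" "f \<in> ext_continuous Y' Y" using assms by auto
  then show "\<phi> \<in> carrier L \<rightarrow> carrier L'" "\<phi> \<in> extensional (carrier L)"
    "f \<in> topspace Y' \<rightarrow> topspace Y" "f \<in> extensional (topspace Y')"
    using boolean_hom_funcset boolean_homD(1) ext_continuousD by blast+
qed

lemma Cat_C_dual_space:
  assumes "(L, p, Y) \<in> Ob (Cat_C S T)"
  shows "dual_space (U_ob (L, p, Y)) p Y" "complete_boolean L" "class_P (Ult L) Y p"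
    "S (carrier L)" "T (topspace Y)"
proof -
  show 1: "complete_boolean L" "class_P (Ult L) Y p" "S (carrier L)" "T (topspace Y)"
    using assms by (simp_all add: Cat_C_simps)
  show "dual_space (U_ob (L, p, Y)) p Y" using dual_space_U_ob[OF 1(1,2)] .
qed

lemma category_Cat_C: "category (Cat_C S T)"
proof -
  have id: "C_id X \<in> C_hom X X" if X: "X \<in> Ob (Cat_C S T)" for X
  proof -
    obtain L p Y where X': "X = (L, p, Y)" by (cases X)
    note d = Cat_C_dual_space[OF X[unfolded X']]
    have "dual_map (U_ob (L, p, Y)) p Y (U_ob (L, p, Y)) p Y (\<lambda>a\<in>carrier L. a) (\<lambda>y\<in>topspace Y. y)"
      using dual_map_id[OF d(1)] by simp
    then show ?thesis unfolding C_hom_iff[symmetric] X' by simp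
  qed
  have comp: "C_comp X X' X'' y x \<in> C_hom X X''"
    if X: "X \<in> Ob (Cat_C S T)" "X' \<in> Ob (Cat_C S T)" "X'' \<in> Ob (Cat_C S T)"
      and x: "x \<in> C_hom X X'" and y: "y \<in> C_hom X' X''" for X X' X'' x y
  proof -
    obtain L p Y L' p' Y' L'' p'' Y'' \<phi> f \<psi> g where
      eq: "X = (L, p, Y)" "X' = (L', p', Y')" "X'' = (L'', p'', Y'')" "x = (\<phi>, f)" "y = (\<psi>, g)"
      by (metis surj_pair)
    note d = Cat_C_dual_space[OF X(1)[unfolded eq]]
    note d' = Cat_C_dual_space[OF X(2)[unfolded eq]]
    note d'' = Cat_C_dual_space[OF X(3)[unfolded eq]]
    have "(compose (carrier (U_ob (L, p, Y))) \<psi> \<phi>, compose (topspace Y'') f g) \<in> C_hom (L, p, Y) (L'', p'', Y'')"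
      unfolding C_hom_iff
      by (rule dual_map_compose[OF d(1) d'(1) d''(1)])
        (use x y in \<open>simp_all only: eq C_hom_iff\<close>)
    then show ?thesis unfolding eq C_comp.simps by (simp only: U_ob.simps) simp
  qed
  have assoc: "C_comp X X' X''' (C_comp X' X'' X''' z y) x = C_comp X X'' X''' z (C_comp X X' X'' y x)"
    if x: "x \<in> C_hom X X'" and y: "y \<in> C_hom X' X''" and z: "z \<in> C_hom X'' X'''" for X X' X'' X''' x y z
  proof -
    obtain L p Y L' p' Y' L'' p'' Y'' L''' p''' Y''' \<phi> f \<psi> g \<omega> h where
      eq: "X = (L, p, Y)" "X' = (L', p', Y')" "X'' = (L'', p'', Y'')" "X''' = (L''', p''', Y''')"
        "x = (\<phi>, f)" "y = (\<psi>, g)" "z = (\<omega>, h)"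
      by (metis surj_pair)
    show ?thesis
      by (simp add: eq compose_assoc[OF C_homD(1)[OF x[unfolded eq]]]
          compose_assoc[OF C_homD(3)[OF z[unfolded eq]]])
  qed
  have unit: "C_comp X X X' x (C_id X) = x \<and> C_comp X X' X' (C_id X') x = x"
    if x: "x \<in> C_hom X X'" for X X' x
  proof -
    obtain L p Y L' p' Y' \<phi> f where
      eq: "X = (L, p, Y)" "X' = (L', p', Y')" "x = (\<phi>, f)"
      by (metis surj_pair)
    note d = C_homD[OF x[unfolded eq]]
    show ?thesis using compose_Id[OF d(1,2)] compose_Id[OF d(3,4)] Id_compose[OF d(1,2)] Id_compose[OF d(3,4)]
      by (simp add: eq)
  qed
  show ?thesis unfolding category_def Cat_C_simps(2-4)
    using id comp assoc unit by blast
qed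

lemma congruence_C_rel:
  fixes S :: "'a set \<Rightarrow> bool" and T :: "'y set \<Rightarrow> bool"
  shows "congruence (Cat_C S T) C_rel"
proof (rule congruenceI)
  show "equiv (Mor (Cat_C S T) X X') (C_rel X X')" for X X'
    by (rule equivI) (auto simp: C_rel_def refl_on_def sym_def trans_def Cat_C_simps simp del: C_hom.simps)
next
  fix X X' X'' :: "('a, 'y) C_ob" and x x' y y'
  assume o: "X \<in> Ob (Cat_C S T)" "X' \<in> Ob (Cat_C S T)" "X'' \<in> Ob (Cat_C S T)"
    and x: "(x, x') \<in> C_rel X X'" and y: "(y, y') \<in> C_rel X' X''"
  have comp: "C_comp X X' X'' b a \<in> C_hom X X''" if "a \<in> C_hom X X'" "b \<in> C_hom X' X''" for a b
    using categoryD(2)[OF category_Cat_C o] that by (simp add: Cat_C_simps)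
  obtain L p Y L' p' Y' L'' p'' Y'' where
    eq: "X = (L, p, Y)" "X' = (L', p', Y')" "X'' = (L'', p'', Y'')" by (metis surj_pair)
  obtain \<phi> f \<phi>' f' \<psi> g \<psi>' g' where
    xy: "x = (\<phi>, f)" "x' = (\<phi>', f')" "y = (\<psi>, g)" "y' = (\<psi>', g')" by (metis surj_pair)
  have h: "x \<in> C_hom X X'" "x' \<in> C_hom X X'" "y \<in> C_hom X' X''" "y' \<in> C_hom X' X''" "f = f'" "g = g'"
    using x y unfolding xy C_rel_def by blast+
  have "C_comp X X' X'' y x \<in> C_hom X X''" "C_comp X X' X'' y' x' \<in> C_hom X X''"
    using comp h by blast+
  then show "(Cmp (Cat_C S T) X X' X'' y x, Cmp (Cat_C S T) X X' X'' y' x') \<in> C_rel X X''"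
    unfolding Cat_C_simps using h(5,6) by (auto simp: C_rel_def eq xy simp del: C_hom.simps)
qed

lemma dual_space_small:
  fixes S :: "'a set \<Rightarrow> bool" and T :: "'y set \<Rightarrow> bool"
  assumes "size_class T" "powerset_bounded S T" "de_vries_algebra A" "S (carrier A)"
  shows "\<exists>p (Y :: 'y topology). dual_space A p Y \<and> T (topspace Y)"
proof -
  obtain B where B: "T B" "Pow (carrier A) \<lesssim> B" using assms(2,4) by (auto simp: powerset_bounded_def)
  then obtain p and Y :: "'y topology" where "dual_space A p Y" "topspace Y \<subseteq> B"
    using de_vries_dual_space[OF assms(3)] by blast
  then show ?thesis using assms(1) B(1) unfolding size_class_def by blast
qed

definition U_func :: "(('a, 'y) C_ob, ('a, 'y) C_mor, 'a contact_lattice, 'a \<Rightarrow> 'a) func" where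
  "U_func = \<lparr>on_ob = U_ob, on_mor = (\<lambda>X X'. fst)\<rparr>"

lemma U_func_simps: "on_ob U_func = U_ob" "on_mor U_func X X' = fst"
  by (simp_all add: U_func_def)

lemma U_bar_eq: "U_bar = quotient_functor deVBoo_rel U_func"
  by (simp add: U_bar_def quotient_functor_def U_func_def case_prod_unfold)

lemma U_ob_in:
  assumes "(L, p, Y) \<in> Ob (Cat_C S T)" shows "U_ob (L, p, Y) \<in> Ob (deVBoo S)"
  using dual_space.de_vries[OF Cat_C_dual_space(1)[OF assms]] Cat_C_dual_space(4)[OF assms]
  by (simp add: deVBoo_simps)

lemma Cat_C_pair:
  assumes "(L, p, Y) \<in> Ob (Cat_C S T)" "(L', p', Y') \<in> Ob (Cat_C S T)"
  shows "dual_space_pair (U_ob (L, p, Y)) p Y (U_ob (L', p', Y')) p' Y'"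
  using Cat_C_dual_space(1)[OF assms(1)] Cat_C_dual_space(1)[OF assms(2)] by (simp only: dual_space_pair_def)

lemma is_functor_U_func:
  fixes S :: "'a set \<Rightarrow> bool" and T :: "'y set \<Rightarrow> bool"
  shows "is_functor (Cat_C S T) (deVBoo S) U_func"
  unfolding is_functor_def U_func_simps
proof (intro conjI ballI)
  show "category (Cat_C S T)" "category (deVBoo S)" by (rule category_Cat_C category_deVBoo)+
  fix X :: "('a, 'y) C_ob" assume X: "X \<in> Ob (Cat_C S T)"
  obtain L p Y where eq: "X = (L, p, Y)" by (cases X)
  show "U_ob X \<in> Ob (deVBoo S)" using U_ob_in X eq by blast
  show "fst (Idt (Cat_C S T) X) = Idt (deVBoo S) (U_ob X)"
    by (simp add: eq Cat_C_simps deVBoo_simps)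
  fix X' :: "('a, 'y) C_ob" assume X': "X' \<in> Ob (Cat_C S T)"
  obtain L' p' Y' where eq': "X' = (L', p', Y')" by (cases X')
  { fix x assume x: "x \<in> Mor (Cat_C S T) X X'"
    obtain \<phi> f where xe: "x = (\<phi>, f)" by (cases x)
    have "dual_map (U_ob (L, p, Y)) p Y (U_ob (L', p', Y')) p' Y' \<phi> f"
      using x by (simp only: Cat_C_simps eq eq' xe C_hom_iff)
    then show "fst x \<in> Mor (deVBoo S) (U_ob X) (U_ob X')"
      using dual_space_pair.dual_imp_mor[OF Cat_C_pair[OF X[unfolded eq] X'[unfolded eq']]]
      by (simp only: deVBoo_simps eq eq' xe fst_conv) }
  fix X'' :: "('a, 'y) C_ob" and x y :: "('a, 'y) C_mor"
  obtain L'' p'' Y'' where eq'': "X'' = (L'', p'', Y'')" by (cases X'')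
  obtain \<phi> f \<psi> g where xe: "x = (\<phi>, f)" "y = (\<psi>, g)" by (metis surj_pair)
  show "fst (Cmp (Cat_C S T) X X' X'' y x) = Cmp (deVBoo S) (U_ob X) (U_ob X') (U_ob X'') (fst y) (fst x)"
    by (simp add: Cat_C_simps deVBoo_simps eq eq' eq'' xe)
qed

text \<open>Fullness is the descent of a homomorphism to dual spaces, faithfulness the agreement of the two
relations. For essential surjectivity, forget the contact relation of an algebra and keep one of its
dual spaces. The contact relation returned by the functor can differ from the given one outside
the carrier, so the outcome is isomorphic, though possibly not equal, to the given algebra.\<close>

theorem U_bar_equivalence:
  fixes S :: "'a set \<Rightarrow> bool" and T :: "'y set \<Rightarrow> bool"
  assumes T: "size_class T" and ST: "powerset_bounded S T"
  shows "is_equivalence (C_quot S T) (deVBoo_quot S) U_bar"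
proof -
  have full: "\<exists>x\<in>Mor (Cat_C S T) X X'. on_mor U_func X X' x = \<phi>"
    if X: "X \<in> Ob (Cat_C S T)" "X' \<in> Ob (Cat_C S T)"
      and \<phi>: "\<phi> \<in> Mor (deVBoo S) (on_ob U_func X) (on_ob U_func X')" for X X' \<phi>
  proof -
    obtain L p Y L' p' Y' where eq: "X = (L, p, Y)" "X' = (L', p', Y')" by (metis surj_pair)
    interpret dual_space_pair "U_ob (L, p, Y)" p Y "U_ob (L', p', Y')" p' Y'
      using Cat_C_pair X unfolding eq .
    have "\<phi> \<in> deVBoo_mor (U_ob (L, p, Y)) (U_ob (L', p', Y'))"
      using \<phi> by (simp only: deVBoo_simps U_func_simps eq)
    then obtain f where "dual \<phi> f" using mor_imp_dual by blast
    then have "(\<phi>, f) \<in> C_hom X X'"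
      unfolding eq C_hom_iff .
    then show ?thesis by (intro bexI[of _ "(\<phi>, f)"]) (simp_all only: U_func_simps fst_conv Cat_C_simps)
  qed
  have ker: "(on_mor U_func X X' x, on_mor U_func X X' y) \<in> deVBoo_rel (on_ob U_func X) (on_ob U_func X')
      \<longleftrightarrow> (x, y) \<in> C_rel X X'"
    if X: "X \<in> Ob (Cat_C S T)" "X' \<in> Ob (Cat_C S T)"
      and x: "x \<in> Mor (Cat_C S T) X X'" and y: "y \<in> Mor (Cat_C S T) X X'" for X X' x y
  proof -
    obtain L p Y L' p' Y' where eq: "X = (L, p, Y)" "X' = (L', p', Y')" by (metis surj_pair)
    obtain \<phi> f \<psi> g where xy: "x = (\<phi>, f)" "y = (\<psi>, g)" by (metis surj_pair)
    interpret dual_space_pair "U_ob (L, p, Y)" p Y "U_ob (L', p', Y')" p' Y'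
      using Cat_C_pair X unfolding eq .
    have h: "(\<phi>, f) \<in> C_hom X X'" "(\<psi>, g) \<in> C_hom X X'" using x y by (simp_all only: Cat_C_simps xy)
    then have "dual \<phi> f" "dual \<psi> g"
      unfolding eq C_hom_iff .
    then have "(\<phi>, \<psi>) \<in> deVBoo_rel (U_ob X) (U_ob X') \<longleftrightarrow> f = g" unfolding eq by (rule deVBoo_rel_iff)
    then show ?thesis using h by (simp add: U_func_simps xy C_rel_def del: U_ob.simps C_hom.simps)
  qed
  note Q = quotient_functor[OF is_functor_U_func congruence_C_rel congruence_deVBoo_rel full ker, folded U_bar_eq]
  have "essentially_surjective (C_quot S T) (deVBoo_quot S) U_bar"
    unfolding essentially_surjective_def quotient_cat_simps
  proof
    fix A assume "A \<in> Ob (deVBoo S)"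
    then have A: "de_vries_algebra A" "S (carrier A)" by (simp_all add: deVBoo_simps)
    obtain p and Y :: "'y topology" where d: "dual_space A p Y" "T (topspace Y)"
      using dual_space_small[OF T ST A] by blast
    interpret dual_space A p Y by fact
    let ?L = "gorder.truncate A"
    have c: "carrier A = carrier ?L" "le A = le ?L" "eq A = eq ?L" by (simp_all add: gorder.truncate_def)
    have X: "(?L, p, Y) \<in> Ob (Cat_C S T)"
      using complete_boolean_cong[OF c complete] in_class_P A(2) d(2) ultrafilter_cong(3)[OF c(1,2)] c(1)
      by (simp add: Cat_C_simps)
    have "S (carrier (U_ob (?L, p, Y)))" using A(2) c(1) by simp
    then have "\<exists>\<Phi>. iso_mor (deVBoo_quot S) (U_ob (?L, p, Y)) A \<Phi>"
      using same_dual_space_iso[where S = S, OF Cat_C_dual_space(1)[OF X] d(1)] A(2) by blast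
    then show "\<exists>X\<in>Ob (Cat_C S T). \<exists>\<Phi>. iso_mor (deVBoo_quot S) (on_ob U_bar X) A \<Phi>"
      using X by (intro bexI[of _ "(?L, p, Y)"]) (simp_all add: U_bar_def del: U_ob.simps)
  qed
  then show ?thesis using fully_faithful_essentially_surjective_equivalence Q by blast
qed

text \<open>The functor sends a space to a chosen algebra dual to it and a continuous map to the class of all
homomorphisms that descend to it, which is nonempty by lifting. Hence it needs no choice of
lifts, and its functoriality is that of descent.\<close>

theorem KHaus_slice_duality:
  fixes S :: "'a set \<Rightarrow> bool" and T :: "'y set \<Rightarrow> bool"
  assumes S: "size_class S" and T: "size_class T" and ST: "powerset_bounded S T"
  shows "dually_equivalent (KHaus_slice S T) (deVBoo_quot S)"
proof -
  let ?K = "KHaus_slice S T"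
  have ob: "Ob ?K = {Y. compact_Hausdorff Y \<and> T (topspace Y) \<and> (\<exists>B. S B \<and> regular_opens Y \<lesssim> B)}"
    by (simp add: KHaus_slice_def KHaus_on_simps)
  have "\<exists>A p. dual_space A p Y \<and> S (carrier A)" if "Y \<in> Ob ?K" for Y
  proof -
    have Y: "compact_Hausdorff Y" "\<exists>B. S B \<and> regular_opens Y \<lesssim> B" using that by (auto simp: ob)
    then obtain B where "S B" "regular_opens Y \<lesssim> B" by blast
    then show ?thesis
      using compact_Hausdorff_dual_algebra[OF Y(1)] S unfolding size_class_def by blast
  qed
  then obtain A p where ds: "\<And>Y. Y \<in> Ob ?K \<Longrightarrow> dual_space (A Y) (p Y) Y"
    and SA: "\<And>Y. Y \<in> Ob ?K \<Longrightarrow> S (carrier (A Y))" by metis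
  define D where "D Y Y' = dual_map (A Y) (p Y) Y (A Y') (p Y') Y'" for Y Y'
  have pair: "dual_space_pair (A Y) (p Y) Y (A Y') (p Y') Y'" if "Y \<in> Ob ?K" "Y' \<in> Ob ?K" for Y Y'
    using ds that by (simp add: dual_space_pair_def)
  have D_ex: "\<exists>\<phi>. D Y Y' \<phi> f" if "Y \<in> Ob ?K" "Y' \<in> Ob ?K" "f \<in> ext_continuous Y' Y" for Y Y' f
    using dual_space_pair.dual_map_exists[OF pair that(3)] that by (simp add: D_def)
  have D_class: "Collect (\<lambda>\<psi>. D Y Y' \<psi> f) = deVBoo_rel (A Y) (A Y') `` {\<phi>}" and D_mor: "\<phi> \<in> deVBoo_mor (A Y) (A Y')"
    if "Y \<in> Ob ?K" "Y' \<in> Ob ?K" "D Y Y' \<phi> f" for Y Y' f \<phi>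
    using dual_maps_form_class[OF ds ds] dual_space_pair.dual_imp_mor[OF pair] that unfolding D_def by blast+
  have AO: "A Y \<in> Ob (deVBoo S)" if "Y \<in> Ob ?K" for Y
    using dual_space.de_vries[OF ds] SA that by (simp add: deVBoo_simps)
  define F where "F = \<lparr>on_ob = A, on_mor = (\<lambda>Y Y' f. Collect (\<lambda>\<phi>. D Y Y' \<phi> f))\<rparr>"
  have catK: "category (opposite ?K)"
    unfolding KHaus_slice_def using category_opposite[OF category_KHaus_on] .
  have op: "Ob (opposite ?K) = Ob ?K" "\<And>Y Y'. Mor (opposite ?K) Y Y' = ext_continuous Y' Y"
    "\<And>Y. Idt (opposite ?K) Y = (\<lambda>y\<in>topspace Y. y)"
    "\<And>Y Y' Y'' g f. Cmp (opposite ?K) Y Y' Y'' g f = compose (topspace Y'') f g"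
    by (simp_all add: opposite_def KHaus_slice_def KHaus_on_simps)
  have F: "on_ob F = A" "\<And>Y Y' f. on_mor F Y Y' f = Collect (\<lambda>\<phi>. D Y Y' \<phi> f)" by (simp_all add: F_def)
  have "is_functor (opposite ?K) (deVBoo_quot S) F"
    unfolding is_functor_def op F quotient_cat_simps
  proof (intro conjI ballI)
    show "category (opposite ?K)" by (rule catK)
    show "category (deVBoo_quot S)" using category_quotient_cat category_deVBoo congruence_deVBoo_rel by blast
    fix Y assume Y: "Y \<in> Ob ?K"
    show "A Y \<in> Ob (deVBoo S)" using AO Y .
    have "D Y Y (\<lambda>a\<in>carrier (A Y). a) (\<lambda>y\<in>topspace Y. y)"
      unfolding D_def using dual_map_id[OF ds[OF Y]] .
    then show "Collect (\<lambda>\<phi>. D Y Y \<phi> (\<lambda>y\<in>topspace Y. y)) = deVBoo_rel (A Y) (A Y) `` {Idt (deVBoo S) (A Y)}"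
      using D_class[OF Y Y] by (simp add: deVBoo_simps)
    fix Y' assume Y': "Y' \<in> Ob ?K"
    { fix f assume "f \<in> ext_continuous Y' Y"
      then obtain \<phi> where \<phi>: "D Y Y' \<phi> f" using D_ex Y Y' by blast
      show "Collect (\<lambda>\<phi>. D Y Y' \<phi> f) \<in> Mor (deVBoo S) (A Y) (A Y') // deVBoo_rel (A Y) (A Y')"
        unfolding D_class[OF Y Y' \<phi>] deVBoo_simps using D_mor[OF Y Y' \<phi>] by (rule quotientI) }
    fix Y'' f g assume Y'': "Y'' \<in> Ob ?K" and f: "f \<in> ext_continuous Y' Y" and g: "g \<in> ext_continuous Y'' Y'"
    obtain \<phi> where \<phi>: "D Y Y' \<phi> f" using D_ex Y Y' f by blast
    obtain \<psi> where \<psi>: "D Y' Y'' \<psi> g" using D_ex Y' Y'' g by blast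
    have c: "D Y Y'' (compose (carrier (A Y)) \<psi> \<phi>) (compose (topspace Y'') f g)"
      unfolding D_def by (rule dual_map_compose[OF ds[OF Y] ds[OF Y'] ds[OF Y'']])
        (use \<phi> \<psi> in \<open>simp_all only: D_def\<close>)
    show "Collect (\<lambda>\<phi>. D Y Y'' \<phi> (compose (topspace Y'') f g)) =
        Cmp (deVBoo_quot S) (A Y) (A Y') (A Y'') (Collect (\<lambda>\<phi>. D Y' Y'' \<phi> g)) (Collect (\<lambda>\<phi>. D Y Y' \<phi> f))"
      unfolding D_class[OF Y Y' \<phi>] D_class[OF Y' Y'' \<psi>] D_class[OF Y Y'' c]
      using quotient_cat_Cmp[OF congruence_deVBoo_rel category_deVBoo AO[OF Y] AO[OF Y'] AO[OF Y'']]
        D_mor[OF Y Y' \<phi>] D_mor[OF Y' Y'' \<psi>] by (simp add: deVBoo_simps)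
  qed
  moreover have "fully_faithful (opposite ?K) (deVBoo_quot S) F"
    unfolding fully_faithful_def op F(1) quotient_cat_simps
  proof (intro ballI)
    fix Y Y' assume Y: "Y \<in> Ob ?K" and Y': "Y' \<in> Ob ?K"
    interpret dual_space_pair "A Y" "p Y" Y "A Y'" "p Y'" Y' using pair Y Y' .
    show "bij_betw (on_mor F Y Y') (ext_continuous Y' Y) (Mor (deVBoo S) (A Y) (A Y') // deVBoo_rel (A Y) (A Y'))"
      unfolding bij_betw_def
    proof
      show "inj_on (on_mor F Y Y') (ext_continuous Y' Y)"
      proof (rule inj_onI)
        fix f g assume f: "f \<in> ext_continuous Y' Y" and g: "g \<in> ext_continuous Y' Y"
          and eq: "on_mor F Y Y' f = on_mor F Y Y' g"
        obtain \<phi> where \<phi>: "D Y Y' \<phi> f" using D_ex Y Y' f by blast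
        then have "D Y Y' \<phi> g" using eq unfolding F by blast
        then show "f = g" using \<phi> dual_unique unfolding D_def by blast
      qed
      show "on_mor F Y Y' ` ext_continuous Y' Y = Mor (deVBoo S) (A Y) (A Y') // deVBoo_rel (A Y) (A Y')"
      proof (intro equalityI subsetI)
        fix \<Theta> assume "\<Theta> \<in> on_mor F Y Y' ` ext_continuous Y' Y"
        then obtain f where f: "f \<in> ext_continuous Y' Y" "\<Theta> = on_mor F Y Y' f" by blast
        obtain \<phi> where \<phi>: "D Y Y' \<phi> f" using D_ex Y Y' f(1) by blast
        show "\<Theta> \<in> Mor (deVBoo S) (A Y) (A Y') // deVBoo_rel (A Y) (A Y')"
          unfolding f(2) F D_class[OF Y Y' \<phi>] deVBoo_simps using D_mor[OF Y Y' \<phi>] by (rule quotientI)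
      next
        fix \<Theta> assume "\<Theta> \<in> Mor (deVBoo S) (A Y) (A Y') // deVBoo_rel (A Y) (A Y')"
        then obtain \<phi> where \<phi>: "\<phi> \<in> deVBoo_mor (A Y) (A Y')" "\<Theta> = deVBoo_rel (A Y) (A Y') `` {\<phi>}"
          unfolding deVBoo_simps by (rule quotientE)
        obtain f where "dual \<phi> f" using mor_imp_dual[OF \<phi>(1)] by blast
        then have f: "D Y Y' \<phi> f" by (simp add: D_def)
        then have "f \<in> ext_continuous Y' Y" by (simp add: D_def dual_map_def)
        moreover have "\<Theta> = on_mor F Y Y' f" unfolding F D_class[OF Y Y' f] \<phi>(2) ..
        ultimately show "\<Theta> \<in> on_mor F Y Y' ` ext_continuous Y' Y" by blast
      qed
    qed
  qed
  moreover have "essentially_surjective (opposite ?K) (deVBoo_quot S) F"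
    unfolding essentially_surjective_def op F quotient_cat_simps
  proof
    fix B assume "B \<in> Ob (deVBoo S)"
    then have B: "de_vries_algebra B" "S (carrier B)" by (simp_all add: deVBoo_simps)
    obtain q and Y :: "'y topology" where d: "dual_space B q Y" "T (topspace Y)"
      using dual_space_small[OF T ST B] by blast
    interpret dual_space B q Y by fact
    have Y: "Y \<in> Ob ?K"
      using d(2) regular_opens_lepoll B(2) in_class_P unfolding ob class_P_def by blast
    have "\<exists>\<Phi>. iso_mor (deVBoo_quot S) (A Y) B \<Phi>"
      using same_dual_space_iso[where S = S, OF ds[OF Y] d(1) SA[OF Y] B(2)] .
    then show "\<exists>Y\<in>Ob ?K. \<exists>\<Phi>. iso_mor (deVBoo_quot S) (A Y) B \<Phi>" using Y by blast
  qed
  ultimately show ?thesis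
    unfolding dually_equivalent_def using fully_faithful_essentially_surjective_equivalence by blast
qed

text \<open>Regular open sets are subsets of the space, so the power set bound makes the second condition of
the slice automatic.\<close>

lemma KHaus_eq_slice:
  fixes S :: "'a set \<Rightarrow> bool" and T :: "'y set \<Rightarrow> bool"
  assumes "powerset_bounded T S"
  shows "KHaus T = KHaus_slice S T"
proof -
  have ex: "\<exists>B. S B \<and> regular_opens Y \<lesssim> B" if Y: "T (topspace Y)" for Y :: "'y topology"
  proof -
    obtain B where B: "S B" "Pow (topspace Y) \<lesssim> B" using assms Y by (auto simp: powerset_bounded_def)
    have "regular_opens Y \<subseteq> Pow (topspace Y)" using openin_regular_open openin_subset by blast
    then show ?thesis using B subset_imp_lepoll lepoll_trans by blast
  qed
  have "(\<lambda>Y. T (topspace Y)) = (\<lambda>Y. T (topspace Y) \<and> (\<exists>B. S B \<and> regular_opens Y \<lesssim> B))"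
    by (rule ext, rule iffI, rule conjI, assumption, erule ex, erule conjunct1)
  then show ?thesis by (simp add: KHaus_def KHaus_slice_def)
qed

theorem theorem4p9:
  fixes S :: "'a set \<Rightarrow> bool" and T :: "'y set \<Rightarrow> bool"
  assumes "size_class S" and "size_class T" and "powerset_bounded S T"
  shows "is_equivalence (C_quot S T) (deVBoo_quot S) U_bar \<and>
    (powerset_bounded T S \<longrightarrow> dually_equivalent (KHaus T) (deVBoo_quot S)) \<and>
    dually_equivalent (KHaus_slice S T) (deVBoo_quot S)"
  using U_bar_equivalence[OF assms(2,3)] KHaus_slice_duality[OF assms] KHaus_eq_slice[of T S] by auto

end
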